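(* Let $H$ be a real Hilbert space and let $A$ be a self-adjoint linear operator on $H$ with dense domain $D(A)$. Let $u_0\in D(A)$, let $p\ge 0$, and let $m:[0,+\infty)\to(0,+\infty)$ be a locally Lipschitz continuous function. Assume that $$\mu:=\inf\{m(\sigma):\sigma\ge 0\}>0,\qquad \nu:=\inf\{\langle Au,u\rangle: u\in D(A),\ |u|=1\}>0 .$$ Then the Cauchy problem $$\frac{1}{(1+t)^p}u'(t)+m\left(|A^{1/2}u(t)|^2\right)Au(t)=0\quad \forall t\ge 0,\qquad u(0)=u_0,$$ has a unique global solution $u\in C^1([0,+\infty);H)\cap C^0([0,+\infty);D(A))$; moreover $u\in C^1((0,+\infty);D(A^\alpha))$ for every $\alpha\ge 0$ (and more generally $u$ is of class $C^{k+1}$, with values in $D(A^\alpha)$ for $t>0$, when $m$ is of class $C^k$). Furthermore there exists a constant $C$ such that $$|u(t)|^2+|A^{1/2}u(t)|^2+|Au(t)|^2+\frac{|u'(t)|^2}{(1+t)^{2p}}\le C\exp\left(-\frac{2\mu\nu}{1+p}(1+t)^{1+p}\right)$$ for every $t\ge 0$.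
   Context: $|x|$ and $\langle x,y\rangle$ denote the norm and scalar product of $H$. The operator $A$ may be unbounded; since it is self-adjoint and nonnegative, the powers $A^\alpha$ ($\alpha\ge 0$) are defined by the spectral theorem on domains $D(A^\alpha)$, which are endowed with the graph norm. *)

theory Defs
  imports "HOL-Analysis.Analysis"
begin

section \<open>Unbounded self-adjoint operators\<close>

text \<open>
  An unbounded operator is a pair of a domain \<open>D\<close> and a map \<open>A\<close> whose values outside \<open>D\<close>
  are irrelevant.  The last conjunct below says that the graph of the adjoint is the graph of
  \<open>A\<close>: the left-hand side states \<open>y \<in> D(A\<^sup>*)\<close> and \<open>A\<^sup>* y = z\<close>.
\<close>

definition linear_operator_on :: "'a::real_vector set \<Rightarrow> ('a \<Rightarrow> 'a) \<Rightarrow> bool" where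
  "linear_operator_on D A \<longleftrightarrow> subspace D \<and>
     (\<forall>x\<in>D. \<forall>y\<in>D. A (x + y) = A x + A y) \<and> (\<forall>c. \<forall>x\<in>D. A (c *\<^sub>R x) = c *\<^sub>R A x)"

definition self_adjoint_operator :: "'a::real_inner set \<Rightarrow> ('a \<Rightarrow> 'a) \<Rightarrow> bool" where
  "self_adjoint_operator D A \<longleftrightarrow> linear_operator_on D A \<and> closure D = UNIV \<and>
     (\<forall>y z. (\<forall>x\<in>D. A x \<bullet> y = x \<bullet> z) \<longleftrightarrow> (y \<in> D \<and> z = A y))"

text \<open>
  The infimum of the quadratic form on the unit sphere, taken in the extended reals so that it
  has the intended value also when the form is unbounded below or the space is trivial.
\<close>

definition numerical_inf :: "'a::real_inner set \<Rightarrow> ('a \<Rightarrow> 'a) \<Rightarrow> ereal" where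
  "numerical_inf D A = (INF u\<in>{u\<in>D. norm u = 1}. ereal (A u \<bullet> u))"

section \<open>Spectral resolution and powers\<close>

definition orth_projector :: "('a::real_inner \<Rightarrow> 'a) \<Rightarrow> bool" where
  "orth_projector P \<longleftrightarrow> bounded_linear P \<and> (\<forall>x. P (P x) = P x) \<and> (\<forall>x y. P x \<bullet> y = x \<bullet> P y)"

definition spectral_family :: "(real \<Rightarrow> 'a::real_inner \<Rightarrow> 'a) \<Rightarrow> bool" where
  "spectral_family E \<longleftrightarrow>
     (\<forall>l. orth_projector (E l)) \<and>
     (\<forall>l l' x. E l (E l' x) = E (min l l') x) \<and>
     (\<forall>l x. ((\<lambda>s. E s x) \<longlongrightarrow> E l x) (at_right l)) \<and>
     (\<forall>x. ((\<lambda>s. E s x) \<longlongrightarrow> 0) at_bot) \<and>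
     (\<forall>x. ((\<lambda>s. E s x) \<longlongrightarrow> x) at_top)"

text \<open>The Stieltjes measure \<open>d\<langle>E(\<lambda>)x, x\<rangle>\<close>.\<close>

definition spectral_measure :: "(real \<Rightarrow> 'a::real_inner \<Rightarrow> 'a) \<Rightarrow> 'a \<Rightarrow> real measure" where
  "spectral_measure E x = interval_measure (\<lambda>l. E l x \<bullet> x)"

text \<open>
  The operator \<open>\<integral> f(\<lambda>) dE(\<lambda>)\<close>.  Its domain is \<open>{x. \<integral> f(\<lambda>)\<^sup>2 d\<langle>E(\<lambda>)x, x\<rangle> < \<infinity>}\<close>, and its value
  at \<open>x\<close> is the vector \<open>z\<close> with \<open>\<langle>z, y\<rangle> = \<integral> f(\<lambda>) d\<langle>E(\<lambda>)x, y\<rangle>\<close> for all \<open>y\<close> in the domain (which is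
  dense); the signed measure on the right is expanded by polarization.
\<close>

definition spectral_integral_dom ::
    "(real \<Rightarrow> 'a::real_inner \<Rightarrow> 'a) \<Rightarrow> (real \<Rightarrow> real) \<Rightarrow> 'a set" where
  "spectral_integral_dom E f = {x. integrable (spectral_measure E x) (\<lambda>l. (f l)\<^sup>2)}"

definition spectral_integral ::
    "(real \<Rightarrow> 'a::real_inner \<Rightarrow> 'a) \<Rightarrow> (real \<Rightarrow> real) \<Rightarrow> 'a \<Rightarrow> 'a" where
  "spectral_integral E f x = (THE z. \<forall>y\<in>spectral_integral_dom E f.
     z \<bullet> y = ((LINT l|spectral_measure E (x + y). f l) - (LINT l|spectral_measure E (x - y). f l)) / 4)"

definition is_spectral_resolution ::
    "'a::real_inner set \<Rightarrow> ('a \<Rightarrow> 'a) \<Rightarrow> (real \<Rightarrow> 'a \<Rightarrow> 'a) \<Rightarrow> bool" where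
  "is_spectral_resolution D A E \<longleftrightarrow> spectral_family E \<and>
     D = spectral_integral_dom E (\<lambda>l. l) \<and> (\<forall>x\<in>D. A x = spectral_integral E (\<lambda>l. l) x)"

text \<open>By the spectral theorem a self-adjoint operator has exactly one spectral resolution.\<close>

definition spectral_resolution ::
    "'a::real_inner set \<Rightarrow> ('a \<Rightarrow> 'a) \<Rightarrow> real \<Rightarrow> 'a \<Rightarrow> 'a" where
  "spectral_resolution D A = (SOME E. is_spectral_resolution D A E)"

text \<open>
  The function \<open>\<lambda> \<mapsto> \<lambda>\<^sup>\<alpha>\<close> on the half-line carrying the spectrum of a nonnegative operator.  The case
  \<open>\<alpha> = 0\<close> is separate because \<open>0 powr 0 = 0\<close>, whereas \<open>A\<^sup>0\<close> is the identity; negative \<open>\<lambda>\<close>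
  are not charged by the spectral measures of a nonnegative operator.
\<close>

definition spectral_pow :: "real \<Rightarrow> real \<Rightarrow> real" where
  "spectral_pow \<alpha> l = (if \<alpha> = 0 then 1 else max 0 l powr \<alpha>)"

definition power_dom :: "'a::real_inner set \<Rightarrow> ('a \<Rightarrow> 'a) \<Rightarrow> real \<Rightarrow> 'a set" where
  "power_dom D A \<alpha> = spectral_integral_dom (spectral_resolution D A) (spectral_pow \<alpha>)"

definition power_op :: "'a::real_inner set \<Rightarrow> ('a \<Rightarrow> 'a) \<Rightarrow> real \<Rightarrow> 'a \<Rightarrow> 'a" where
  "power_op D A \<alpha> = spectral_integral (spectral_resolution D A) (spectral_pow \<alpha>)"

section \<open>Regularity classes\<close>

text \<open>\<open>Ck_on k S f\<close> is \<open>f \<in> C\<^sup>k(S)\<close>, with one-sided derivatives at endpoints belonging to \<open>S\<close>.\<close>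

primrec Ck_on :: "nat \<Rightarrow> real set \<Rightarrow> (real \<Rightarrow> 'b::real_normed_vector) \<Rightarrow> bool" where
  "Ck_on 0 S f \<longleftrightarrow> continuous_on S f"
| "Ck_on (Suc k) S f \<longleftrightarrow>
     (\<exists>f'. (\<forall>t\<in>S. (f has_vector_derivative f' t) (at t within S)) \<and> Ck_on k S f')"

text \<open>
  \<open>Ck_into D B k S u\<close> is \<open>u \<in> C\<^sup>k(S; D(B))\<close>.  The graph norm \<open>(|x|\<^sup>2 + |B x|\<^sup>2)\<^sup>1\<^sup>/\<^sup>2\<close> of \<open>x\<close> is the
  norm of the pair \<open>(x, B x)\<close> in the product space, so limits in \<open>D(B)\<close> are limits of such pairs.
\<close>

primrec Ck_into ::
    "'a::real_normed_vector set \<Rightarrow> ('a \<Rightarrow> 'a) \<Rightarrow> nat \<Rightarrow> real set \<Rightarrow> (real \<Rightarrow> 'a) \<Rightarrow> bool" where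
  "Ck_into D B 0 S u \<longleftrightarrow> (\<forall>t\<in>S. u t \<in> D) \<and> continuous_on S (\<lambda>t. (u t, B (u t)))"
| "Ck_into D B (Suc k) S u \<longleftrightarrow> (\<forall>t\<in>S. u t \<in> D) \<and>
     (\<exists>u'. (\<forall>t\<in>S. u' t \<in> D \<and>
              ((\<lambda>s. (u s, B (u s))) has_vector_derivative (u' t, B (u' t))) (at t within S)) \<and>
           Ck_into D B k S u')"

definition locally_lipschitz_on :: "real set \<Rightarrow> (real \<Rightarrow> real) \<Rightarrow> bool" where
  "locally_lipschitz_on S f \<longleftrightarrow> (\<forall>x\<in>S. \<exists>e>0. \<exists>L. L-lipschitz_on (cball x e \<inter> S) f)"

section \<open>The Cauchy problem\<close>

definition is_global_solution ::
    "'a::real_inner set \<Rightarrow> ('a \<Rightarrow> 'a) \<Rightarrow> real \<Rightarrow> (real \<Rightarrow> real) \<Rightarrow> 'a \<Rightarrow> (real \<Rightarrow> 'a) \<Rightarrow> bool" where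
  "is_global_solution D A p m u0 u \<longleftrightarrow>
     Ck_on 1 {0..} u \<and> Ck_into D A 0 {0..} u \<and>
     (\<forall>t\<ge>0. (1 / (1 + t) powr p) *\<^sub>R vector_derivative u (at t within {0..})
              + m ((norm (power_op D A (1/2) (u t)))\<^sup>2) *\<^sub>R A (u t) = 0) \<and>
     u 0 = u0"

end

theory Submission
  imports Defs "HOL-Probability.Distribution_Functions"
begin

text \<open>
  The equation differs from the linear heat equation \<open>v' = - A v\<close> only by a scalar factor, so
  the solution runs along the trajectory \<open>exp(-s A) u\<^sub>0\<close> of the linear one, at a speed that has to be found.
  Put \<open>u(t) = exp(-\<sigma>(t) A) u\<^sub>0\<close> and \<open>\<phi>(s) = |A\<^sup>1\<^sup>/\<^sup>2 exp(-s A) u\<^sub>0|\<^sup>2\<close>.  The equation for \<open>u\<close> becomes the scalar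
  equation \<open>\<sigma>' = (1 + t)\<^sup>p m(\<phi>(\<sigma>))\<close>, \<open>\<sigma>(0) = 0\<close>, which separates: if \<open>G' = 1 / (m \<circ> \<phi>)\<close> and \<open>G(0) = 0\<close>,
  then \<open>G(\<sigma>(t)) = ((1 + t)\<^sup>1\<^sup>+\<^sup>p - 1) / (1 + p)\<close>.  As \<open>m \<circ> \<phi>\<close> is bounded and positive, \<open>G\<close> is a bijection
  of the line, and this defines \<open>\<sigma>\<close> (lemma \<open>time_change\<close>).

  Uniqueness (\<open>solution_unique\<close>): a solution \<open>v\<close> solves the linear equation \<open>v' = - k(t) A v\<close> whose
  coefficient is computed from \<open>v\<close> itself.  Since \<open>A \<ge> 0\<close>, the energy \<open>|w|\<^sup>2\<close> of the difference of two
  solutions of this linear equation does not increase, so \<open>v(t) = exp(-S(t) A) u\<^sub>0\<close> with \<open>S' = k\<close>.  Then \<open>S\<close> solves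
  the scalar equation, and \<open>G(S(t))\<close> is known.

  Regularity (\<open>solution_regularity\<close>): for \<open>s > 0\<close> the vector \<open>exp(-s A) u\<^sub>0\<close> is a smooth function of \<open>s\<close> with
  values in the domain of every power of \<open>A\<close>, so the regularity of \<open>u\<close> is that of \<open>\<sigma>\<close>, and a
  bootstrap in the scalar equation gives \<open>\<sigma> \<in> C\<^sup>k\<^sup>+\<^sup>1\<close> when \<open>m \<in> C\<^sup>k\<close>.  Decay (\<open>solution_decay\<close>): all norms are
  at most a constant times \<open>exp(-\<nu> \<sigma>)\<close>, and \<open>\<sigma>' \<ge> \<mu> (1 + t)\<^sup>p\<close>.

  All of this needs \<open>A\<^sup>\<alpha> exp(-s A)\<close> as a spectral integral, hence the spectral theorem for \<open>A\<close>.  Because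
  \<open>\<nu> > 0\<close>, \<open>A\<close> has a bounded self-adjoint inverse \<open>T\<close>, and the spectral projection of \<open>A\<close> for
  \<open>(-\<infinity>, l]\<close>, with \<open>l > 0\<close>, is the projection onto the part of the space where \<open>l T - 1 \<ge> 0\<close>.  That projection is a
  polynomial in the sign of \<open>l T - 1\<close>, and the sign of a bounded self-adjoint operator is the strong
  limit of Newton's iteration (\<open>sign_operator_contraction\<close>).  A functional calculus for step
  functions and their uniform limits shows that these projections resolve \<open>A\<close> (\<open>E_resolution\<close>).
\<close>

section \<open>Bounded self-adjoint operators\<close>

text \<open>
  The criterion behind the strong limits below. For increasing projections, for Newton's
  iteration and for truncated spectral integrals the squared distance of two terms is at
  most the difference of the terms of a convergent real sequence.
\<close>

lemma Cauchy_if_squared_dist_le: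
  fixes X :: "nat \<Rightarrow> 'a::real_normed_vector" and h :: "nat \<Rightarrow> real"
  assumes "Cauchy h" and le: "\<And>i j. j \<le> i \<Longrightarrow> (norm (X i - X j))\<^sup>2 \<le> \<bar>h i - h j\<bar>"
  shows "Cauchy X"
proof (rule CauchyI)
  fix e :: real assume e: "e > 0"
  then obtain N where N: "\<And>i j. i \<ge> N \<Longrightarrow> j \<ge> N \<Longrightarrow> \<bar>h i - h j\<bar> < e\<^sup>2"
    using CauchyD[OF assms(1), of "e\<^sup>2"] by auto
  have *: "norm (X i - X j) < e" if "i \<ge> N" "j \<ge> N" "j \<le> i" for i j
    by (rule power2_less_imp_less[OF le_less_trans[OF le[OF that(3)] N[OF that(1,2)]]]) (use e in simp)
  have "norm (X i - X j) < e" if "i \<ge> N" "j \<ge> N" for i j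
    using *[OF that] *[OF that(2,1)] by (cases "j \<le> i") (auto simp: norm_minus_commute)
  then show "\<exists>N. \<forall>i\<ge>N. \<forall>j\<ge>N. norm (X i - X j) < e" by blast
qed

text \<open>
  The difference between a point outside \<open>M\<close> and its nearest point in \<open>M\<close>; the nearest
  point exists because the parallelogram law makes minimizing sequences Cauchy.
\<close>

lemma closed_subspace_orthogonal_vector:
  fixes M :: "'a::{real_inner, complete_space} set"
  assumes "closed M" "subspace M" "M \<noteq> UNIV"
  obtains z where "z \<noteq> 0" "\<And>y. y \<in> M \<Longrightarrow> z \<bullet> y = 0"
proof -
  obtain x where x: "x \<notin> M" using assms(3) by auto
  have M0: "0 \<in> M" using assms(2) by (simp add: subspace_def)
  define d where "d = infdist x M"
  have dle: "d \<le> norm (x - y)" if "y \<in> M" for y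
    using infdist_le[OF that] unfolding d_def by (simp add: dist_norm)
  have d0: "0 \<le> d" by (simp add: d_def infdist_nonneg)
  have "\<exists>y\<in>M. norm (x - y) < d + 1 / real (Suc n)" for n
  proof (rule ccontr)
    assume *: "\<not> ?thesis"
    have "M \<noteq> {}" using M0 by auto
    then have "d + 1 / real (Suc n) \<le> infdist x M"
      using * by (auto simp: infdist_def dist_norm not_less intro!: cINF_greatest)
    then show False unfolding d_def by simp
  qed
  then obtain y where yM: "\<And>n. y n \<in> M" and yd: "\<And>n. norm (x - y n) < d + 1 / real (Suc n)"
    by metis
  have close: "(norm (y i - y j))\<^sup>2 \<le> 2 * (norm (x - y i))\<^sup>2 + 2 * (norm (x - y j))\<^sup>2 - 4 * d\<^sup>2" for i j
  proof -
    have "(1/2) *\<^sub>R (y i + y j) \<in> M" using yM assms(2) by (simp add: subspace_def)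
    then have "d\<^sup>2 \<le> (norm (x - (1/2) *\<^sub>R (y i + y j)))\<^sup>2" using dle d0 by (simp add: power_mono)
    moreover have "(norm (y i - y j))\<^sup>2 + 4 * (norm (x - (1/2) *\<^sub>R (y i + y j)))\<^sup>2
        = 2 * (norm (x - y i))\<^sup>2 + 2 * (norm (x - y j))\<^sup>2"
      unfolding power2_norm_eq_inner
      by (simp add: inner_simps inner_commute) (simp add: field_simps inner_commute)
    ultimately show ?thesis by linarith
  qed
  have lim: "(\<lambda>n. (norm (x - y n))\<^sup>2) \<longlonglongrightarrow> d\<^sup>2"
  proof (intro tendsto_power)
    have "(\<lambda>n. 1 / real (Suc n)) \<longlonglongrightarrow> 0" by (rule LIMSEQ_Suc[OF lim_1_over_n])
    then have "(\<lambda>n. d + 1 / real (Suc n)) \<longlonglongrightarrow> d + 0" by (rule tendsto_add[OF tendsto_const])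
    then have up: "(\<lambda>n. d + 1 / real (Suc n)) \<longlonglongrightarrow> d" by simp
    show "(\<lambda>n. norm (x - y n)) \<longlonglongrightarrow> d"
      by (rule tendsto_sandwich[OF always_eventually always_eventually tendsto_const up])
         (use dle[OF yM] less_imp_le[OF yd] in blast)+
  qed
  have "Cauchy y"
  proof (rule CauchyI)
    fix e :: real assume e: "e > 0"
    have "eventually (\<lambda>n. (norm (x - y n))\<^sup>2 < d\<^sup>2 + e\<^sup>2 / 4) sequentially"
      using order_tendstoD(2)[OF lim, of "d\<^sup>2 + e\<^sup>2/4"] e by simp
    then obtain N where N: "\<And>n. n \<ge> N \<Longrightarrow> (norm (x - y n))\<^sup>2 < d\<^sup>2 + e\<^sup>2 / 4"
      by (auto simp: eventually_sequentially)
    have "norm (y i - y j) < e" if "i \<ge> N" "j \<ge> N" for i j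
    proof (rule power2_less_imp_less)
      show "(norm (y i - y j))\<^sup>2 < e\<^sup>2" using close[of i j] N[OF that(1)] N[OF that(2)] by linarith
    qed (use e in simp)
    then show "\<exists>N. \<forall>i\<ge>N. \<forall>j\<ge>N. norm (y i - y j) < e" by blast
  qed
  then obtain w where w: "y \<longlonglongrightarrow> w" using Cauchy_convergent convergent_def by blast
  have wM: "w \<in> M" using closed_sequentially[OF assms(1) _ w] yM by blast
  have "(\<lambda>n. (norm (x - y n))\<^sup>2) \<longlonglongrightarrow> (norm (x - w))\<^sup>2" by (intro tendsto_intros w)
  then have dw: "(norm (x - w))\<^sup>2 = d\<^sup>2" using lim LIMSEQ_unique by blast
  show thesis
  proof
    show "x - w \<noteq> 0" using x wM by auto
    fix v assume v: "v \<in> M"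
    show "(x - w) \<bullet> v = 0"
    proof (rule ccontr)
      assume n0: "(x - w) \<bullet> v \<noteq> 0"
      then have vv: "v \<bullet> v > 0" by auto
      define t where "t = ((x - w) \<bullet> v) / (v \<bullet> v)"
      have "w + t *\<^sub>R v \<in> M" using wM v assms(2) by (simp add: subspace_def)
      then have "d\<^sup>2 \<le> (norm (x - (w + t *\<^sub>R v)))\<^sup>2" using dle d0 by (simp add: power_mono)
      also have "\<dots> = (norm (x - w))\<^sup>2 - 2 * t * ((x - w) \<bullet> v) + t\<^sup>2 * (v \<bullet> v)"
        unfolding power2_norm_eq_inner
        by (simp add: inner_simps inner_commute) (simp add: power2_eq_square algebra_simps inner_commute)
      also have "\<dots> = d\<^sup>2 - ((x - w) \<bullet> v)\<^sup>2 / (v \<bullet> v)"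
        using vv dw by (simp add: t_def power2_eq_square field_simps)
      finally show False using n0 vv by (simp add: field_simps)
    qed
  qed
qed

definition sa_op :: "('a::real_inner \<Rightarrow> 'a) \<Rightarrow> bool" where
  "sa_op B \<longleftrightarrow> bounded_linear B \<and> (\<forall>x y. B x \<bullet> y = x \<bullet> B y)"

definition pos_op :: "('a::real_inner \<Rightarrow> 'a) \<Rightarrow> bool" where
  "pos_op B \<longleftrightarrow> sa_op B \<and> (\<forall>x. 0 \<le> B x \<bullet> x)"

lemma sa_op_bl: "sa_op B \<Longrightarrow> bounded_linear B"
  by (simp add: sa_op_def)

lemma sa_op_swap: "sa_op B \<Longrightarrow> B x \<bullet> y = x \<bullet> B y"
  by (simp add: sa_op_def)

lemma sa_op_lin:
  assumes "sa_op B"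
  shows "B (x + y) = B x + B y" "B (x - y) = B x - B y" "B (c *\<^sub>R x) = c *\<^sub>R B x" "B 0 = 0" "B (- x) = - B x"
  using bounded_linear.linear[OF sa_op_bl[OF assms]]
  by (simp_all add: linear_add linear_diff linear_cmul linear_0 linear_neg)

lemma sa_op_tendsto: "sa_op B \<Longrightarrow> (f \<longlongrightarrow> x) F \<Longrightarrow> ((\<lambda>t. B (f t)) \<longlongrightarrow> B x) F"
  using bounded_linear.tendsto sa_op_bl by blast

lemma sa_op_id: "sa_op (\<lambda>x. x)"
  by (simp add: sa_op_def)

lemma sa_op_comb:
  assumes "sa_op B" "sa_op C"
  shows "sa_op (\<lambda>x. a *\<^sub>R B x + b *\<^sub>R C x)"
  unfolding sa_op_def
proof
  show "bounded_linear (\<lambda>x. a *\<^sub>R B x + b *\<^sub>R C x)"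
    by (intro bounded_linear_add bounded_linear_scaleR_right[THEN bounded_linear_compose] sa_op_bl assms)
qed (use assms in \<open>simp add: inner_left_distrib inner_right_distrib sa_op_swap\<close>)

lemma sa_op_comp:
  assumes "sa_op B" "sa_op C" "\<And>x. B (C x) = C (B x)"
  shows "sa_op (\<lambda>x. B (C x))"
  using assms bounded_linear_compose[of B C] unfolding sa_op_def by metis

lemma sa_op_strong_limit:
  fixes B :: "nat \<Rightarrow> 'a::real_inner \<Rightarrow> 'a"
  assumes "\<And>n. sa_op (B n)" "\<And>x. (\<lambda>n. B n x) \<longlonglongrightarrow> C x" "\<And>n x. norm (B n x) \<le> K * norm x"
  shows "sa_op C"
proof -
  have "bounded_linear C"
  proof (rule bounded_linear_intro[of _ K])
    fix x y r
    have "(\<lambda>n. B n (x + y)) \<longlonglongrightarrow> C x + C y"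
      using tendsto_add[OF assms(2) assms(2), of x y] by (simp add: sa_op_lin[OF assms(1)])
    then show "C (x + y) = C x + C y" using assms(2) LIMSEQ_unique by blast
    have "(\<lambda>n. B n (r *\<^sub>R x)) \<longlonglongrightarrow> r *\<^sub>R C x"
      using tendsto_scaleR[OF tendsto_const assms(2), of r x] by (simp add: sa_op_lin[OF assms(1)])
    then show "C (r *\<^sub>R x) = r *\<^sub>R C x" using assms(2) LIMSEQ_unique by blast
    show "norm (C x) \<le> norm x * K"
      using tendsto_norm[OF assms(2)] by (rule LIMSEQ_le_const2) (use assms(3) in \<open>auto simp: mult.commute\<close>)
  qed
  moreover have "C x \<bullet> y = x \<bullet> C y" for x y
  proof -
    have "(\<lambda>n. B n x \<bullet> y) \<longlonglongrightarrow> C x \<bullet> y" "(\<lambda>n. x \<bullet> B n y) \<longlonglongrightarrow> x \<bullet> C y"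
      by (intro tendsto_intros assms(2))+
    then show ?thesis using LIMSEQ_unique sa_op_swap[OF assms(1)] by fastforce
  qed
  ultimately show ?thesis by (simp add: sa_op_def)
qed

text \<open>
  Polarization at \<open>x\<close> and at the multiple of \<open>B x\<close> that has the same norm as \<open>x\<close>.
\<close>

lemma sa_op_norm_le:
  assumes B: "sa_op B" and le: "\<And>x. \<bar>B x \<bullet> x\<bar> \<le> d * (norm x)\<^sup>2"
  shows "norm (B x) \<le> d * norm x"
proof (cases "B x = 0")
  case True
  then show ?thesis using le[of x] by (cases "x = 0") (auto simp: zero_le_mult_iff)
next
  case False
  define y where "y = (norm x / norm (B x)) *\<^sub>R B x"
  have ny: "norm y = norm x" using False by (simp add: y_def)
  have "4 * (B x \<bullet> y) = B (x + y) \<bullet> (x + y) - B (x - y) \<bullet> (x - y)"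
    using sa_op_swap[OF B] by (simp add: sa_op_lin[OF B] algebra_simps inner_commute)
  also have "\<dots> \<le> d * (norm (x + y))\<^sup>2 + d * (norm (x - y))\<^sup>2"
    using le[of "x + y"] le[of "x - y"] by linarith
  also have "\<dots> = d * (2 * (norm x)\<^sup>2 + 2 * (norm y)\<^sup>2)"
    by (simp add: power2_norm_eq_inner algebra_simps inner_commute)
  finally have "4 * (B x \<bullet> y) \<le> 4 * d * (norm x)\<^sup>2" by (simp add: ny)
  moreover have "B x \<bullet> y = norm x * norm (B x)"
    using False by (simp add: y_def power2_norm_eq_inner[symmetric] power2_eq_square)
  ultimately have "norm x * norm (B x) \<le> norm x * (d * norm x)"
    by (simp add: power2_eq_square mult_ac)
  moreover have "norm x > 0" using False sa_op_lin(4)[OF B] by auto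
  ultimately show ?thesis by simp
qed

text \<open>
  The recursion \<open>a\<^sub>0 = A\<close>, \<open>a\<^sub>n\<^sub>+\<^sub>1 = a\<^sub>n - a\<^sub>n\<^sup>2\<close> stays between 0 and 1 and telescopes to
  \<open>A = a\<^sub>0\<^sup>2 + \<dots> + a\<^sub>n\<^sub>-\<^sub>1\<^sup>2 + a\<^sub>n\<close>. As \<open>B\<close> commutes with \<open>a\<^sub>k\<close>, each square contributes
  \<open>\<langle>B a\<^sub>k x, a\<^sub>k x\<rangle> \<ge> 0\<close>, and the remainder \<open>a\<^sub>n x\<close> tends to 0 because the \<open>|a\<^sub>k x|\<^sup>2\<close> are
  summable.
\<close>

lemma pos_op_commuting_product:
  fixes A B :: "'a::{real_inner, complete_space} \<Rightarrow> 'a"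
  assumes A: "pos_op A" and A1: "\<And>x. A x \<bullet> x \<le> (norm x)\<^sup>2" and B: "pos_op B"
    and comm: "\<And>x. A (B x) = B (A x)"
  shows "0 \<le> B (A x) \<bullet> x"
proof -
  define a where "a = rec_nat A (\<lambda>_ g x. g x - g (g x))"
  have a0: "a 0 = A" and aS: "a (Suc n) = (\<lambda>x. a n x - a n (a n x))" for n
    by (auto simp: a_def)
  have inv: "sa_op (a n) \<and> (\<forall>x. 0 \<le> a n x \<bullet> x \<and> a n x \<bullet> x \<le> (norm x)\<^sup>2) \<and> (\<forall>x. a n (B x) = B (a n x))" for n
  proof (induction n)
    case 0
    then show ?case using A A1 comm by (auto simp: a0 pos_op_def)
  next
    case (Suc n)
    let ?g = "a n"
    have g: "sa_op ?g" "\<And>x. 0 \<le> ?g x \<bullet> x" "\<And>x. ?g x \<bullet> x \<le> (norm x)\<^sup>2" "\<And>x. ?g (B x) = B (?g x)"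
      using Suc by auto
    have "sa_op (\<lambda>x. ?g (?g x))" by (rule sa_op_comp) (use g in auto)
    then have "sa_op (\<lambda>x. 1 *\<^sub>R ?g x + (-1) *\<^sub>R ?g (?g x))" by (intro sa_op_comb g)
    then have "sa_op (a (Suc n))" by (simp add: aS)
    moreover have "0 \<le> (?g x - ?g (?g x)) \<bullet> x" for x
    proof -
      have "(?g x - ?g (?g x)) \<bullet> x = ((norm (?g x))\<^sup>2 - ?g (?g x) \<bullet> ?g x) + ?g (x - ?g x) \<bullet> (x - ?g x)"
        using sa_op_swap[OF g(1), of "?g x" x]
        by (simp add: power2_norm_eq_inner sa_op_lin[OF g(1)] inner_simps)
      then show ?thesis using g(3)[of "?g x"] g(2)[of "x - ?g x"] by linarith
    qed
    moreover have "(?g x - ?g (?g x)) \<bullet> x \<le> (norm x)\<^sup>2" for x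
    proof -
      have "?g (?g x) \<bullet> x = (norm (?g x))\<^sup>2" using sa_op_swap[OF g(1)] by (simp add: power2_norm_eq_inner)
      then show ?thesis using g(3)[of x] by (simp add: inner_diff_left) (smt (verit) zero_le_power2)
    qed
    moreover have "B (x - y) = B x - B y" for x y using B by (simp add: pos_op_def sa_op_lin)
    ultimately show ?case using g(4) by (simp add: aS)
  qed
  have sum: "(\<Sum>k<n. (norm (a k x))\<^sup>2) = A x \<bullet> x - a n x \<bullet> x" for n
  proof (induction n)
    case (Suc n)
    have "a n (a n x) \<bullet> x = (norm (a n x))\<^sup>2" using inv sa_op_swap[of "a n"] by (simp add: power2_norm_eq_inner)
    then show ?case using Suc by (simp add: aS inner_diff_left)
  qed (simp add: a0)
  have "summable (\<lambda>k. (norm (a k x))\<^sup>2)"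
    by (rule bounded_imp_summable[where B = "A x \<bullet> x"])
       (auto simp: sum lessThan_Suc_atMost[symmetric] inv simp del: sum.lessThan_Suc)
  then have "(\<lambda>k. (norm (a k x))\<^sup>2) \<longlonglongrightarrow> 0" by (rule summable_LIMSEQ_zero)
  then have "(\<lambda>k. sqrt ((norm (a k x))\<^sup>2)) \<longlonglongrightarrow> sqrt 0" by (intro tendsto_intros)
  then have "(\<lambda>k. a k x) \<longlonglongrightarrow> 0" by (simp add: tendsto_norm_zero_iff)
  moreover have Bs: "sa_op B" using B by (simp add: pos_op_def)
  ultimately have "(\<lambda>k. B (a k x) \<bullet> x) \<longlonglongrightarrow> B 0 \<bullet> x"
    by (intro tendsto_inner[OF _ tendsto_const] sa_op_tendsto[of B])
  moreover have "B (a n x) \<bullet> x \<le> B (A x) \<bullet> x" for n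
  proof (induction n)
    case (Suc n)
    have "B (a n (a n x)) \<bullet> x = B (a n x) \<bullet> a n x"
      using inv[of n] sa_op_swap[of "a n" "B (a n x)" x] by auto
    then have "0 \<le> B (a n (a n x)) \<bullet> x" using B by (simp add: pos_op_def)
    then show ?case using Suc by (simp add: aS sa_op_lin[OF Bs] inner_diff_left)
  qed (simp add: a0)
  ultimately have "B 0 \<bullet> x \<le> B (A x) \<bullet> x" by (intro LIMSEQ_le_const2) auto
  then show ?thesis by (simp add: sa_op_lin[OF Bs])
qed

section \<open>The sign of a bounded self-adjoint operator\<close>

text \<open>
  Newton's iteration \<open>X \<mapsto> (3 X - X\<^sup>3) / 2\<close> for the matrix sign function. For a real
  starting point in \<open>[-1, 1]\<close> it converges to the sign of that point.
\<close>

primrec newton_sign :: "('a::real_vector \<Rightarrow> 'a) \<Rightarrow> nat \<Rightarrow> 'a \<Rightarrow> 'a" where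
  "newton_sign S 0 x = S x"
| "newton_sign S (Suc n) x = (3/2) *\<^sub>R newton_sign S n x
     + (-1/2) *\<^sub>R newton_sign S n (newton_sign S n (newton_sign S n x))"

lemma sa_newton_sign:
  assumes "sa_op S" shows "sa_op (newton_sign S n)"
proof (induction n)
  case 0
  have "newton_sign S 0 = S" by (simp add: fun_eq_iff)
  then show ?case using assms by simp
next
  case (Suc n)
  have "sa_op (\<lambda>x. newton_sign S n (newton_sign S n (newton_sign S n x)))"
    by (rule sa_op_comp[OF Suc sa_op_comp[OF Suc Suc refl] refl])
  from sa_op_comb[OF Suc this, of "3/2" "-1/2"]
  show ?case by (simp add: newton_sign.simps(2)[abs_def])
qed

lemma newton_sign_commute:
  assumes C: "bounded_linear C" and comm: "\<And>x. C (S x) = S (C x)"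
  shows "C (newton_sign S n x) = newton_sign S n (C x)"
proof (induction n arbitrary: x)
  case (Suc n)
  interpret C: bounded_linear C by fact
  show ?case by (simp add: C.add C.scaleR C.diff C.neg Suc)
qed (simp add: comm)

lemma newton_sign_commute_each:
  assumes "sa_op S"
  shows "newton_sign S m (newton_sign S n x) = newton_sign S n (newton_sign S m x)"
proof (rule newton_sign_commute[OF sa_op_bl[OF sa_newton_sign[OF assms]]])
  show "newton_sign S m (S x) = S (newton_sign S m x)" for x
    using newton_sign_commute[OF sa_op_bl[OF assms], of S] by simp
qed

text \<open>
  If \<open>X'\<close> follows \<open>X\<close> and \<open>Y = X\<^sup>2\<close>, then \<open>4 (1 - X'\<^sup>2) = (1 - Y)\<^sup>2 (4 - Y)\<close>, which is
  nonnegative once \<open>Y \<le> 1\<close>.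
\<close>

lemma newton_sign_contraction:
  assumes S: "sa_op S" and c: "\<And>x. norm (S x) \<le> norm x"
  shows "norm (newton_sign S n x) \<le> norm x"
proof (induction n arbitrary: x)
  case (Suc n)
  let ?X = "newton_sign S n"
  have X: "sa_op ?X" by (rule sa_newton_sign[OF S])
  define x1 x2 x3 where "x1 = ?X x" and "x2 = ?X x1" and "x3 = ?X x2"
  define w where "w = x - x2"
  have Xw: "?X w = x1 - x3" by (simp add: w_def sa_op_lin[OF X] x1_def x2_def x3_def)
  have sw: "x2 \<bullet> x = x1 \<bullet> x1" "x3 \<bullet> x1 = x2 \<bullet> x2"
    unfolding x3_def x2_def x1_def by (simp_all add: sa_op_swap[OF X])
  have "4 * ((norm x)\<^sup>2 - (norm (newton_sign S (Suc n) x))\<^sup>2) = 4 * (norm w)\<^sup>2 - (norm (?X w))\<^sup>2"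
    unfolding newton_sign.simps(2) Xw unfolding w_def power2_norm_eq_inner
      x1_def[symmetric] x2_def[symmetric] x3_def[symmetric] using sw
    by (simp add: inner_simps inner_commute)
  moreover have "(norm (?X w))\<^sup>2 \<le> (norm w)\<^sup>2" using Suc[of w] by (simp add: power_mono)
  moreover have "b \<le> a" if "4 * (a - b) = 4 * d - e" "e \<le> d" "0 \<le> d" for a b d e :: real
    using that by argo
  ultimately have "(norm (newton_sign S (Suc n) x))\<^sup>2 \<le> (norm x)\<^sup>2"
    using zero_le_power2[of "norm w"] by blast
  then show ?case by (rule power2_le_imp_le) simp
qed (simp add: c)

lemma newton_sign_defect:
  assumes S: "sa_op S" and c: "\<And>x. norm (S x) \<le> norm x"
  defines "Z \<equiv> \<lambda>n x. x - newton_sign S n (newton_sign S n x)"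
  shows "pos_op (Z n)" "Z n x \<bullet> x \<le> (norm x)\<^sup>2"
proof -
  let ?X = "newton_sign S n"
  have X: "sa_op ?X" by (rule sa_newton_sign[OF S])
  have "sa_op (\<lambda>x. 1 *\<^sub>R x + (-1) *\<^sub>R ?X (?X x))"
    by (rule sa_op_comb[OF sa_op_id sa_op_comp[OF X X refl]])
  then have "sa_op (Z n)" by (simp add: Z_def)
  moreover have eq: "Z n x \<bullet> x = (norm x)\<^sup>2 - (norm (?X x))\<^sup>2" for x
    by (simp add: Z_def inner_diff_left power2_norm_eq_inner sa_op_swap[OF X])
  moreover have "(norm (?X x))\<^sup>2 \<le> (norm x)\<^sup>2" for x
    using newton_sign_contraction[OF S c, of n x] by (simp add: power_mono)
  ultimately show "pos_op (Z n)" "Z n x \<bullet> x \<le> (norm x)\<^sup>2" by (auto simp: pos_op_def)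
qed

text \<open>
  With \<open>X\<^sub>m\<close> the iterates, \<open>X\<^sub>m\<^sub>+\<^sub>1 X\<^sub>n - X\<^sub>m X\<^sub>n = X\<^sub>m X\<^sub>n (1 - X\<^sub>m\<^sup>2) / 2\<close> is a product of
  commuting positive operators, so \<open>X\<^sub>m X\<^sub>n\<close> increases with \<open>m\<close>, starting from \<open>X\<^sub>n\<^sup>2\<close>.
\<close>

lemma newton_sign_product_step:
  fixes S :: "'a::{real_inner, complete_space} \<Rightarrow> 'a"
  assumes S: "sa_op S" and c: "\<And>x. norm (S x) \<le> norm x" and mn: "n \<le> m"
  shows "pos_op (\<lambda>x. newton_sign S m (newton_sign S n x))
    \<and> (norm (newton_sign S n x))\<^sup>2 \<le> newton_sign S m (newton_sign S n x) \<bullet> x"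
  using mn
proof (induction m rule: dec_induct)
  case base
  have X: "sa_op (newton_sign S n)" by (rule sa_newton_sign[OF S])
  show ?case
    using sa_op_comp[OF X X refl] sa_op_swap[OF X, of "newton_sign S n _"]
    by (simp add: pos_op_def power2_norm_eq_inner)
next
  case (step m)
  let ?X = "newton_sign S n" and ?Y = "newton_sign S m"
  have X: "sa_op ?X" and Y: "sa_op ?Y" by (rule sa_newton_sign[OF S])+
  define Z where "Z = (\<lambda>x. x - ?Y (?Y x))"
  have xy: "?X (?Y x) = ?Y (?X x)" for x by (rule newton_sign_commute_each[OF S])
  have P: "pos_op (\<lambda>x. ?Y (?X x))" using step by blast
  have Zc: "Z (?Y (?X x)) = ?Y (?X (Z x))" for x
    by (simp add: Z_def sa_op_lin[OF X] sa_op_lin[OF Y] xy)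
  have "0 \<le> ?Y (?X (Z x)) \<bullet> x" for x
    by (rule pos_op_commuting_product[where B = "\<lambda>x. ?Y (?X x)" and A = Z, OF _ _ P])
       (use newton_sign_defect[OF S c] Zc in \<open>simp_all add: Z_def\<close>)
  moreover have eq: "newton_sign S (Suc m) (?X x) = ?Y (?X x) + (1/2) *\<^sub>R ?Y (?X (Z x))" for x
  proof -
    have "(3/2) *\<^sub>R v = v + (1/2) *\<^sub>R v" for v :: 'a using scaleR_add_left[of 1 "1/2" v] by simp
    then show ?thesis by (simp add: Z_def sa_op_lin[OF X] sa_op_lin[OF Y] xy scaleR_diff_right)
  qed
  ultimately have ge: "?Y (?X x) \<bullet> x \<le> newton_sign S (Suc m) (?X x) \<bullet> x" for x
    by (simp only: eq inner_add_left inner_scaleR_left) (smt (verit) field_sum_of_halves mult_nonneg_nonneg)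
  have "sa_op (\<lambda>x. newton_sign S (Suc m) (?X x))"
    using sa_op_comp[where B = "newton_sign S (Suc m)" and C = "?X"]
      sa_newton_sign[OF S] newton_sign_commute_each[OF S] by blast
  moreover have "0 \<le> ?Y (?X x) \<bullet> x" for x using P by (simp add: pos_op_def)
  ultimately show ?case using ge step.IH order_trans unfolding pos_op_def by blast
qed

text \<open>
  By the previous lemma \<open>|X\<^sub>m x - X\<^sub>n x|\<^sup>2 \<le> |X\<^sub>m x|\<^sup>2 - |X\<^sub>n x|\<^sup>2\<close>, and these norms increase and
  are bounded.
\<close>

lemma newton_sign_Cauchy:
  fixes S :: "'a::{real_inner, complete_space} \<Rightarrow> 'a"
  assumes S: "sa_op S" and c: "\<And>x. norm (S x) \<le> norm x"
  shows "convergent (\<lambda>n. newton_sign S n x)"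
proof -
  let ?X = "newton_sign S"
  have X: "sa_op (?X n)" for n by (rule sa_newton_sign[OF S])
  have diff: "(norm (?X m x - ?X n x))\<^sup>2 \<le> (norm (?X m x))\<^sup>2 - (norm (?X n x))\<^sup>2" if "n \<le> m" for m n
  proof -
    have "(norm (?X n x))\<^sup>2 \<le> ?X m (?X n x) \<bullet> x" using newton_sign_product_step[OF S c that] by blast
    also have "?X m (?X n x) \<bullet> x = ?X n x \<bullet> ?X m x" by (simp add: sa_op_swap[OF X])
    finally show ?thesis unfolding power2_norm_eq_inner by (simp add: inner_simps inner_commute)
  qed
  define h where "h n = (norm (?X n x))\<^sup>2" for n
  have "incseq h"
  proof (rule incseq_SucI)
    fix n show "h n \<le> h (Suc n)" unfolding h_def using diff[of n "Suc n"] zero_le_power2[of "norm (?X (Suc n) x - ?X n x)"] by linarith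
  qed
  moreover have "h n \<le> (norm x)\<^sup>2" for n
    unfolding h_def using newton_sign_contraction[OF S c] by (simp add: power_mono)
  ultimately have "convergent h" using incseq_convergent convergent_def by metis
  then have Ch: "Cauchy h" by (rule convergent_Cauchy)
  have "Cauchy (\<lambda>n. ?X n x)"
    by (rule Cauchy_if_squared_dist_le[OF Ch]) (use diff in \<open>force simp: h_def\<close>)
  then show ?thesis by (rule Cauchy_convergent)
qed

text \<open>
  The strong limit \<open>G\<close> of the iteration is the sign of \<open>S\<close>. It is a fixed point, which
  reads \<open>G\<^sup>3 = G\<close>; the inequality \<open>S G \<ge> S\<^sup>2\<close> is the limit of \<open>X\<^sub>n X\<^sub>0 \<ge> X\<^sub>0\<^sup>2\<close>, and with the
  last clause it makes the kernels of \<open>S\<close> and \<open>G\<close> equal.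
\<close>

lemma sign_operator_contraction:
  fixes S :: "'a::{real_inner, complete_space} \<Rightarrow> 'a"
  assumes S: "sa_op S" and c: "\<And>x. norm (S x) \<le> norm x"
  obtains G where "sa_op G" "\<And>x. G (G (G x)) = G x" "\<And>x. (norm (S x))\<^sup>2 \<le> S (G x) \<bullet> x"
    "\<And>C x. bounded_linear C \<Longrightarrow> (\<And>y. C (S y) = S (C y)) \<Longrightarrow> C (G x) = G (C x)"
    "\<And>x. S x = 0 \<Longrightarrow> G x = 0"
proof -
  let ?X = "newton_sign S"
  have X: "sa_op (?X n)" for n by (rule sa_newton_sign[OF S])
  have con: "norm (?X n x) \<le> norm x" for n x by (rule newton_sign_contraction[OF S c])
  define G where "G x = lim (\<lambda>n. ?X n x)" for x
  have lim: "(\<lambda>n. ?X n x) \<longlonglongrightarrow> G x" for x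
    unfolding G_def using newton_sign_Cauchy[OF S c] convergent_LIMSEQ_iff by blast
  have saG: "sa_op G" by (rule sa_op_strong_limit[of ?X G 1]) (use X lim con in auto)
  have shift: "(\<lambda>n. ?X n (y n)) \<longlonglongrightarrow> G z" if y: "y \<longlonglongrightarrow> z" for y z
  proof -
    have "(\<lambda>n. norm (y n - z)) \<longlonglongrightarrow> 0" by (rule tendsto_norm_zero[OF LIM_zero[OF y]])
    then have "(\<lambda>n. ?X n (y n - z)) \<longlonglongrightarrow> 0"
      by (rule Lim_null_comparison[rotated]) (use con in auto)
    from tendsto_add[OF this lim[of z]] show ?thesis by (simp add: sa_op_lin[OF X])
  qed
  show thesis
  proof
    show "sa_op G" by fact
    fix x
    have "(\<lambda>n. ?X n (?X n (?X n x))) \<longlonglongrightarrow> G (G (G x))"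
      using shift[OF shift[OF lim[of x]]] .
    from tendsto_add[OF tendsto_scaleR[OF tendsto_const lim[of x], of "3/2"]
        tendsto_scaleR[OF tendsto_const this, of "-1/2"]]
    have "(\<lambda>n. ?X (Suc n) x) \<longlonglongrightarrow> (3/2) *\<^sub>R G x + (-1/2) *\<^sub>R G (G (G x))" by simp
    then have "G x = (3/2) *\<^sub>R G x + (-1/2) *\<^sub>R G (G (G x))"
      using LIMSEQ_Suc[OF lim[of x]] LIMSEQ_unique by blast
    then have "2 *\<^sub>R G x = 2 *\<^sub>R ((3/2) *\<^sub>R G x + (-1/2) *\<^sub>R G (G (G x)))" by (rule arg_cong)
    then have "2 *\<^sub>R G x = 3 *\<^sub>R G x - G (G (G x))" by (simp add: scaleR_add_right scaleR_diff_right)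
    moreover have "3 *\<^sub>R G x = 2 *\<^sub>R G x + G x" using scaleR_add_left[of 2 1 "G x"] by simp
    ultimately show "G (G (G x)) = G x" by (simp add: algebra_simps)
    have "(norm (S x))\<^sup>2 \<le> ?X n x \<bullet> S x" for n
    proof -
      have "(norm (?X 0 x))\<^sup>2 \<le> ?X n (?X 0 x) \<bullet> x" using newton_sign_product_step[OF S c, of 0 n] by blast
      then show ?thesis using sa_op_swap[OF X[of n], of "S x" x] by (simp add: inner_commute)
    qed
    then have "(norm (S x))\<^sup>2 \<le> G x \<bullet> S x"
      using LIMSEQ_le_const[OF tendsto_inner[OF lim[of x] tendsto_const]] by blast
    then show "(norm (S x))\<^sup>2 \<le> S (G x) \<bullet> x" by (simp add: sa_op_swap[OF S])
    have "?X n x = 0" if "S x = 0" for n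
      by (induction n) (use that sa_op_lin(4)[OF X] in auto)
    then show "G x = 0" if "S x = 0" using that LIMSEQ_unique[OF lim[of x]] by simp
  next
    fix C :: "'a \<Rightarrow> 'a" and x assume C: "bounded_linear C" "\<And>y. C (S y) = S (C y)"
    have "(\<lambda>n. C (?X n x)) \<longlonglongrightarrow> C (G x)" by (rule bounded_linear.tendsto[OF C(1) lim])
    then show "C (G x) = G (C x)"
      using LIMSEQ_unique[OF _ lim[of "C x"]] by (simp add: newton_sign_commute[of C S, OF C(1) C(2)])
  qed
qed

text \<open>
  If \<open>G\<close> is the sign of \<open>S\<close>, then \<open>(G\<^sup>2 - G) / 2\<close> projects onto the part of the space where
  \<open>S\<close> is negative, and \<open>P\<close> is the complementary projection. The last clause says that \<open>S\<close>
  is strictly negative there; it will give the right-continuity of the spectral family.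
\<close>

lemma nonneg_part_projector:
  fixes S :: "'a::{real_inner, complete_space} \<Rightarrow> 'a"
  assumes S: "sa_op S"
  obtains P where "orth_projector P"
    "\<And>C x. bounded_linear C \<Longrightarrow> (\<And>y. C (S y) = S (C y)) \<Longrightarrow> C (P x) = P (C x)"
    "\<And>x. P x = x \<Longrightarrow> 0 \<le> S x \<bullet> x"
    "\<And>x. P x = 0 \<Longrightarrow> S x \<bullet> x \<le> 0"
    "\<And>x. P x = 0 \<Longrightarrow> S x \<bullet> x = 0 \<Longrightarrow> x = 0"
proof -
  obtain K where K: "K > 0" "\<And>x. norm (S x) \<le> norm x * K"
    using bounded_linear.pos_bounded[OF sa_op_bl[OF S]] by blast
  \<comment> \<open>rescale to a contraction; the zero summand only brings \<open>R\<close> into the form of \<open>sa_op_comb\<close>\<close>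
  define R where "R x = (1/K) *\<^sub>R S x + 0 *\<^sub>R x" for x
  have RS: "R x = (1/K) *\<^sub>R S x" and SR: "S x = K *\<^sub>R R x" for x using K by (auto simp: R_def)
  have R: "sa_op R" unfolding R_def[abs_def] by (rule sa_op_comb[OF S sa_op_id])
  have "norm (R x) \<le> norm x" for x using K by (simp add: RS field_simps)
  from sign_operator_contraction[OF R this] obtain G where G: "sa_op G" "\<And>x. G (G (G x)) = G x"
    "\<And>x. (norm (R x))\<^sup>2 \<le> R (G x) \<bullet> x"
    "\<And>C x. bounded_linear C \<Longrightarrow> (\<And>y. C (R y) = R (C y)) \<Longrightarrow> C (G x) = G (C x)"
    "\<And>x. R x = 0 \<Longrightarrow> G x = 0" by blast
  define P where "P x = 1 *\<^sub>R x + (-1) *\<^sub>R ((1/2) *\<^sub>R G (G x) + (-1/2) *\<^sub>R G x)" for x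
  have PG: "P x = x - (1/2) *\<^sub>R (G (G x) - G x)" for x by (simp add: P_def scaleR_diff_right)
  note lin = sa_op_lin[OF G(1)]
  have saP: "sa_op P" unfolding P_def[abs_def]
    by (rule sa_op_comb[OF sa_op_id sa_op_comb[OF sa_op_comp[OF G(1) G(1) refl] G(1)]])
  have neg: "G x = - x" if "P x = 0" for x
  proof -
    have x: "x = (1/2) *\<^sub>R (G (G x) - G x)" using that by (simp add: PG)
    have "G x = (1/2) *\<^sub>R (G (G (G x)) - G (G x))" using arg_cong[OF x, of G] by (simp add: lin)
    also have "\<dots> = - ((1/2) *\<^sub>R (G (G x) - G x))" by (simp add: G(2) scaleR_diff_right)
    finally show ?thesis using x by simp
  qed
  show thesis
  proof (rule that[of P])
    have "P (P x) = P x" for x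
    proof -
      define y where "y = (1/2) *\<^sub>R (G (G x) - G x)"
      have "G y = - y" by (simp add: y_def lin G(2) scaleR_diff_right)
      then have "G (G y) - G y = 2 *\<^sub>R y" by (simp add: lin scaleR_2)
      then have "P y = 0" by (simp add: PG)
      moreover have "P x = x - y" by (simp add: PG y_def)
      ultimately show ?thesis by (simp add: sa_op_lin[OF saP])
    qed
    then show "orth_projector P" using saP by (simp add: orth_projector_def sa_op_def)
  next
    fix C x assume C: "bounded_linear C" "\<And>y. C (S y) = S (C y)"
    interpret C: bounded_linear C by fact
    have "C (G y) = G (C y)" for y by (rule G(4)[OF C(1)]) (simp add: RS C.scaleR C(2))
    then show "C (P x) = P (C x)" by (simp add: PG C.diff C.scaleR)
  next
    fix x assume "P x = x"
    then have GG: "G (G x) = G x" by (simp add: PG)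
    define k where "k = x - G x"
    have "G k = 0" by (simp add: k_def lin GG)
    then have Rk: "R k = 0" using G(3)[of k] by (simp add: sa_op_lin[OF R])
    have "R (G x) = R x" using Rk by (simp add: k_def sa_op_lin[OF R])
    then have "0 \<le> R x \<bullet> x" using G(3)[of x] order_trans[OF zero_le_power2[of "norm (R x)"]] by auto
    then show "0 \<le> S x \<bullet> x" using K by (simp add: SR)
  next
    fix x assume P: "P x = 0"
    have *: "(norm (R x))\<^sup>2 \<le> - (R x \<bullet> x)" using G(3)[of x] by (simp add: neg[OF P] sa_op_lin[OF R])
    then have "R x \<bullet> x \<le> 0" using zero_le_power2[of "norm (R x)"] by linarith
    then show "S x \<bullet> x \<le> 0" using K by (simp add: SR mult_nonneg_nonpos)
    assume "S x \<bullet> x = 0"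
    then have "R x \<bullet> x = 0" by (simp add: RS)
    then have "R x = 0" using * by simp
    then show "x = 0" using G(5) neg[OF P] by force
  qed
qed

section \<open>Bounded functional calculus of a spectral family\<close>

lemma uniform_limit_mult_bounded:
  fixes f :: "nat \<Rightarrow> real \<Rightarrow> real"
  assumes "uniform_limit UNIV f g sequentially" "\<And>l. \<bar>h l\<bar> \<le> c"
  shows "uniform_limit UNIV (\<lambda>n l. f n l * h l) (\<lambda>l. g l * h l) sequentially"
proof (rule uniform_limitI)
  fix e :: real assume e: "e > 0"
  have c: "0 \<le> c" using assms(2)[of 0] by linarith
  have "\<forall>\<^sub>F n in sequentially. \<forall>l\<in>UNIV. dist (f n l) (g l) < e / (c + 1)"
    by (rule uniform_limitD[OF assms(1)]) (use e c in auto)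
  then show "\<forall>\<^sub>F n in sequentially. \<forall>l\<in>UNIV. dist (f n l * h l) (g l * h l) < e"
  proof (rule eventually_mono)
    fix n assume *: "\<forall>l\<in>UNIV. dist (f n l) (g l) < e / (c + 1)"
    show "\<forall>l\<in>UNIV. dist (f n l * h l) (g l * h l) < e"
    proof
      fix l
      have "dist (f n l * h l) (g l * h l) = dist (f n l) (g l) * \<bar>h l\<bar>"
        by (simp add: dist_real_def abs_mult flip: left_diff_distrib)
      also have "\<dots> \<le> dist (f n l) (g l) * (c + 1)"
        by (rule mult_left_mono) (use assms(2)[of l] in auto)
      also have "\<dots> < e" using * c by (simp add: pos_less_divide_eq)
      finally show "dist (f n l * h l) (g l * h l) < e" .
    qed
  qed
qed

locale spectral_fam =
  fixes E :: "real \<Rightarrow> 'a::{real_inner, complete_space} \<Rightarrow> 'a"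
  assumes fam: "spectral_family E"
begin

abbreviation \<mu> where "\<mu> \<equiv> spectral_measure E"

lemma sa_E: "sa_op (E l)"
  using fam by (simp add: spectral_family_def orth_projector_def sa_op_def)

lemma E_min: "E l (E l' x) = E (min l l') x"
  using fam by (simp add: spectral_family_def)

lemma E_inner: "E l x \<bullet> x = (norm (E l x))\<^sup>2"
  using sa_op_swap[OF sa_E, of l "E l x" x] by (simp add: E_min power2_norm_eq_inner inner_commute)

lemma norm_E_le: "norm (E l x) \<le> norm x"
proof -
  have "norm (E l x) * norm (E l x) \<le> norm (E l x) * norm x"
    using E_inner[of l x] norm_cauchy_schwarz[of "E l x" x] by (simp add: power2_eq_square)
  then show ?thesis by (cases "E l x = 0") auto
qed

lemma norm_E_mono: assumes "l \<le> l'" shows "norm (E l x) \<le> norm (E l' x)"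
  using norm_E_le[of l "E l' x"] assms by (simp add: E_min min_absorb1)

lemma E_right_cont: "((\<lambda>s. E s x) \<longlongrightarrow> E l x) (at_right l)"
  and E_bot: "((\<lambda>s. E s x) \<longlongrightarrow> 0) at_bot" and E_top: "((\<lambda>s. E s x) \<longlongrightarrow> x) at_top"
  using fam by (simp_all add: spectral_family_def)

lemma cdf_props:
  shows "x' \<le> y' \<Longrightarrow> E x' x \<bullet> x \<le> E y' x \<bullet> x"
    "continuous (at_right a) (\<lambda>l. E l x \<bullet> x)"
    "((\<lambda>l. E l x \<bullet> x) \<longlongrightarrow> 0) at_bot" "((\<lambda>l. E l x \<bullet> x) \<longlongrightarrow> (norm x)\<^sup>2) at_top"
proof -
  show "x' \<le> y' \<Longrightarrow> E x' x \<bullet> x \<le> E y' x \<bullet> x"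
    unfolding E_inner by (simp add: norm_E_mono power_mono)
  show "continuous (at_right a) (\<lambda>l. E l x \<bullet> x)"
    unfolding continuous_within by (rule tendsto_inner[OF E_right_cont tendsto_const])
  show "((\<lambda>l. E l x \<bullet> x) \<longlongrightarrow> 0) at_bot"
    using tendsto_inner[OF E_bot tendsto_const, of x x] by simp
  show "((\<lambda>l. E l x \<bullet> x) \<longlongrightarrow> (norm x)\<^sup>2) at_top"
    using tendsto_inner[OF E_top tendsto_const, of x x] by (simp add: power2_norm_eq_inner)
qed

lemma fin_measure: "finite_borel_measure (\<mu> x)"
  unfolding spectral_measure_def
  by (rule finite_borel_measure_interval_measure[where m = "(norm x)\<^sup>2"]) (use cdf_props in auto)

lemma measure_Iic: "measure (\<mu> x) {..l} = E l x \<bullet> x"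
  unfolding spectral_measure_def
  by (rule measure_interval_measure_Iic) (use cdf_props in auto)

lemma measure_UNIV: "measure (\<mu> x) UNIV = (norm x)\<^sup>2"
proof -
  have "emeasure (\<mu> x) UNIV = (norm x)\<^sup>2"
    unfolding spectral_measure_def by (rule interval_measure_UNIV) (use cdf_props in auto)
  then show ?thesis by (simp add: measure_def)
qed

lemma sets_mu [measurable_cong, simp]: "sets (\<mu> x) = sets borel"
  by (simp add: spectral_measure_def)

lemma space_mu [simp]: "space (\<mu> x) = UNIV"
  by (simp add: spectral_measure_def)

lemma finite_mu: "finite_measure (\<mu> x)"
  using fin_measure finite_borel_measure.axioms(1) by blast

lemma integrable_bounded:
  fixes f :: "real \<Rightarrow> real"
  assumes "f \<in> borel_measurable borel" "\<And>l. \<bar>f l\<bar> \<le> c"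
  shows "integrable (\<mu> x) f"
  by (rule finite_measure.integrable_const_bound[OF finite_mu, where B = c])
     (use assms in \<open>auto simp: measurable_cong_sets[OF sets_mu refl]\<close>)

lemma abs_integral_le:
  fixes f :: "real \<Rightarrow> real"
  assumes "f \<in> borel_measurable borel" "\<And>l. \<bar>f l\<bar> \<le> c"
  shows "\<bar>\<integral>l. f l \<partial>\<mu> x\<bar> \<le> c * (norm x)\<^sup>2"
proof -
  interpret finite_measure "\<mu> x" by (rule finite_mu)
  have "\<bar>\<integral>l. f l \<partial>\<mu> x\<bar> \<le> (\<integral>l. \<bar>f l\<bar> \<partial>\<mu> x)" by (rule integral_abs_bound)
  also have "\<dots> \<le> (\<integral>l. c \<partial>\<mu> x)"
    by (rule integral_mono) (use assms integrable_bounded[OF assms] in auto)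
  also have "\<dots> = c * (norm x)\<^sup>2" by (simp add: measure_UNIV)
  finally show ?thesis .
qed

text \<open>
  \<open>rep f B\<close> means \<open>B = \<integral> f dE\<close>, for \<open>f\<close> a uniform limit of step functions. The relation is
  generated from the projections so that algebraic laws can be checked there and passed to
  limits. The constant 1 has its own rule: combinations of indicators of \<open>{..l}\<close>, and
  their uniform limits, vanish at \<open>+\<infinity>\<close>.
\<close>

inductive rep :: "(real \<Rightarrow> real) \<Rightarrow> ('a \<Rightarrow> 'a) \<Rightarrow> bool" where
  rep_one: "rep (\<lambda>_. 1) (\<lambda>x. x)"
| rep_proj: "rep (indicator {..l}) (E l)"
| rep_lin: "rep f B \<Longrightarrow> rep g C \<Longrightarrow> rep (\<lambda>l. a * f l + b * g l) (\<lambda>x. a *\<^sub>R B x + b *\<^sub>R C x)"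
| rep_lim: "(\<And>n::nat. rep (f n) (B n)) \<Longrightarrow> uniform_limit UNIV f g sequentially
    \<Longrightarrow> (\<And>x. (\<lambda>n. B n x) \<longlonglongrightarrow> C x) \<Longrightarrow> rep g C"

text \<open>
  Uniform limits preserve all of this because the formula for the quadratic form bounds it
  by \<open>sup |f| |x|\<^sup>2\<close>, and for a self-adjoint operator this bounds the norm.
\<close>

lemma rep_props:
  assumes "rep f B"
  shows "f \<in> borel_measurable borel \<and> (\<exists>c. \<forall>l. \<bar>f l\<bar> \<le> c) \<and> sa_op B \<and> (\<forall>x. B x \<bullet> x = (\<integral>l. f l \<partial>\<mu> x))"
  using assms
proof (induction rule: rep.induct)
  case rep_one
  have "\<exists>c. \<forall>l::real. \<bar>1::real\<bar> \<le> c" by (rule exI[of _ 1]) simp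
  then show ?case by (simp add: sa_op_id measure_UNIV power2_norm_eq_inner)
next
  case (rep_proj l)
  have "\<bar>indicator {..l} l' :: real\<bar> \<le> 1" for l' by (simp add: indicator_def)
  then show ?case by (auto simp: sa_E measure_Iic)
next
  case (rep_lin f B g C a b)
  then obtain c d where cd: "\<And>l. \<bar>f l\<bar> \<le> c" "\<And>l. \<bar>g l\<bar> \<le> d" by blast
  have "\<bar>a * f l + b * g l\<bar> \<le> \<bar>a\<bar> * c + \<bar>b\<bar> * d" for l
    using mult_left_mono[OF cd(1)[of l], of "\<bar>a\<bar>"] mult_left_mono[OF cd(2)[of l], of "\<bar>b\<bar>"]
      abs_triangle_ineq[of "a * f l" "b * g l"] by (simp add: abs_mult)
  moreover have "(a *\<^sub>R B x + b *\<^sub>R C x) \<bullet> x = (\<integral>l. a * f l + b * g l \<partial>\<mu> x)" for x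
    using integrable_bounded[of f c x] integrable_bounded[of g d x] rep_lin cd
    by (simp add: inner_add_left)
  ultimately show ?case using rep_lin sa_op_comb[of B C a b] by auto
next
  case (rep_lim f B g C)
  have fm: "f n \<in> borel_measurable borel" for n using rep_lim by blast
  have pt: "(\<lambda>n. f n l) \<longlonglongrightarrow> g l" for l by (rule tendsto_uniform_limitI[OF rep_lim.hyps(2)]) simp
  have gm: "g \<in> borel_measurable borel" by (rule borel_measurable_LIMSEQ_real[where u = f]) (rule pt, rule fm)
  obtain N where N: "\<And>n l. n \<ge> N \<Longrightarrow> \<bar>f n l - g l\<bar> < 1"
    using uniform_limitD[OF rep_lim.hyps(2), of 1] by (auto simp: eventually_sequentially dist_real_def)
  obtain c0 where c0: "\<And>l. \<bar>f N l\<bar> \<le> c0" using rep_lim by blast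
  define c where "c = c0 + 2"
  have cg: "\<bar>g l\<bar> \<le> c" for l using c0[of l] N[of N l] by (simp add: c_def)
  have cf: "\<bar>f (n + N) l\<bar> \<le> c" for n l
    using c0[of l] N[of N l] N[of "n + N" l] by (simp add: c_def)
  have nb: "norm (B (n + N) x) \<le> c * norm x" for n x
    by (rule sa_op_norm_le) (use rep_lim abs_integral_le[OF fm cf] in auto)
  have lim': "(\<lambda>n. B (n + N) x) \<longlonglongrightarrow> C x" for x by (rule LIMSEQ_ignore_initial_segment[OF rep_lim.hyps(3)])
  have saC: "sa_op C" by (rule sa_op_strong_limit[of "\<lambda>n. B (n + N)" C c]) (use rep_lim nb lim' in auto)
  have "C x \<bullet> x = (\<integral>l. g l \<partial>\<mu> x)" for x
  proof -
    interpret finite_measure "\<mu> x" by (rule finite_mu)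
    have "(\<lambda>n. \<integral>l. f (n + N) l \<partial>\<mu> x) \<longlonglongrightarrow> (\<integral>l. g l \<partial>\<mu> x)"
    proof (rule integral_dominated_convergence[where w = "\<lambda>_. c"])
      show "g \<in> borel_measurable (\<mu> x)" "\<And>i. f (i + N) \<in> borel_measurable (\<mu> x)"
        using gm fm by (auto simp: measurable_cong_sets[OF sets_mu refl])
      show "AE l in \<mu> x. (\<lambda>i. f (i + N) l) \<longlonglongrightarrow> g l"
        using LIMSEQ_ignore_initial_segment[OF pt] by auto
    qed (use cf in auto)
    moreover have "(\<lambda>n. B (n + N) x \<bullet> x) \<longlonglongrightarrow> C x \<bullet> x"
      by (rule tendsto_inner[OF lim' tendsto_const])
    ultimately show ?thesis using LIMSEQ_unique rep_lim.IH by auto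
  qed
  then show ?case using gm saC cg by blast
qed

lemma rep_measurable: "rep f B \<Longrightarrow> f \<in> borel_measurable borel"
  and rep_sa: "rep f B \<Longrightarrow> sa_op B"
  and rep_quad: "rep f B \<Longrightarrow> B x \<bullet> x = (\<integral>l. f l \<partial>\<mu> x)"
  using rep_props by blast+

lemma rep_norm_le:
  assumes "rep f B" "\<And>l. \<bar>f l\<bar> \<le> c"
  shows "norm (B x) \<le> c * norm x"
  by (rule sa_op_norm_le)
     (use assms rep_props[OF assms(1)] abs_integral_le[OF _ assms(2)] in auto)

lemma rep_diff: "rep f B \<Longrightarrow> rep g C \<Longrightarrow> rep (\<lambda>l. f l - g l) (\<lambda>x. B x - C x)"
  using rep_lin[of f B g C 1 "-1"] by simp

lemma rep_add: "rep f B \<Longrightarrow> rep g C \<Longrightarrow> rep (\<lambda>l. f l + g l) (\<lambda>x. B x + C x)"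
  using rep_lin[of f B g C 1 1] by simp

lemma rep_scale: "rep f B \<Longrightarrow> rep (\<lambda>l. a * f l) (\<lambda>x. a *\<^sub>R B x)"
  using rep_lin[of f B f B a 0] by simp

lemma rep_unique:
  assumes "rep f B" "rep f C"
  shows "B = C"
proof
  fix x
  have "norm (B x - C x) \<le> 0 * norm x" by (rule rep_norm_le[OF rep_diff[OF assms]]) simp
  then show "B x = C x" by simp
qed

text \<open>
  On projections this is the law \<open>E\<^sub>l E\<^sub>l\<^sub>' = E\<^sub>m\<^sub>i\<^sub>n\<^sub>(\<^sub>l\<^sub>,\<^sub>l\<^sub>'\<^sub>)\<close>; the rest follows by induction on
  both derivations.
\<close>

lemma rep_mult:
  assumes "rep f B" "rep g C"
  shows "rep (\<lambda>l. f l * g l) (\<lambda>x. B (C x))"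
  using assms(1)
proof (induction rule: rep.induct)
  case rep_one
  then show ?case using assms(2) by simp
next
  case (rep_proj l)
  show ?case using assms(2)
  proof (induction rule: rep.induct)
    case rep_one
    then show ?case using rep.rep_proj[of l] by simp
  next
    case (rep_proj l')
    have "(\<lambda>s. indicator {..l} s * indicator {..l'} s :: real) = indicator {..min l l'}"
      by (auto simp: indicator_def fun_eq_iff)
    then show ?case using rep.rep_proj[of "min l l'"] by (simp add: E_min[abs_def])
  next
    case (rep_lin f B g C a b)
    from rep.rep_lin[OF rep_lin(3,4), of a b] show ?case
      by (simp add: sa_op_lin[OF sa_E] algebra_simps)
  next
    case (rep_lim f B g C)
    have ul: "uniform_limit UNIV (\<lambda>n s. indicator {..l} s * f n s) (\<lambda>s. indicator {..l} s * g s) sequentially"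
      using uniform_limit_mult_bounded[OF rep_lim.hyps(2), of "indicator {..l}" 1]
      by (simp add: mult.commute indicator_def)
    show ?case
      by (rule rep.rep_lim[OF rep_lim.IH ul sa_op_tendsto[OF sa_E rep_lim.hyps(3)]])
  qed
next
  case (rep_lin f B g' C' a b)
  from rep.rep_lin[OF rep_lin(3,4), of a b] show ?case by (simp add: algebra_simps)
next
  case (rep_lim f B g' C')
  obtain c where c: "\<And>l. \<bar>g l\<bar> \<le> c" using rep_props[OF assms(2)] by blast
  show ?case
    by (rule rep.rep_lim[OF rep_lim.IH uniform_limit_mult_bounded[OF rep_lim.hyps(2) c] rep_lim.hyps(3)])
qed

lemma rep_norm_sq:
  assumes "rep f B"
  shows "(norm (B x))\<^sup>2 = (\<integral>l. (f l)\<^sup>2 \<partial>\<mu> x)"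
  using rep_quad[OF rep_mult[OF assms assms], of x] sa_op_swap[OF rep_sa[OF assms], of "B x" x]
  unfolding power2_norm_eq_inner by (simp add: power2_eq_square)

text \<open>
  Uniformly close functions have operators that are close in norm, so the operators of a
  sequence of approximations converge.
\<close>

lemma rep_approx:
  assumes "\<And>e. e > 0 \<Longrightarrow> \<exists>f B. rep f B \<and> (\<forall>l. \<bar>f l - g l\<bar> \<le> e)"
  shows "\<exists>C. rep g C"
proof -
  have "\<forall>n. \<exists>f B. rep f B \<and> (\<forall>l. \<bar>f l - g l\<bar> \<le> 1 / real (Suc n))" using assms by simp
  then obtain f B where fB: "\<And>n. rep (f n) (B n)" "\<And>n l. \<bar>f n l - g l\<bar> \<le> 1 / real (Suc n)" by metis
  have z: "(\<lambda>n. 1 / real (Suc n)) \<longlonglongrightarrow> 0" by (rule LIMSEQ_Suc[OF lim_1_over_n])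
  have ul: "uniform_limit UNIV f g sequentially"
  proof (rule uniform_limitI)
    fix e :: real assume "e > 0"
    then have "\<forall>\<^sub>F n in sequentially. 1 / real (Suc n) < e" using order_tendstoD(2)[OF z] by simp
    then show "\<forall>\<^sub>F n in sequentially. \<forall>l\<in>UNIV. dist (f n l) (g l) < e"
      by (rule eventually_mono) (use fB(2) in \<open>auto simp: dist_real_def intro: le_less_trans\<close>)
  qed
  have conv: "convergent (\<lambda>n. B n x)" for x
  proof (rule Cauchy_convergent, rule CauchyI)
    fix e :: real assume e: "e > 0"
    obtain N where N: "\<And>n. n \<ge> N \<Longrightarrow> 1 / real (Suc n) < e / (2 * (norm x + 1))"
      using order_tendstoD(2)[OF z, of "e / (2 * (norm x + 1))"] e
      by (auto simp: eventually_sequentially add_nonneg_pos)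
    have "norm (B m x - B n x) < e" if "m \<ge> N" "n \<ge> N" for m n
    proof -
      have "\<bar>f m l - f n l\<bar> \<le> e / (norm x + 1)" for l
      proof -
        have "e / (norm x + 1) = e / (2 * (norm x + 1)) + e / (2 * (norm x + 1))"
          using field_sum_of_halves[of "e / (norm x + 1)"] by (simp add: mult.commute)
        then show ?thesis
          using fB(2)[of m l] fB(2)[of n l] N[OF that(1)] N[OF that(2)] by argo
      qed
      then have "norm (B m x - B n x) \<le> e / (norm x + 1) * norm x"
        by (rule rep_norm_le[OF rep_diff[OF fB(1) fB(1)]])
      also have "\<dots> < e" using e norm_ge_zero[of x] by (simp add: divide_less_eq add_nonneg_pos)
      finally show ?thesis .
    qed
    then show "\<exists>M. \<forall>m\<ge>M. \<forall>n\<ge>M. norm (B m x - B n x) < e" by blast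
  qed
  have "rep g (\<lambda>x. lim (\<lambda>n. B n x))"
    by (rule rep_lim[OF fB(1) ul]) (use conv in \<open>simp add: convergent_LIMSEQ_iff\<close>)
  then show ?thesis by blast
qed

lemma rep_Ioc: assumes "a \<le> b" shows "rep (indicator {a<..b}) (\<lambda>x. E b x - E a x)"
proof -
  have "(\<lambda>l. indicator {..b} l - indicator {..a} l :: real) = indicator {a<..b}"
    using assms by (auto simp: indicator_def fun_eq_iff)
  then show ?thesis using rep_diff[OF rep_proj[of b] rep_proj[of a]] by simp
qed

text \<open>
  Bolzano's subdivision principle applies: on a short interval a constant approximates \<open>f\<close>
  within \<open>e\<close>, and approximations on adjacent intervals, each vanishing outside its
  interval, can be added.
\<close>

lemma rep_continuous_Ioc:
  assumes f: "continuous_on UNIV f" and ab: "a \<le> b"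
  shows "\<exists>B. rep (\<lambda>l. indicator {a<..b} l * f l) B"
proof (rule rep_approx)
  fix e :: real assume e: "e > 0"
  define P where "P a b \<longleftrightarrow> (\<exists>g B. rep g B \<and> (\<forall>l. \<bar>g l - indicator {a<..b} l * f l\<bar> \<le> e) \<and> (\<forall>l. l \<notin> {a<..b} \<longrightarrow> g l = 0))" for a b
  have "P a b"
  proof (rule Bolzano[OF ab])
    fix a b c assume "P a b" "P b c" and abc: "a \<le> b" "b \<le> c"
    then obtain g B h C where g: "rep g B" "\<forall>l. \<bar>g l - indicator {a<..b} l * f l\<bar> \<le> e" "\<forall>l. l \<notin> {a<..b} \<longrightarrow> g l = 0"
      and h: "rep h C" "\<forall>l. \<bar>h l - indicator {b<..c} l * f l\<bar> \<le> e" "\<forall>l. l \<notin> {b<..c} \<longrightarrow> h l = 0"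
      unfolding P_def by blast
    have "\<bar>g l + h l - indicator {a<..c} l * f l\<bar> \<le> e" for l
    proof (cases "l \<le> b")
      case True
      then have "h l = 0" "(indicator {a<..c} l :: real) = indicator {a<..b} l"
        using h(3) abc by (auto simp: indicator_def)
      then show ?thesis using g(2) by simp
    next
      case False
      then have "g l = 0" "(indicator {a<..c} l :: real) = indicator {b<..c} l"
        using g(3) abc by (auto simp: indicator_def)
      then show ?thesis using h(2) by simp
    qed
    moreover have "g l + h l = 0" if "l \<notin> {a<..c}" for l using g(3) h(3) abc that by auto
    ultimately show "P a c" unfolding P_def using rep_add[OF g(1) h(1)] by blast
  next
    fix x assume "a \<le> x" "x \<le> b"
    have "isCont f x" using f by (simp add: continuous_on_eq_continuous_at)
    then obtain d where d: "d > 0" "\<And>y. \<bar>y - x\<bar> < d \<Longrightarrow> \<bar>f y - f x\<bar> < e"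
      using e unfolding continuous_at_eps_delta by (auto simp: dist_real_def)
    have "P a b" if "a \<le> x \<and> x \<le> b \<and> b - a < d" for a b
    proof -
      have "rep (\<lambda>l. f x * indicator {a<..b} l) (\<lambda>y. f x *\<^sub>R (E b y - E a y))"
        using rep_scale[OF rep_Ioc[of a b]] that by simp
      moreover have "\<bar>f x * indicator {a<..b} l - indicator {a<..b} l * f l\<bar> \<le> e" for l
        using d(2)[of l] that e by (auto simp: indicator_def abs_minus_commute intro: less_imp_le)
      ultimately show ?thesis unfolding P_def by fastforce
    qed
    then show "\<exists>d>0. \<forall>a b. a \<le> x \<and> x \<le> b \<and> b - a < d \<longrightarrow> P a b" using d(1) by blast
  qed
  then show "\<exists>g B. rep g B \<and> (\<forall>l. \<bar>g l - indicator {a<..b} l * f l\<bar> \<le> e)" unfolding P_def by blast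
qed

section \<open>Spectral integrals of continuous functions\<close>

definition trunc :: "(real \<Rightarrow> real) \<Rightarrow> nat \<Rightarrow> real \<Rightarrow> real" where
  "trunc f n l = indicator {- real n<..real n} l * f l"

text \<open>
  The bounded operator \<open>\<integral> f dE\<close> over \<open>(-n, n]\<close>; for continuous \<open>f\<close> it exists and is
  unique.
\<close>

definition cutop :: "(real \<Rightarrow> real) \<Rightarrow> nat \<Rightarrow> 'a \<Rightarrow> 'a" where
  "cutop f n = (SOME B. rep (trunc f n) B)"

abbreviation cont :: "(real \<Rightarrow> real) \<Rightarrow> bool" where
  "cont f \<equiv> continuous_on UNIV f"

lemma rep_cutop: assumes "cont f" shows "rep (trunc f n) (cutop f n)"
proof -
  have "\<exists>B. rep (trunc f n) B"
    using rep_continuous_Ioc[OF assms, of "- real n" "real n"] by (simp add: trunc_def[abs_def])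
  then show ?thesis unfolding cutop_def by (rule someI_ex)
qed

lemma cont_measurable: "cont f \<Longrightarrow> f \<in> borel_measurable borel"
  by (rule borel_measurable_continuous_onI)

lemma cont_sq: "cont f \<Longrightarrow> cont (\<lambda>l. (f l)\<^sup>2)"
  by (intro continuous_intros)

lemma trunc_measurable: "cont f \<Longrightarrow> trunc f n \<in> borel_measurable (\<mu> x)"
  using rep_measurable[OF rep_cutop] by (simp add: measurable_cong_sets[OF sets_mu refl])

lemma cutop_add:
  assumes "cont f" "cont g"
  shows "cutop (\<lambda>l. a * f l + b * g l) n x = a *\<^sub>R cutop f n x + b *\<^sub>R cutop g n x"
proof -
  have "cont (\<lambda>l. a * f l + b * g l)" using assms by (intro continuous_intros)
  note 1 = rep_cutop[OF this, of n]
  have "trunc (\<lambda>l. a * f l + b * g l) n = (\<lambda>l. a * trunc f n l + b * trunc g n l)"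
    by (auto simp: trunc_def fun_eq_iff algebra_simps)
  then have "cutop (\<lambda>l. a * f l + b * g l) n = (\<lambda>x. a *\<^sub>R cutop f n x + b *\<^sub>R cutop g n x)"
    using rep_unique[OF 1] rep_lin[OF rep_cutop[OF assms(1), of n] rep_cutop[OF assms(2), of n], of a b]
    by simp
  then show ?thesis by simp
qed

lemma cutop_mult:
  assumes "cont f" "cont g" "n \<le> k"
  shows "cutop f n (cutop g k x) = cutop (\<lambda>l. f l * g l) n x"
proof -
  have "cont (\<lambda>l. f l * g l)" using assms by (intro continuous_intros)
  note 1 = rep_cutop[OF this, of n]
  have "trunc (\<lambda>l. f l * g l) n = (\<lambda>l. trunc f n l * trunc g k l)"
    using assms(3) by (auto simp: trunc_def fun_eq_iff indicator_def)
  then have "cutop (\<lambda>l. f l * g l) n = (\<lambda>x. cutop f n (cutop g k x))"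
    using rep_unique[OF 1] rep_mult[OF rep_cutop[OF assms(1), of n] rep_cutop[OF assms(2), of k]]
    by simp
  then show ?thesis by simp
qed

lemma sa_cutop: "cont f \<Longrightarrow> sa_op (cutop f n)"
  using rep_sa rep_cutop by blast

lemma cutop_norm_sq: "cont f \<Longrightarrow> (norm (cutop f n x))\<^sup>2 = (\<integral>l. trunc (\<lambda>l. (f l)\<^sup>2) n l \<partial>\<mu> x)"
proof -
  assume f: "cont f"
  have "(\<lambda>l. (trunc f n l)\<^sup>2) = trunc (\<lambda>l. (f l)\<^sup>2) n"
    by (auto simp: trunc_def indicator_def fun_eq_iff)
  then show ?thesis using rep_norm_sq[OF rep_cutop[OF f], of n x] by simp
qed

lemma trunc_integrable: "cont f \<Longrightarrow> integrable (\<mu> x) (trunc f n)"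
  using rep_props[OF rep_cutop[of f n]] integrable_bounded by blast

lemma trunc_tendsto: "(\<lambda>n. trunc f n l) \<longlonglongrightarrow> f l"
proof (rule tendsto_eventually)
  obtain N where "\<bar>l\<bar> < real N" using reals_Archimedean2 by blast
  then have "trunc f n l = f l" if "n \<ge> N" for n
    using that by (auto simp: trunc_def indicator_def)
  then show "\<forall>\<^sub>F n in sequentially. trunc f n l = f l" by (auto simp: eventually_sequentially)
qed

lemma trunc_integral_tendsto:
  assumes "cont f" "integrable (\<mu> x) f"
  shows "(\<lambda>n. \<integral>l. trunc f n l \<partial>\<mu> x) \<longlonglongrightarrow> (\<integral>l. f l \<partial>\<mu> x)"
proof (rule integral_dominated_convergence[where w = "\<lambda>l. \<bar>f l\<bar>"])
  show "f \<in> borel_measurable (\<mu> x)" using assms(2) by simp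
  show "trunc f n \<in> borel_measurable (\<mu> x)" for n by (rule trunc_measurable[OF assms(1)])
  show "integrable (\<mu> x) (\<lambda>l. \<bar>f l\<bar>)" using assms(2) by simp
  show "AE l in \<mu> x. (\<lambda>n. trunc f n l) \<longlonglongrightarrow> f l" using trunc_tendsto by simp
  show "AE l in \<mu> x. norm (trunc f n l) \<le> \<bar>f l\<bar>" for n by (auto simp: trunc_def indicator_def)
qed

abbreviation sdom where "sdom \<equiv> spectral_integral_dom E"

text \<open>
  The squared norm of a truncation is the integral of \<open>f\<^sup>2\<close> over \<open>(-n, n]\<close>, so this is
  monotone convergence. It turns membership in a domain into a uniform bound on the
  truncations.
\<close>

lemma sdom_iff_bounded:
  assumes f: "cont f"
  shows "x \<in> sdom f \<longleftrightarrow> (\<exists>K. \<forall>n. norm (cutop f n x) \<le> K)"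
proof
  assume x: "x \<in> sdom f"
  then have i: "integrable (\<mu> x) (\<lambda>l. (f l)\<^sup>2)" by (simp add: spectral_integral_dom_def)
  have "(norm (cutop f n x))\<^sup>2 \<le> (\<integral>l. (f l)\<^sup>2 \<partial>\<mu> x)" for n
    unfolding cutop_norm_sq[OF f]
    by (rule integral_mono[OF trunc_integrable[OF cont_sq[OF f]] i]) (auto simp: trunc_def indicator_def)
  then have "norm (cutop f n x) \<le> sqrt (\<integral>l. (f l)\<^sup>2 \<partial>\<mu> x)" for n by (rule real_le_rsqrt)
  then show "\<exists>K. \<forall>n. norm (cutop f n x) \<le> K" by blast
next
  assume "\<exists>K. \<forall>n. norm (cutop f n x) \<le> K"
  then obtain K where K: "\<And>n. norm (cutop f n x) \<le> K" by blast
  let ?I = "\<lambda>n. \<integral>l. trunc (\<lambda>l. (f l)\<^sup>2) n l \<partial>\<mu> x"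
  note ti = trunc_integrable[OF cont_sq[OF f]]
  have mono: "trunc (\<lambda>l. (f l)\<^sup>2) n l \<le> trunc (\<lambda>l. (f l)\<^sup>2) m l" if "n \<le> m" for n m l
    using that by (auto simp: trunc_def indicator_def)
  have "incseq ?I" by (rule incseq_SucI) (rule integral_mono[OF ti ti mono], simp)
  moreover have "?I n \<le> K\<^sup>2" for n
    unfolding cutop_norm_sq[OF f, symmetric] using K[of n] by (simp add: power_mono)
  ultimately obtain L where L: "?I \<longlonglongrightarrow> L" using incseq_convergent by metis
  have "integrable (\<mu> x) (\<lambda>l. (f l)\<^sup>2)"
  proof (rule integrable_monotone_convergence[where f = "trunc (\<lambda>l. (f l)\<^sup>2)" and x = L])
    show "AE l in \<mu> x. mono (\<lambda>n. trunc (\<lambda>l. (f l)\<^sup>2) n l)" using mono by (simp add: mono_def)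
    show "AE l in \<mu> x. (\<lambda>i. trunc (\<lambda>l. (f l)\<^sup>2) i l) \<longlonglongrightarrow> (f l)\<^sup>2"
      using trunc_tendsto[of "\<lambda>l. (f l)\<^sup>2"] by simp
    show "(\<lambda>l. (f l)\<^sup>2) \<in> borel_measurable (\<mu> x)"
      using cont_measurable[OF cont_sq[OF f]] by (simp add: measurable_cong_sets[OF sets_mu refl])
  qed (rule ti, rule L)
  then show "x \<in> sdom f" by (simp add: spectral_integral_dom_def)
qed

lemma sdom_lin:
  assumes f: "cont f" and xy: "x \<in> sdom f" "y \<in> sdom f"
  shows "a *\<^sub>R x + b *\<^sub>R y \<in> sdom f"
proof -
  obtain K L where KL: "\<And>n. norm (cutop f n x) \<le> K" "\<And>n. norm (cutop f n y) \<le> L"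
    using xy sdom_iff_bounded[OF f] by metis
  have "norm (cutop f n (a *\<^sub>R x + b *\<^sub>R y)) \<le> \<bar>a\<bar> * K + \<bar>b\<bar> * L" for n
  proof -
    have "norm (cutop f n (a *\<^sub>R x + b *\<^sub>R y)) \<le> \<bar>a\<bar> * norm (cutop f n x) + \<bar>b\<bar> * norm (cutop f n y)"
      using norm_triangle_ineq[of "a *\<^sub>R cutop f n x" "b *\<^sub>R cutop f n y"]
      by (simp add: sa_op_lin[OF sa_cutop[OF f]])
    also have "\<dots> \<le> \<bar>a\<bar> * K + \<bar>b\<bar> * L" by (intro add_mono mult_left_mono KL) auto
    finally show ?thesis .
  qed
  then show ?thesis unfolding sdom_iff_bounded[OF f] by blast
qed

lemma sdom_add: "cont f \<Longrightarrow> x \<in> sdom f \<Longrightarrow> y \<in> sdom f \<Longrightarrow> x + y \<in> sdom f"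
  using sdom_lin[of f x y 1 1] by simp

lemma sdom_diff: "cont f \<Longrightarrow> x \<in> sdom f \<Longrightarrow> y \<in> sdom f \<Longrightarrow> x - y \<in> sdom f"
  using sdom_lin[of f x y 1 "-1"] by simp

lemma sdom_integrable:
  assumes f: "cont f" and x: "x \<in> sdom f"
  shows "integrable (\<mu> x) f"
proof (rule Bochner_Integration.integrable_bound[where f = "\<lambda>l. 1 + (f l)\<^sup>2"])
  interpret finite_measure "\<mu> x" by (rule finite_mu)
  show "integrable (\<mu> x) (\<lambda>l. 1 + (f l)\<^sup>2)" using x by (simp add: spectral_integral_dom_def)
  show "f \<in> borel_measurable (\<mu> x)"
    using cont_measurable[OF f] by (simp add: measurable_cong_sets[OF sets_mu refl])
  have "\<bar>c\<bar> \<le> \<bar>1 + c\<^sup>2\<bar>" for c :: real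
  proof -
    have "0 \<le> (\<bar>c\<bar> - 1)\<^sup>2" by simp
    then have "2 * \<bar>c\<bar> \<le> 1 + c\<^sup>2" by (simp add: power2_diff)
    then show ?thesis by simp
  qed
  then show "AE l in \<mu> x. norm (f l) \<le> norm (1 + (f l)\<^sup>2)" by simp
qed

lemma cutop_tendsto_ex:
  assumes f: "cont f" and x: "x \<in> sdom f"
  shows "convergent (\<lambda>n. cutop f n x)"
proof -
  let ?I = "\<lambda>n. \<integral>l. trunc (\<lambda>l. (f l)\<^sup>2) n l \<partial>\<mu> x"
  have i: "integrable (\<mu> x) (\<lambda>l. (f l)\<^sup>2)" using x by (simp add: spectral_integral_dom_def)
  note ti = trunc_integrable[OF cont_sq[OF f]]
  have CI: "Cauchy ?I" by (rule LIMSEQ_imp_Cauchy[OF trunc_integral_tendsto[OF cont_sq[OF f] i]])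
  have diff: "(norm (cutop f m x - cutop f n x))\<^sup>2 = ?I m - ?I n" if "n \<le> m" for n m
  proof -
    have "(norm (cutop f m x - cutop f n x))\<^sup>2 = (\<integral>l. (trunc f m l - trunc f n l)\<^sup>2 \<partial>\<mu> x)"
      by (rule rep_norm_sq[OF rep_diff[OF rep_cutop[OF f] rep_cutop[OF f]]])
    also have "\<dots> = (\<integral>l. trunc (\<lambda>l. (f l)\<^sup>2) m l - trunc (\<lambda>l. (f l)\<^sup>2) n l \<partial>\<mu> x)"
      using that by (intro Bochner_Integration.integral_cong) (auto simp: trunc_def indicator_def)
    also have "\<dots> = ?I m - ?I n" by (rule Bochner_Integration.integral_diff[OF ti ti])
    finally show ?thesis .
  qed
  have "Cauchy (\<lambda>n. cutop f n x)"
    by (rule Cauchy_if_squared_dist_le[OF CI]) (simp add: diff)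
  then show ?thesis by (rule Cauchy_convergent)
qed

lemma cutop_one: "cutop (\<lambda>_. 1) n x = E (real n) x - E (- real n) x"
proof -
  have 1: "cont (\<lambda>_. 1)" by simp
  have "trunc (\<lambda>_. 1) n = indicator {- real n<..real n}" by (auto simp: trunc_def fun_eq_iff)
  then have "cutop (\<lambda>_. 1) n = (\<lambda>x. E (real n) x - E (- real n) x)"
    using rep_unique[OF rep_cutop[OF 1, of n]] rep_Ioc[of "- real n" "real n"] by simp
  then show ?thesis by (rule fun_cong)
qed

text \<open>
  Vectors of bounded spectral support lie in every domain; by the next lemma they are
  dense.
\<close>

lemma E_diff_in_sdom:
  assumes f: "cont f" shows "E (real k) x - E (- real k) x \<in> sdom f"
proof -
  have 1: "cont (\<lambda>_. 1)" by simp
  have eq: "E (real k) x - E (- real k) x = cutop (\<lambda>_. 1) k x" by (simp add: cutop_one)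
  have fm: "cutop f n (cutop (\<lambda>_. 1) k x) = cutop f (min n k) x" for n
  proof (cases "n \<le> k")
    case True
    then show ?thesis using cutop_mult[OF f 1 True, of x] by simp
  next
    case False
    have "(\<lambda>l. trunc f n l * trunc (\<lambda>_. 1) k l) = trunc f k"
      using False by (auto simp: trunc_def fun_eq_iff indicator_def)
    then have "(\<lambda>x. cutop f n (cutop (\<lambda>_. 1) k x)) = cutop f k"
      using rep_unique[OF rep_cutop[OF f, of k]] rep_mult[OF rep_cutop[OF f, of n] rep_cutop[OF 1, of k]] by metis
    then show ?thesis using False by (simp add: fun_eq_iff min_def)
  qed
  have "norm (cutop f n (cutop (\<lambda>_. 1) k x)) \<le> Max ((\<lambda>j. norm (cutop f j x)) ` {..k})" for n
    unfolding fm by (rule Max_ge) auto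
  then show ?thesis unfolding sdom_iff_bounded[OF f] eq by blast
qed

lemma E_diff_tendsto: "(\<lambda>k. E (real k) x - E (- real k) x) \<longlonglongrightarrow> x"
proof -
  have "(\<lambda>k. E (real k) x) \<longlonglongrightarrow> x"
    by (rule filterlim_compose[OF E_top filterlim_real_sequentially])
  moreover have "(\<lambda>k. E (- real k) x) \<longlonglongrightarrow> 0"
    by (rule filterlim_compose[OF E_bot filterlim_compose[OF filterlim_uminus_at_bot_at_top filterlim_real_sequentially]])
  ultimately show ?thesis using tendsto_diff by fastforce
qed

abbreviation sint where "sint \<equiv> spectral_integral E"

text \<open>
  The limit of the truncations satisfies the polarized identity that defines the spectral
  integral, and the identity has only one solution because the domain is dense.
\<close>

lemma cutop_tendsto:
  assumes f: "cont f" and x: "x \<in> sdom f"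
  shows "(\<lambda>n. cutop f n x) \<longlonglongrightarrow> sint f x"
proof -
  obtain z where z: "(\<lambda>n. cutop f n x) \<longlonglongrightarrow> z" using cutop_tendsto_ex[OF f x] convergent_def by blast
  let ?P = "\<lambda>z. \<forall>y\<in>sdom f. z \<bullet> y = ((LINT l|\<mu> (x + y). f l) - (LINT l|\<mu> (x - y). f l)) / 4"
  have Pz: "?P z"
  proof
    fix y assume y: "y \<in> sdom f"
    have eq: "cutop f n x \<bullet> y = ((LINT l|\<mu> (x + y). trunc f n l) - (LINT l|\<mu> (x - y). trunc f n l)) / 4" for n
      unfolding rep_quad[OF rep_cutop[OF f], symmetric] sa_op_lin[OF sa_cutop[OF f]]
      using sa_op_swap[OF sa_cutop[OF f], of n x y]
      by (simp add: inner_simps inner_commute)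
    have "(\<lambda>n. ((LINT l|\<mu> (x + y). trunc f n l) - (LINT l|\<mu> (x - y). trunc f n l)) / 4)
       \<longlonglongrightarrow> ((LINT l|\<mu> (x + y). f l) - (LINT l|\<mu> (x - y). f l)) / 4"
      by (intro tendsto_divide tendsto_diff tendsto_const trunc_integral_tendsto f sdom_integrable
          sdom_add sdom_diff x y) auto
    moreover have "(\<lambda>n. cutop f n x \<bullet> y) \<longlonglongrightarrow> z \<bullet> y" by (rule tendsto_inner[OF z tendsto_const])
    ultimately show "z \<bullet> y = ((LINT l|\<mu> (x + y). f l) - (LINT l|\<mu> (x - y). f l)) / 4"
      unfolding eq[symmetric] using LIMSEQ_unique by blast
  qed
  have "sint f x = z" unfolding spectral_integral_def
  proof (rule the_equality)
    show "?P z" by fact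
    fix w assume w: "?P w"
    have d: "(w - z) \<bullet> y = 0" if "y \<in> sdom f" for y
      unfolding inner_diff_left using bspec[OF w that] bspec[OF Pz that] by simp
    have "(\<lambda>k. (w - z) \<bullet> (E (real k) (w - z) - E (- real k) (w - z))) \<longlonglongrightarrow> (w - z) \<bullet> (w - z)"
      by (rule tendsto_inner[OF tendsto_const E_diff_tendsto])
    then have "(\<lambda>k. 0) \<longlonglongrightarrow> (w - z) \<bullet> (w - z)" by (simp only: d[OF E_diff_in_sdom[OF f]])
    then show "w = z" using LIMSEQ_unique[OF _ tendsto_const, of 0] by fastforce
  qed
  then show ?thesis using z by simp
qed

lemma sint_norm_sq:
  assumes f: "cont f" and x: "x \<in> sdom f"
  shows "(norm (sint f x))\<^sup>2 = (\<integral>l. (f l)\<^sup>2 \<partial>\<mu> x)"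
proof -
  have i: "integrable (\<mu> x) (\<lambda>l. (f l)\<^sup>2)" using x by (simp add: spectral_integral_dom_def)
  have "(\<lambda>n. (norm (cutop f n x))\<^sup>2) \<longlonglongrightarrow> (norm (sint f x))\<^sup>2"
    by (intro tendsto_power tendsto_norm cutop_tendsto[OF f x])
  then show ?thesis
    unfolding cutop_norm_sq[OF f] using trunc_integral_tendsto[OF cont_sq[OF f] i] LIMSEQ_unique by blast
qed

lemma sint_quad:
  assumes f: "cont f" and x: "x \<in> sdom f"
  shows "sint f x \<bullet> x = (\<integral>l. f l \<partial>\<mu> x)"
proof -
  have "(\<lambda>n. cutop f n x \<bullet> x) \<longlonglongrightarrow> sint f x \<bullet> x"
    by (rule tendsto_inner[OF cutop_tendsto[OF f x] tendsto_const])
  then show ?thesis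
    unfolding rep_quad[OF rep_cutop[OF f]]
    using trunc_integral_tendsto[OF f sdom_integrable[OF f x]] LIMSEQ_unique by blast
qed

lemma sint_lin:
  assumes f: "cont f" and xy: "x \<in> sdom f" "y \<in> sdom f"
  shows "sint f (a *\<^sub>R x + b *\<^sub>R y) = a *\<^sub>R sint f x + b *\<^sub>R sint f y"
proof -
  have "(\<lambda>n. a *\<^sub>R cutop f n x + b *\<^sub>R cutop f n y) \<longlonglongrightarrow> a *\<^sub>R sint f x + b *\<^sub>R sint f y"
    by (intro tendsto_add tendsto_scaleR tendsto_const cutop_tendsto f xy)
  then show ?thesis
    using LIMSEQ_unique[OF cutop_tendsto[OF f sdom_lin[OF f xy]]] by (simp add: sa_op_lin[OF sa_cutop[OF f]])
qed

lemma sdom_fun_lin: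
  assumes f: "cont f" and g: "cont g" and x: "x \<in> sdom f" "x \<in> sdom g"
  shows "x \<in> sdom (\<lambda>l. a * f l + b * g l)"
    and "sint (\<lambda>l. a * f l + b * g l) x = a *\<^sub>R sint f x + b *\<^sub>R sint g x"
proof -
  have c: "cont (\<lambda>l. a * f l + b * g l)" using f g by (intro continuous_intros)
  obtain K L where KL: "\<And>n. norm (cutop f n x) \<le> K" "\<And>n. norm (cutop g n x) \<le> L"
    using x sdom_iff_bounded f g by metis
  have "norm (cutop (\<lambda>l. a * f l + b * g l) n x) \<le> \<bar>a\<bar> * K + \<bar>b\<bar> * L" for n
  proof -
    have "norm (cutop (\<lambda>l. a * f l + b * g l) n x) \<le> \<bar>a\<bar> * norm (cutop f n x) + \<bar>b\<bar> * norm (cutop g n x)"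
      using norm_triangle_ineq[of "a *\<^sub>R cutop f n x" "b *\<^sub>R cutop g n x"] by (simp add: cutop_add f g)
    also have "\<dots> \<le> \<bar>a\<bar> * K + \<bar>b\<bar> * L" by (intro add_mono mult_left_mono KL) auto
    finally show ?thesis .
  qed
  then show d: "x \<in> sdom (\<lambda>l. a * f l + b * g l)" unfolding sdom_iff_bounded[OF c] by blast
  have "(\<lambda>n. a *\<^sub>R cutop f n x + b *\<^sub>R cutop g n x) \<longlonglongrightarrow> a *\<^sub>R sint f x + b *\<^sub>R sint g x"
    by (intro tendsto_add tendsto_scaleR tendsto_const cutop_tendsto f g x)
  then show "sint (\<lambda>l. a * f l + b * g l) x = a *\<^sub>R sint f x + b *\<^sub>R sint g x"
    using LIMSEQ_unique[OF cutop_tendsto[OF c d]] by (simp add: cutop_add f g)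
qed

text \<open>
  Truncations multiply exactly: truncating \<open>f\<close> at \<open>n\<close> after the spectral integral of \<open>g\<close>
  is the truncation of the product at \<open>n\<close>.
\<close>

lemma sint_mult:
  assumes f: "cont f" and g: "cont g" and x: "x \<in> sdom g" "x \<in> sdom (\<lambda>l. f l * g l)"
  shows "sint g x \<in> sdom f" "sint f (sint g x) = sint (\<lambda>l. f l * g l) x"
proof -
  have c: "cont (\<lambda>l. f l * g l)" using f g by (intro continuous_intros)
  have eq: "cutop f n (sint g x) = cutop (\<lambda>l. f l * g l) n x" for n
  proof -
    have "(\<lambda>k. cutop f n (cutop g k x)) \<longlonglongrightarrow> cutop f n (sint g x)"
      by (rule sa_op_tendsto[OF sa_cutop[OF f] cutop_tendsto[OF g x(1)]])
    moreover have "(\<lambda>k. cutop f n (cutop g k x)) \<longlonglongrightarrow> cutop (\<lambda>l. f l * g l) n x"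
      by (rule tendsto_eventually)
         (use cutop_mult[OF f g, of n] in \<open>auto simp: eventually_sequentially\<close>)
    ultimately show ?thesis by (rule LIMSEQ_unique)
  qed
  show d: "sint g x \<in> sdom f"
    using x(2) unfolding sdom_iff_bounded[OF f] sdom_iff_bounded[OF c] eq .
  show "sint f (sint g x) = sint (\<lambda>l. f l * g l) x"
    using LIMSEQ_unique[OF cutop_tendsto[OF f d]] cutop_tendsto[OF c x(2)] unfolding eq by blast
qed

end

section \<open>The spectral family of a coercive operator\<close>

locale coercive_operator =
  fixes D :: "'a::{real_inner, complete_space} set" and A :: "'a \<Rightarrow> 'a" and c :: real
  assumes sadj: "self_adjoint_operator D A" and c_pos: "c > 0"
    and coercive: "\<And>x. x \<in> D \<Longrightarrow> c * (norm x)\<^sup>2 \<le> A x \<bullet> x"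
begin

lemma D_subspace: "subspace D"
  and A_add: "x \<in> D \<Longrightarrow> y \<in> D \<Longrightarrow> A (x + y) = A x + A y"
  and A_scale: "x \<in> D \<Longrightarrow> A (r *\<^sub>R x) = r *\<^sub>R A x"
  and A_adj: "(\<forall>x\<in>D. A x \<bullet> y = x \<bullet> z) \<longleftrightarrow> (y \<in> D \<and> z = A y)"
  using sadj unfolding self_adjoint_operator_def linear_operator_on_def by blast+

lemma D_add: "x \<in> D \<Longrightarrow> y \<in> D \<Longrightarrow> x + y \<in> D"
  and D_scale: "x \<in> D \<Longrightarrow> r *\<^sub>R x \<in> D" and D_zero: "0 \<in> D"
  and D_diff: "x \<in> D \<Longrightarrow> y \<in> D \<Longrightarrow> x - y \<in> D"
  using D_subspace by (auto simp: subspace_def subspace_diff[OF D_subspace])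

lemma A_diff: "x \<in> D \<Longrightarrow> y \<in> D \<Longrightarrow> A (x - y) = A x - A y"
  using A_add[of x "(-1) *\<^sub>R y"] A_scale[of y "-1"] D_scale[of y "-1"] by simp

lemma A_sym: "x \<in> D \<Longrightarrow> y \<in> D \<Longrightarrow> A x \<bullet> y = x \<bullet> A y"
  using A_adj[of y "A y"] by simp

lemma A_norm_ge: assumes "x \<in> D" shows "c * norm x \<le> norm (A x)"
proof (cases "x = 0")
  case False
  have "c * norm x * norm x \<le> norm (A x) * norm x"
    using coercive[OF assms] norm_cauchy_schwarz[of "A x" x] by (simp add: power2_eq_square)
  then show ?thesis using False by simp
qed simp

lemma A_inj: "x \<in> D \<Longrightarrow> y \<in> D \<Longrightarrow> A x = A y \<Longrightarrow> x = y"
  using A_norm_ge[of "x - y"] A_diff[of x y] D_diff[of x y] c_pos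
  by (simp add: mult_le_0_iff)

lemma A_closed_graph:
  assumes "\<And>n. x n \<in> D" "x \<longlonglongrightarrow> y" "(\<lambda>n. A (x n)) \<longlonglongrightarrow> z"
  shows "y \<in> D \<and> z = A y"
proof -
  have "A v \<bullet> y = v \<bullet> z" if "v \<in> D" for v
  proof (rule LIMSEQ_unique)
    show "(\<lambda>n. A v \<bullet> x n) \<longlonglongrightarrow> A v \<bullet> y" by (rule tendsto_inner[OF tendsto_const assms(2)])
    show "(\<lambda>n. A v \<bullet> x n) \<longlonglongrightarrow> v \<bullet> z"
      using tendsto_inner[OF tendsto_const assms(3), of v] by (simp add: A_sym[OF that assms(1)])
  qed
  then show ?thesis using A_adj by blast
qed

text \<open>
  Coercivity and the closed graph make the range closed. A vector \<open>z\<close> orthogonal to the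
  range belongs to the domain of the adjoint, so \<open>z \<in> D\<close> and \<open>A z = 0\<close>, and coercivity
  gives \<open>z = 0\<close>.
\<close>

lemma A_surj: "\<exists>y\<in>D. A y = x"
proof (rule ccontr)
  assume "\<not> ?thesis"
  then have "x \<notin> A ` D" by blast
  then have "A ` D \<noteq> UNIV" by blast
  moreover have "closed (A ` D)"
    unfolding closed_sequential_limits
  proof (intro allI impI)
    fix f l assume fl: "(\<forall>n. f n \<in> A ` D) \<and> f \<longlonglongrightarrow> l"
    then have "\<forall>n. \<exists>x\<in>D. f n = A x" by blast
    then obtain x where x: "\<And>n. x n \<in> D" "\<And>n. f n = A (x n)" by metis
    have "Cauchy x"
    proof (rule metric_CauchyI)
      fix e :: real assume e: "e > 0"
      obtain M where M: "\<And>m n. m \<ge> M \<Longrightarrow> n \<ge> M \<Longrightarrow> dist (f m) (f n) < c * e"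
        using LIMSEQ_imp_Cauchy[of f l] fl metric_CauchyD[of f "c * e"] e c_pos by auto
      have "dist (x m) (x n) < e" if "m \<ge> M" "n \<ge> M" for m n
      proof -
        have "c * dist (x m) (x n) < c * e"
          using A_norm_ge[of "x m - x n"] M[OF that] x by (simp add: dist_norm A_diff D_diff)
        then show ?thesis using c_pos by simp
      qed
      then show "\<exists>M. \<forall>m\<ge>M. \<forall>n\<ge>M. dist (x m) (x n) < e" by blast
    qed
    then obtain y where y: "x \<longlonglongrightarrow> y" using Cauchy_convergent convergent_def by blast
    have "(\<lambda>n. A (x n)) \<longlonglongrightarrow> l" using fl unfolding x(2)[symmetric] by simp
    from A_closed_graph[OF x(1) y this] show "l \<in> A ` D" by blast
  qed
  moreover have "subspace (A ` D)"
    unfolding subspace_def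
  proof (intro conjI ballI allI)
    show "0 \<in> A ` D" using A_scale[OF D_zero, of 0] D_zero by (metis image_eqI scaleR_zero_left)
  qed (auto simp: A_add[symmetric] A_scale[symmetric] D_add D_scale)
  ultimately obtain z where z: "z \<noteq> 0" "\<And>y. y \<in> A ` D \<Longrightarrow> z \<bullet> y = 0"
    using closed_subspace_orthogonal_vector by blast
  have "\<forall>x\<in>D. A x \<bullet> z = x \<bullet> 0"
  proof
    fix x assume "x \<in> D"
    then have "z \<bullet> A x = 0" using z(2) by blast
    then show "A x \<bullet> z = x \<bullet> 0" by (simp add: inner_commute)
  qed
  then have zD: "z \<in> D" "0 = A z" using A_adj by blast+
  then show False using A_norm_ge[OF zD(1)] z(1) c_pos by (simp add: mult_le_0_iff)
qed

definition T :: "'a \<Rightarrow> 'a" where "T = inv_into D A"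

lemma T_D: "T x \<in> D" and A_T: "A (T x) = x"
  using A_surj[of x] unfolding T_def by (auto intro: inv_into_into f_inv_into_f)

lemma T_A: "x \<in> D \<Longrightarrow> T (A x) = x"
  using A_inj[OF T_D _ A_T] by blast

lemma T_norm: "norm (T x) \<le> norm x * (1 / c)"
  using A_norm_ge[OF T_D, of x] c_pos by (simp add: A_T field_simps)

lemma sa_T: "sa_op T"
  unfolding sa_op_def
proof (intro conjI allI)
  show "bounded_linear T"
  proof (rule bounded_linear_intro[OF _ _ T_norm])
    show "T (x + y) = T x + T y" for x y
      by (rule A_inj) (simp_all add: T_D D_add A_add A_T)
    show "T (r *\<^sub>R x) = r *\<^sub>R T x" for r x
      by (rule A_inj) (simp_all add: T_D D_scale A_scale A_T)
  qed
  show "T x \<bullet> y = x \<bullet> T y" for x y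
    using A_sym[OF T_D T_D, of x y] by (simp add: A_T)
qed

lemma T_coercive: "c * (norm (T x))\<^sup>2 \<le> T x \<bullet> x"
  using coercive[OF T_D, of x] by (simp add: A_T inner_commute)

lemma T_quad_le: "c * (T x \<bullet> x) \<le> (norm x)\<^sup>2"
proof -
  have "T x \<bullet> x \<le> norm (T x) * norm x" by (rule norm_cauchy_schwarz)
  also have "\<dots> \<le> (norm x * (1 / c)) * norm x" by (rule mult_right_mono[OF T_norm]) simp
  finally show ?thesis using c_pos by (simp add: field_simps power2_eq_square)
qed

lemma T_inj: "T x = 0 \<Longrightarrow> x = 0"
  using A_T[of x] A_scale[OF D_zero, of 0] by simp

text \<open>
  \<open>P\<close> projects onto the part of the space where \<open>l T \<ge> 1\<close>, that is \<open>A \<le> l\<close>. Commutation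
  with everything that commutes with \<open>T\<close> makes the projections for different \<open>l\<close> commute.
\<close>

definition spec_proj :: "real \<Rightarrow> ('a \<Rightarrow> 'a) \<Rightarrow> bool" where
  "spec_proj l P \<longleftrightarrow> orth_projector P
     \<and> (\<forall>C. bounded_linear C \<longrightarrow> (\<forall>y. C (T y) = T (C y)) \<longrightarrow> (\<forall>x. C (P x) = P (C x)))
     \<and> (\<forall>x. P x = x \<longrightarrow> (norm x)\<^sup>2 \<le> l * (T x \<bullet> x))
     \<and> (\<forall>x. P x = 0 \<longrightarrow> l * (T x \<bullet> x) \<le> (norm x)\<^sup>2)
     \<and> (\<forall>x. P x = 0 \<longrightarrow> l * (T x \<bullet> x) = (norm x)\<^sup>2 \<longrightarrow> x = 0)"

lemma spec_proj_ex: "\<exists>P. spec_proj l P"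
proof -
  define S where "S x = l *\<^sub>R T x + (-1) *\<^sub>R x" for x
  have S: "sa_op S" unfolding S_def[abs_def] by (rule sa_op_comb[OF sa_T sa_op_id])
  have q: "S x \<bullet> x = l * (T x \<bullet> x) - (norm x)\<^sup>2" for x
    by (simp add: S_def inner_diff_left power2_norm_eq_inner)
  obtain P where P: "orth_projector P"
    "\<And>C x. bounded_linear C \<Longrightarrow> (\<And>y. C (S y) = S (C y)) \<Longrightarrow> C (P x) = P (C x)"
    "\<And>x. P x = x \<Longrightarrow> 0 \<le> S x \<bullet> x" "\<And>x. P x = 0 \<Longrightarrow> S x \<bullet> x \<le> 0"
    "\<And>x. P x = 0 \<Longrightarrow> S x \<bullet> x = 0 \<Longrightarrow> x = 0"
    using nonneg_part_projector[OF S] by blast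
  have "C (P x) = P (C x)" if C: "bounded_linear C" "\<forall>y. C (T y) = T (C y)" for C x
  proof (rule P(2)[OF C(1)])
    interpret C: bounded_linear C by fact
    show "C (S y) = S (C y)" for y by (simp add: S_def C.diff C.scaleR C.neg C(2))
  qed
  then have "spec_proj l P" unfolding spec_proj_def using P(1,3,4,5) unfolding q by simp
  then show ?thesis by blast
qed

definition E :: "real \<Rightarrow> 'a \<Rightarrow> 'a" where
  "E l = (if l \<le> 0 then (\<lambda>_. 0) else (SOME P. spec_proj l P))"

lemma E_spec: "l > 0 \<Longrightarrow> spec_proj l (E l)"
  unfolding E_def using someI_ex[OF spec_proj_ex, of l] by simp

lemma sa_E: "sa_op (E l)"
proof (cases "l > 0")
  case True
  then show ?thesis using E_spec by (auto simp: spec_proj_def orth_projector_def sa_op_def)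
qed (simp add: E_def sa_op_def)

lemma E_idem: "E l (E l x) = E l x"
proof (cases "l > 0")
  case True
  then show ?thesis using E_spec by (auto simp: spec_proj_def orth_projector_def)
qed (simp add: E_def)

lemma E_commutant:
  assumes C: "bounded_linear C" "\<And>y. C (T y) = T (C y)"
  shows "C (E l x) = E l (C x)"
proof (cases "l > 0")
  case True
  have "\<forall>C. bounded_linear C \<longrightarrow> (\<forall>y. C (T y) = T (C y)) \<longrightarrow> (\<forall>x. C (E l x) = E l (C x))"
    using E_spec[OF True] unfolding spec_proj_def by (elim conjE)
  from this[rule_format, OF C] show ?thesis .
next
  case False
  interpret C: bounded_linear C by fact
  show ?thesis using False by (simp add: E_def C.zero)
qed

lemma E_T: "T (E l x) = E l (T x)"
  by (rule E_commutant[of T, OF sa_op_bl[OF sa_T]]) simp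

lemma E_range: "l > 0 \<Longrightarrow> E l x = x \<Longrightarrow> (norm x)\<^sup>2 \<le> l * (T x \<bullet> x)"
  and E_ker: "l > 0 \<Longrightarrow> E l x = 0 \<Longrightarrow> l * (T x \<bullet> x) \<le> (norm x)\<^sup>2"
  and E_ker_strict: "l > 0 \<Longrightarrow> E l x = 0 \<Longrightarrow> l * (T x \<bullet> x) = (norm x)\<^sup>2 \<Longrightarrow> x = 0"
  using E_spec unfolding spec_proj_def by blast+

lemma E_comm: "E l (E l' x) = E l' (E l x)"
  by (rule E_commutant[of "E l", OF sa_op_bl[OF sa_E]]) (simp add: E_T)

lemma E_zero: assumes "l < c" shows "E l x = 0"
proof (cases "l > 0")
  case True
  define y where "y = E l x"
  have "c * (norm y)\<^sup>2 \<le> c * (l * (T y \<bullet> y))"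
    using E_range[OF True, of y] c_pos by (intro mult_left_mono) (auto simp: y_def E_idem)
  also have "\<dots> \<le> l * (norm y)\<^sup>2" using mult_left_mono[OF T_quad_le[of y], of l] True by (simp add: mult_ac)
  finally have "(c - l) * (norm y)\<^sup>2 \<le> 0" by (simp add: left_diff_distrib)
  then show ?thesis using assms by (simp add: mult_le_0_iff y_def)
qed (simp add: E_def)

text \<open>
  A vector \<open>y\<close> fixed by \<open>E\<^sub>l\<close> and killed by \<open>E\<^sub>l\<^sub>'\<close> has \<open>l' \<langle>T y, y\<rangle> \<le> |y|\<^sup>2 \<le> l \<langle>T y, y\<rangle>\<close>,
  which for \<open>0 < l < l'\<close> is possible only if \<open>y = 0\<close>.
\<close>

lemma E_absorb: assumes "l \<le> l'" shows "E l' (E l x) = E l x"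
proof (cases "l > 0 \<and> l < l'")
  case True
  define y where "y = E l x - E l' (E l x)"
  have 1: "E l y = y"
    by (simp add: y_def sa_op_lin[OF sa_E] E_idem E_comm[of l l'])
  have 2: "E l' y = 0" by (simp add: y_def sa_op_lin[OF sa_E] E_idem)
  have "l' * (norm y)\<^sup>2 \<le> l' * (l * (T y \<bullet> y))"
    using E_range[OF _ 1] True by (intro mult_left_mono) auto
  also have "\<dots> \<le> l * (norm y)\<^sup>2"
    using mult_left_mono[OF E_ker[OF _ 2], of l] True by (simp add: mult_ac)
  finally have "(l' - l) * (norm y)\<^sup>2 \<le> 0" by (simp add: left_diff_distrib)
  then show ?thesis using True by (simp add: mult_le_0_iff y_def)
next
  case False
  then consider "l \<le> 0" | "l' = l" using assms by linarith
  then show ?thesis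
  proof cases
    case 1
    then show ?thesis by (simp add: E_def[of l] sa_op_lin[OF sa_E])
  qed (simp add: E_idem)
qed

lemma E_min: "E l (E l' x) = E (min l l') x"
proof (cases "l \<le> l'")
  case True
  then show ?thesis using E_comm[of l l' x] by (simp add: min_def E_absorb)
qed (simp add: min_def E_absorb)

lemma E_pyth: "l \<le> l' \<Longrightarrow> (norm (E l' x - E l x))\<^sup>2 = (norm (E l' x))\<^sup>2 - (norm (E l x))\<^sup>2"
  using sa_op_swap[OF sa_E, of l' x "E l x"] sa_op_swap[OF sa_E, of l x "E l x"]
  by (simp add: power2_norm_eq_inner inner_simps inner_commute E_idem E_absorb)

lemma E_norm_mono: "l \<le> l' \<Longrightarrow> norm (E l x) \<le> norm (E l' x)"
  by (rule power2_le_imp_le) (use E_pyth[of l l' x] zero_le_power2[of "norm (E l' x - E l x)"] in auto)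

lemma E_norm_le: "norm (E l x) \<le> norm x"
proof -
  have "(norm (x - E l x))\<^sup>2 = (norm x)\<^sup>2 - (norm (E l x))\<^sup>2"
    using sa_op_swap[OF sa_E, of l x "E l x"]
    by (simp add: power2_norm_eq_inner inner_simps inner_commute E_idem)
  then have "(norm (E l x))\<^sup>2 \<le> (norm x)\<^sup>2" using zero_le_power2[of "norm (x - E l x)"] by argo
  then show ?thesis by (rule power2_le_imp_le) simp
qed

text \<open>
  Let \<open>w\<close> be the jump at \<open>l > 0\<close>. It is killed by \<open>E\<^sub>l\<close> and fixed by \<open>E\<^sub>s\<close> for \<open>s > l\<close>, so
  \<open>|w|\<^sup>2 \<le> s \<langle>T w, w\<rangle>\<close> for these \<open>s\<close>; letting \<open>s\<close> tend to \<open>l\<close> gives equality in the bound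
  \<open>l \<langle>T w, w\<rangle> \<le> |w|\<^sup>2\<close>, and this forces \<open>w = 0\<close>.
\<close>

lemma E_right_continuous: "((\<lambda>s. E s x) \<longlongrightarrow> E l x) (at_right l)"
proof (cases "l > 0")
  case False
  then have "\<forall>\<^sub>F s in at_right l. s < c"
    using c_pos by (intro eventually_at_rightI[of l c]) auto
  then have "\<forall>\<^sub>F s in at_right l. E s x = E l x"
    by (rule eventually_mono) (use False c_pos in \<open>simp add: E_zero\<close>)
  then show ?thesis by (rule tendsto_eventually)
next
  case l: True
  define s where "s n = l + 1 / real (Suc n)" for n
  have sl: "l < s n" for n by (simp add: s_def)
  have smono: "s i \<le> s j" if "j \<le> i" for i j using that by (simp add: s_def frac_le)
  have slim: "s \<longlonglongrightarrow> l"
    unfolding s_def[abs_def] using tendsto_add[OF tendsto_const LIMSEQ_Suc[OF lim_1_over_n], of l] by simp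
  define h where "h n = (norm (E (s n) x))\<^sup>2" for n
  have "decseq h" unfolding h_def decseq_def using smono E_norm_mono by (auto intro!: power_mono)
  moreover have "0 \<le> h n" for n by (simp add: h_def)
  ultimately have "convergent h" using decseq_convergent[of h 0] convergent_def by metis
  then have Ch: "Cauchy h" by (rule convergent_Cauchy)
  have "Cauchy (\<lambda>n. E (s n) x)"
  proof (rule Cauchy_if_squared_dist_le[OF Ch])
    fix i j :: nat assume "j \<le> i"
    then show "(norm (E (s i) x - E (s j) x))\<^sup>2 \<le> \<bar>h i - h j\<bar>"
      using E_pyth[OF smono, of j i x] by (simp add: h_def norm_minus_commute)
  qed
  then obtain v where v: "(\<lambda>n. E (s n) x) \<longlonglongrightarrow> v" using Cauchy_convergent convergent_def by blast
  define w where "w = v - E l x"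
  have dw: "(\<lambda>n. E (s n) x - E l x) \<longlonglongrightarrow> w" unfolding w_def by (intro tendsto_intros v)
  have "E l (E (s n) x - E l x) = 0" for n
    using sl[of n] by (simp add: sa_op_lin[OF sa_E] E_idem E_min min_absorb1)
  then have lw: "E l w = 0" using LIMSEQ_unique[OF sa_op_tendsto[OF sa_E[of l] dw], of 0] by simp
  have sw: "E (s k) w = w" for k
  proof (rule LIMSEQ_unique)
    show "(\<lambda>n. E (s k) (E (s n) x - E l x)) \<longlonglongrightarrow> E (s k) w" by (rule sa_op_tendsto[OF sa_E dw])
    have "E (s k) (E (s n) x - E l x) = E (s n) x - E l x" if "k \<le> n" for n
      using smono[OF that] less_imp_le[OF sl[of k]] by (simp add: sa_op_lin[OF sa_E] E_absorb)
    then have "\<forall>\<^sub>F n in sequentially. E (s k) (E (s n) x - E l x) = E (s n) x - E l x"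
      unfolding eventually_sequentially by blast
    then show "(\<lambda>n. E (s k) (E (s n) x - E l x)) \<longlonglongrightarrow> w"
      using dw by (simp add: tendsto_cong)
  qed
  have "(norm w)\<^sup>2 \<le> l * (T w \<bullet> w)"
  proof (rule LIMSEQ_le_const[OF tendsto_mult[OF slim tendsto_const]])
    show "\<exists>N. \<forall>n\<ge>N. (norm w)\<^sup>2 \<le> s n * (T w \<bullet> w)"
      using E_range[OF less_trans[OF l sl] sw] by blast
  qed
  then have "w = 0" using E_ker_strict[OF l lw] E_ker[OF l lw] by linarith
  then have lim0: "(\<lambda>n. norm (E (s n) x - E l x)) \<longlonglongrightarrow> 0" using dw tendsto_norm_zero by blast
  show ?thesis
  proof (rule tendstoI)
    fix e :: real assume "e > 0"
    then obtain N where N: "norm (E (s N) x - E l x) < e"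
      using order_tendstoD(2)[OF lim0] by (auto simp: eventually_sequentially)
    have "dist (E r x) (E l x) < e" if r: "l < r" "r < s N" for r
    proof -
      have "(norm (E r x - E l x))\<^sup>2 \<le> (norm (E (s N) x - E l x))\<^sup>2"
        using E_pyth[of l r x] E_pyth[of l "s N" x] r power_mono[OF E_norm_mono[of r "s N" x], of 2] by simp
      then have "norm (E r x - E l x) \<le> norm (E (s N) x - E l x)" by (rule power2_le_imp_le) simp
      then show ?thesis using N by (simp add: dist_norm)
    qed
    then show "\<forall>\<^sub>F r in at_right l. dist (E r x) (E l x) < e"
      using sl[of N] by (intro eventually_at_rightI[of l "s N"]) auto
  qed
qed

text \<open>
  A vector \<open>w\<close> killed by all \<open>E\<^sub>s\<close> has \<open>\<langle>T w, w\<rangle> \<le> |w|\<^sup>2 / s\<close> for all \<open>s > 0\<close>, so \<open>T w = 0\<close>.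
\<close>

lemma E_at_top: "((\<lambda>s. E s x) \<longlongrightarrow> x) at_top"
proof -
  define h where "h n = (norm (E (real n) x))\<^sup>2" for n
  have "incseq h" unfolding h_def incseq_def using E_norm_mono by (auto intro!: power_mono)
  moreover have "h n \<le> (norm x)\<^sup>2" for n using E_norm_le by (simp add: h_def power_mono)
  ultimately have "convergent h" using incseq_convergent[of h] convergent_def by metis
  then have Ch: "Cauchy h" by (rule convergent_Cauchy)
  have "Cauchy (\<lambda>n. E (real n) x)"
  proof (rule Cauchy_if_squared_dist_le[OF Ch])
    fix i j :: nat assume "j \<le> i"
    then show "(norm (E (real i) x - E (real j) x))\<^sup>2 \<le> \<bar>h i - h j\<bar>"
      using E_pyth[of "real j" "real i" x] by (simp add: h_def)
  qed
  then obtain v where v: "(\<lambda>n. E (real n) x) \<longlonglongrightarrow> v" using Cauchy_convergent convergent_def by blast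
  define w where "w = x - v"
  have dw: "(\<lambda>n. x - E (real n) x) \<longlonglongrightarrow> w" unfolding w_def by (intro tendsto_intros v)
  have Ew: "E (real k) w = 0" for k
  proof (rule LIMSEQ_unique)
    show "(\<lambda>n. E (real k) (x - E (real n) x)) \<longlonglongrightarrow> E (real k) w" by (rule sa_op_tendsto[OF sa_E dw])
    have "\<forall>\<^sub>F n in sequentially. E (real k) (x - E (real n) x) = 0"
      unfolding eventually_sequentially
      by (intro exI[of _ k]) (auto simp: sa_op_lin[OF sa_E] E_min min_absorb1)
    then show "(\<lambda>n. E (real k) (x - E (real n) x)) \<longlonglongrightarrow> 0"
      by (rule tendsto_eventually)
  qed
  have "w = 0"
  proof (rule ccontr)
    assume "w \<noteq> 0"
    then have "T w \<noteq> 0" using T_inj by blast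
    then have pos: "T w \<bullet> w > 0" using T_coercive[of w] c_pos by (smt (verit) mult_pos_pos norm_eq_zero zero_less_power2)
    obtain k where k: "(norm w)\<^sup>2 / (T w \<bullet> w) < real k" using reals_Archimedean2 by blast
    then have "0 < real k" using pos by (smt (verit) divide_nonneg_pos zero_le_power2)
    then have "real k * (T w \<bullet> w) \<le> (norm w)\<^sup>2" using E_ker[OF _ Ew] by blast
    then show False using k pos by (simp add: pos_divide_less_eq)
  qed
  then have lim0: "(\<lambda>n. norm (x - E (real n) x)) \<longlonglongrightarrow> 0" using dw tendsto_norm_zero by blast
  show ?thesis
  proof (rule tendstoI)
    fix e :: real assume "e > 0"
    then obtain N where N: "norm (x - E (real N) x) < e"
      using order_tendstoD(2)[OF lim0] by (auto simp: eventually_sequentially)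
    have "dist (E r x) x < e" if r: "r \<ge> real N" for r
    proof -
      have eq: "(norm (x - E l x))\<^sup>2 = (norm x)\<^sup>2 - (norm (E l x))\<^sup>2" for l
        using sa_op_swap[OF sa_E, of l x "E l x"]
        by (simp add: power2_norm_eq_inner inner_simps inner_commute E_idem)
      have "(norm (x - E r x))\<^sup>2 \<le> (norm (x - E (real N) x))\<^sup>2"
        using eq[of r] eq[of "real N"] power_mono[OF E_norm_mono[OF r, of x], of 2] by simp
      then have "norm (x - E r x) \<le> norm (x - E (real N) x)" by (rule power2_le_imp_le) simp
      then show ?thesis using N by (simp add: dist_norm norm_minus_commute)
    qed
    then show "\<forall>\<^sub>F r in at_top. dist (E r x) x < e" unfolding eventually_at_top_linorder by blast
  qed
qed

lemma E_family: "spectral_family E"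
  unfolding spectral_family_def
proof (intro conjI allI)
  show "orth_projector (E l)" for l
    using sa_E[of l] E_idem by (simp add: orth_projector_def sa_op_def)
  show "((\<lambda>s. E s x) \<longlongrightarrow> 0) at_bot" for x
  proof (rule tendsto_eventually)
    show "\<forall>\<^sub>F s in at_bot. E s x = 0"
      unfolding eventually_at_bot_linorder using E_zero c_pos by (intro exI[of _ 0]) auto
  qed
qed (simp_all add: E_min E_right_continuous E_at_top)

sublocale fam: spectral_fam E
  by unfold_locales (rule E_family)

section \<open>The spectral theorem for coercive operators\<close>

text \<open>
  \<open>E\<^sub>b\<close> fixes \<open>y x\<close> and \<open>E\<^sub>a\<close> kills it, so the bounds on \<open>T\<close> that characterize the two
  projections both apply.
\<close>

lemma T_slice_estimate:
  assumes "0 < a" "a \<le> b"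
  defines "y x \<equiv> E b x - E a x"
  shows "T (E b x - E a x) \<bullet> x = T (y x) \<bullet> y x" "(E b x - E a x) \<bullet> x = (norm (y x))\<^sup>2"
    "(norm (y x))\<^sup>2 \<le> b * (T (y x) \<bullet> y x)" "a * (T (y x) \<bullet> y x) \<le> (norm (y x))\<^sup>2"
proof -
  have Eb: "E b (y x) = y x" and Ea: "E a (y x) = 0"
    using assms(2) by (simp_all add: y_def sa_op_lin[OF sa_E] E_idem E_absorb E_min min_absorb1)
  have swap: "w \<bullet> x = w \<bullet> y x" if "E b w = w" "E a w = 0" for w
    using sa_op_swap[OF sa_E, of b w x] sa_op_swap[OF sa_E, of a w x] that
    by (simp add: y_def inner_diff_right)
  show "T (E b x - E a x) \<bullet> x = T (y x) \<bullet> y x"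
    unfolding y_def[symmetric] by (rule swap) (simp_all add: E_T[symmetric] Eb Ea sa_op_lin[OF sa_T])
  show "(E b x - E a x) \<bullet> x = (norm (y x))\<^sup>2"
    unfolding y_def[symmetric] power2_norm_eq_inner by (rule swap[OF Eb Ea])
  show "(norm (y x))\<^sup>2 \<le> b * (T (y x) \<bullet> y x)" "a * (T (y x) \<bullet> y x) \<le> (norm (y x))\<^sup>2"
    using E_range[OF _ Eb] E_ker[OF assms(1) Ea] assms by auto
qed

text \<open>
  On a short slice around \<open>x\<close> the operator \<open>T\<close> is close to the constant \<open>1 / x\<close>, in the
  sense of quadratic forms, and such estimates add up over adjacent slices. So the step
  functions that approximate \<open>1 / l\<close> have operators that approximate \<open>T\<close>.
\<close>

lemma rep_T_slice:
  assumes a: "0 < a" and ab: "a \<le> b"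
  shows "fam.rep (\<lambda>l. indicator {a<..b} l / l) (\<lambda>x. T (E b x - E a x))"
proof -
  have approx: "\<exists>g B. fam.rep g B \<and> (\<forall>l. \<bar>g l - indicator {a<..b} l / l\<bar> \<le> e)
      \<and> (\<forall>x. norm (B x - T (E b x - E a x)) \<le> e * norm x)" if e: "e > 0" for e
  proof -
    define P where "P a b \<longleftrightarrow> (\<exists>g B. fam.rep g B \<and> (\<forall>l. \<bar>g l - indicator {a<..b} l / l\<bar> \<le> e)
      \<and> (\<forall>l. l \<notin> {a<..b} \<longrightarrow> g l = 0)
      \<and> (\<forall>x. \<bar>B x \<bullet> x - T (E b x - E a x) \<bullet> x\<bar> \<le> e * ((E b x - E a x) \<bullet> x)))" for a b
    have "P a b"
    proof (rule Bolzano[OF ab])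
      fix a b c assume "P a b" "P b c" and abc: "a \<le> b" "b \<le> c"
      then obtain g B h C where g: "fam.rep g B" "\<forall>l. \<bar>g l - indicator {a<..b} l / l\<bar> \<le> e" "\<forall>l. l \<notin> {a<..b} \<longrightarrow> g l = 0"
         "\<forall>x. \<bar>B x \<bullet> x - T (E b x - E a x) \<bullet> x\<bar> \<le> e * ((E b x - E a x) \<bullet> x)"
        and h: "fam.rep h C" "\<forall>l. \<bar>h l - indicator {b<..c} l / l\<bar> \<le> e" "\<forall>l. l \<notin> {b<..c} \<longrightarrow> h l = 0"
         "\<forall>x. \<bar>C x \<bullet> x - T (E c x - E b x) \<bullet> x\<bar> \<le> e * ((E c x - E b x) \<bullet> x)"
        unfolding P_def by blast
      have "\<bar>g l + h l - indicator {a<..c} l / l\<bar> \<le> e" for l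
      proof (cases "l \<le> b")
        case True
        then have "h l = 0" "(indicator {a<..c} l :: real) = indicator {a<..b} l"
          using h(3) abc by (auto simp: indicator_def)
        then show ?thesis using g(2) by simp
      next
        case False
        then have "g l = 0" "(indicator {a<..c} l :: real) = indicator {b<..c} l"
          using g(3) abc by (auto simp: indicator_def)
        then show ?thesis using h(2) by simp
      qed
      moreover have "g l + h l = 0" if "l \<notin> {a<..c}" for l using g(3) h(3) abc that by auto
      moreover have "\<bar>(B x + C x) \<bullet> x - T (E c x - E a x) \<bullet> x\<bar> \<le> e * ((E c x - E a x) \<bullet> x)" for x
        using g(4)[rule_format, of x] h(4)[rule_format, of x]
        by (simp add: sa_op_lin[OF sa_T] inner_simps algebra_simps)
      ultimately show "P a c" unfolding P_def using fam.rep_add[OF g(1) h(1)] by blast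
    next
      fix x assume x: "a \<le> x" "x \<le> b"
      have "isCont (\<lambda>l::real. 1 / l) x" using x a by (intro continuous_intros) auto
      then obtain d where d: "d > 0" "\<And>y. \<bar>y - x\<bar> < d \<Longrightarrow> \<bar>1 / y - 1 / x\<bar> < e"
        using e unfolding continuous_at_eps_delta by (auto simp: dist_real_def)
      \<comment> \<open>the bound \<open>a / 2\<close> on the length keeps \<open>p\<close> positive even if \<open>p < a\<close>\<close>
      have "P p q" if pq: "p \<le> x \<and> x \<le> q \<and> q - p < min d (a / 2)" for p q
      proof -
        have p0: "0 < p" using pq x a by linarith
        have "fam.rep (\<lambda>l. 1 / x * indicator {p<..q} l) (\<lambda>y. (1 / x) *\<^sub>R (E q y - E p y))"
          by (rule fam.rep_scale[OF fam.rep_Ioc]) (use pq in linarith)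
        moreover have "\<bar>1 / x * indicator {p<..q} l - indicator {p<..q} l / l\<bar> \<le> e" for l
          using d(2)[of l] pq e by (auto simp: indicator_def abs_minus_commute intro: less_imp_le)
        moreover have "\<bar>((1 / x) *\<^sub>R (E q z - E p z)) \<bullet> z - T (E q z - E p z) \<bullet> z\<bar> \<le> e * ((E q z - E p z) \<bullet> z)" for z
        proof -
          \<comment> \<open>\<open>T\<close> lies between \<open>1 / q\<close> and \<open>1 / p\<close> on the slice, and both are within \<open>e\<close> of \<open>1 / x\<close>\<close>
          define n where "n = (norm (E q z - E p z))\<^sup>2"
          define t where "t = T (E q z - E p z) \<bullet> (E q z - E p z)"
          have pq': "p \<le> q" using pq by simp
          have n0: "0 \<le> n" by (simp add: n_def)
          have nt: "n \<le> q * t" "p * t \<le> n"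
            using T_slice_estimate(3,4)[OF p0 pq', of z] by (simp_all add: n_def t_def)
          have "\<bar>1 / q - 1 / x\<bar> < e" "\<bar>1 / p - 1 / x\<bar> < e" using d(2)[of q] d(2)[of p] pq by auto
          then have lh: "1 / x - e \<le> 1 / q" "1 / p \<le> 1 / x + e" by linarith+
          have "(1 / x - e) * n \<le> (1 / q) * n" "(1 / p) * n \<le> (1 / x + e) * n"
            using lh n0 by (intro mult_right_mono; simp)+
          moreover have "(1 / q) * n \<le> t" "t \<le> (1 / p) * n"
            using nt p0 pq' by (simp_all add: field_simps)
          ultimately have "\<bar>(1 / x) * n - t\<bar> \<le> e * n" by (simp add: algebra_simps abs_le_iff)
          then show ?thesis
            using T_slice_estimate(1,2)[OF p0 pq', of z] by (simp add: n_def t_def)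
        qed
        moreover have "1 / x * indicator {p<..q} l = 0" if "l \<notin> {p<..q}" for l using that by simp
        ultimately show ?thesis unfolding P_def by blast
      qed
      then show "\<exists>d>0. \<forall>a b. a \<le> x \<and> x \<le> b \<and> b - a < d \<longrightarrow> P a b"
        using d(1) a by (intro exI[of _ "min d (a / 2)"]) simp
    qed
    then obtain g B where g: "fam.rep g B" "\<forall>l. \<bar>g l - indicator {a<..b} l / l\<bar> \<le> e"
      "\<forall>x. \<bar>B x \<bullet> x - T (E b x - E a x) \<bullet> x\<bar> \<le> e * ((E b x - E a x) \<bullet> x)"
      unfolding P_def by blast
    have Q: "sa_op (\<lambda>x. E b x - E a x)" by (rule fam.rep_sa[OF fam.rep_Ioc[OF ab]])
    have TQ: "sa_op (\<lambda>x. T (E b x - E a x))"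
      using sa_op_comp[OF sa_T Q] by (simp add: sa_op_lin[OF sa_T] E_T)
    have "sa_op (\<lambda>x. 1 *\<^sub>R B x + (-1) *\<^sub>R T (E b x - E a x))"
      by (rule sa_op_comb[OF fam.rep_sa[OF g(1)] TQ])
    then have sa: "sa_op (\<lambda>x. B x - T (E b x - E a x))" by simp
    have "norm (B x - T (E b x - E a x)) \<le> e * norm x" for x
    proof (rule sa_op_norm_le[OF sa])
      fix x
      have "(E b x - E a x) \<bullet> x = (norm (E b x))\<^sup>2 - (norm (E a x))\<^sup>2"
        using fam.E_inner by (simp add: inner_diff_left)
      also have "\<dots> \<le> (norm x)\<^sup>2"
        using power_mono[OF E_norm_le[of b x] norm_ge_zero, of 2] zero_le_power2[of "norm (E a x)"] by argo
      finally have "e * ((E b x - E a x) \<bullet> x) \<le> e * (norm x)\<^sup>2" using e by simp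
      then show "\<bar>(B x - T (E b x - E a x)) \<bullet> x\<bar> \<le> e * (norm x)\<^sup>2"
        using g(3)[rule_format, of x] by (simp add: inner_diff_left)
    qed
    then show ?thesis using g by blast
  qed
  have "\<forall>n. \<exists>g B. fam.rep g B \<and> (\<forall>l. \<bar>g l - indicator {a<..b} l / l\<bar> \<le> 1 / real (Suc n))
      \<and> (\<forall>x. norm (B x - T (E b x - E a x)) \<le> 1 / real (Suc n) * norm x)"
    by (intro allI approx) simp
  then obtain g B where gB: "\<And>n. fam.rep (g n) (B n)"
    "\<And>n l. \<bar>g n l - indicator {a<..b} l / l\<bar> \<le> 1 / real (Suc n)"
    "\<And>n x. norm (B n x - T (E b x - E a x)) \<le> 1 / real (Suc n) * norm x" by metis
  have z: "(\<lambda>n. 1 / real (Suc n)) \<longlonglongrightarrow> 0" by (rule LIMSEQ_Suc[OF lim_1_over_n])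
  show ?thesis
  proof (rule fam.rep_lim[OF gB(1)])
    show "uniform_limit UNIV g (\<lambda>l. indicator {a<..b} l / l) sequentially"
    proof (rule uniform_limitI)
      fix e :: real assume "e > 0"
      then have "\<forall>\<^sub>F n in sequentially. 1 / real (Suc n) < e" using order_tendstoD(2)[OF z] by simp
      then show "\<forall>\<^sub>F n in sequentially. \<forall>l\<in>UNIV. dist (g n l) (indicator {a<..b} l / l) < e"
        by (rule eventually_mono) (use gB(2) in \<open>auto simp: dist_real_def intro: le_less_trans\<close>)
    qed
    fix x :: 'a
    have "(\<lambda>n. 1 / real (Suc n) * norm x) \<longlonglongrightarrow> 0" using tendsto_mult[OF z tendsto_const, of "norm x"] by simp
    then have "(\<lambda>n. B n x - T (E b x - E a x)) \<longlonglongrightarrow> 0"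
      by (rule Lim_null_comparison[rotated]) (use gB(3) in simp)
    then show "(\<lambda>n. B n x) \<longlonglongrightarrow> T (E b x - E a x)" by (rule LIM_zero_cancel)
  qed
qed

text \<open>
  On \<open>(0, n]\<close> the functions \<open>l\<close> and \<open>1 / l\<close> are inverse to each other, and the spectral
  family carries nothing below \<open>c\<close>.
\<close>

lemma cutop_id_T:
  assumes n: "n > 0"
  shows "T (fam.cutop (\<lambda>l. l) n x) = E (real n) x" "fam.cutop (\<lambda>l. l) n (T x) = E (real n) x"
proof -
  let ?I = "\<lambda>l::real. l"
  \<comment> \<open>any positive \<open>a < c\<close> with \<open>a \<le> n\<close> will do, since \<open>E a = 0\<close>\<close>
  define a where "a = min c 1 / 2"
  have a: "0 < a" "a < c" "a \<le> real n" using c_pos n by (auto simp: a_def)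
  have E0: "E a x = 0" "E (- real n) x = 0" for x using a c_pos E_zero by auto
  have TE: "(\<lambda>x. T (E (real n) x - E a x)) = (\<lambda>x. T (E (real n) x))" by (simp add: E0)
  have r1: "fam.rep (fam.trunc ?I n) (fam.cutop ?I n)" by (rule fam.rep_cutop) simp
  have r2: "fam.rep (\<lambda>l. indicator {a<..real n} l / l) (\<lambda>x. T (E (real n) x))"
    using rep_T_slice[OF a(1,3)] unfolding TE .
  have "(\<lambda>l. indicator {a<..real n} l / l * fam.trunc ?I n l) = (indicator {a<..real n} :: real \<Rightarrow> real)"
    using a by (auto simp: fam.trunc_def indicator_def fun_eq_iff)
  moreover have r3: "fam.rep (indicator {a<..real n}) (E (real n))"
    using fam.rep_Ioc[OF a(3)] by (simp add: E0)
  ultimately have "(\<lambda>x. T (E (real n) (fam.cutop ?I n x))) = E (real n)"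
    using fam.rep_unique fam.rep_mult[OF r2 r1] by simp
  then have 1: "T (E (real n) (fam.cutop ?I n x)) = E (real n) x" for x by (rule fun_cong)
  have "(\<lambda>l. indicator {..real n} l * fam.trunc ?I n l) = fam.trunc ?I n"
    by (auto simp: fam.trunc_def indicator_def fun_eq_iff)
  then have "(\<lambda>x. E (real n) (fam.cutop ?I n x)) = fam.cutop ?I n"
    using fam.rep_unique fam.rep_mult[OF fam.rep_proj[of "real n"] r1] r1 by simp
  then have 2: "E (real n) (fam.cutop ?I n x) = fam.cutop ?I n x" for x by (rule fun_cong)
  show "T (fam.cutop ?I n x) = E (real n) x" using 1 2 by simp
  have "T (fam.cutop ?I n (T x)) = T (E (real n) x)" using 1[of "T x"] 2 by (simp add: E_T)
  then show "fam.cutop ?I n (T x) = E (real n) x"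
    using T_inj[of "fam.cutop ?I n (T x) - E (real n) x"] by (simp add: sa_op_lin[OF sa_T])
qed

text \<open>
  For \<open>y = T x\<close> the truncations of \<open>\<integral> l dE\<close> at \<open>y\<close> are \<open>E\<^sub>n x\<close>, which converge to
  \<open>x = A y\<close>. Conversely, if the truncations at \<open>y\<close> converge to \<open>z\<close>, then \<open>T z\<close> is the
  limit of \<open>E\<^sub>n y\<close>, so \<open>y = T z\<close>.
\<close>

lemma E_resolution: "is_spectral_resolution D A E"
proof -
  let ?I = "\<lambda>l::real. l"
  have c: "continuous_on UNIV ?I" by simp
  have En: "(\<lambda>n. E (real n) x) \<longlonglongrightarrow> x" for x
    by (rule filterlim_compose[OF E_at_top filterlim_real_sequentially])
  have fwd: "y \<in> spectral_integral_dom E ?I \<and> A y = spectral_integral E ?I y" if y: "y \<in> D" for y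
  proof -
    have eq: "fam.cutop ?I n y = E (real n) (A y)" if "n > 0" for n
      using cutop_id_T(2)[OF that, of "A y"] by (simp add: T_A y)
    have "norm (fam.cutop ?I n y) \<le> max (norm (fam.cutop ?I 0 y)) (norm (A y))" for n
      by (cases "n = 0") (use eq[of n] E_norm_le[of "real n" "A y"] in auto)
    then have dom: "y \<in> spectral_integral_dom E ?I" unfolding fam.sdom_iff_bounded[OF c] by blast
    have "\<forall>\<^sub>F n in sequentially. E (real n) (A y) = fam.cutop ?I n y"
      by (rule eventually_mono[OF eventually_gt_at_top[of 0]]) (simp add: eq)
    then have "(\<lambda>n. fam.cutop ?I n y) \<longlonglongrightarrow> A y" by (rule Lim_transform_eventually[OF En])
    then show ?thesis using dom LIMSEQ_unique[OF fam.cutop_tendsto[OF c dom]] by simp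
  qed
  have bwd: "y \<in> D" if y: "y \<in> spectral_integral_dom E ?I" for y
  proof -
    have lim: "(\<lambda>n. T (fam.cutop ?I n y)) \<longlonglongrightarrow> T (spectral_integral E ?I y)"
      by (rule sa_op_tendsto[OF sa_T fam.cutop_tendsto[OF c y]])
    have "\<forall>\<^sub>F n in sequentially. T (fam.cutop ?I n y) = E (real n) y"
      by (rule eventually_mono[OF eventually_gt_at_top[of 0]]) (rule cutop_id_T(1))
    then have "(\<lambda>n. E (real n) y) \<longlonglongrightarrow> T (spectral_integral E ?I y)" by (rule Lim_transform_eventually[OF lim])
    then have "y = T (spectral_integral E ?I y)" using LIMSEQ_unique[OF En[of y]] by blast
    then show ?thesis using T_D by metis
  qed
  show ?thesis unfolding is_spectral_resolution_def using E_family fwd bwd by blast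
qed

text \<open>
  From here on only this property of the chosen resolution is used, not the construction
  of \<open>E\<close>.
\<close>

lemma resolution: "is_spectral_resolution D A (spectral_resolution D A)"
  unfolding spectral_resolution_def by (rule someI[where P = "is_spectral_resolution D A", OF E_resolution])

section \<open>Fractional powers and the semigroup\<close>

abbreviation R where "R \<equiv> spectral_resolution D A"

lemma R_family: "spectral_family R"
  and D_eq: "D = spectral_integral_dom R (\<lambda>l. l)"
  and A_eq: "x \<in> D \<Longrightarrow> A x = spectral_integral R (\<lambda>l. l) x"
  using resolution unfolding is_spectral_resolution_def by blast+

end

sublocale coercive_operator \<subseteq> res: spectral_fam "spectral_resolution D A"
  by unfold_locales (rule R_family)

context coercive_operator
begin

lemma D_iff: "x \<in> D \<longleftrightarrow> x \<in> res.sdom (\<lambda>l. l)"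
  using D_eq by blast

lemma cont_id: "res.cont (\<lambda>l. l)"
  by simp

text \<open>
  On the range of \<open>R\<^sub>l - R\<^sub>k\<close> with \<open>k < l < c\<close> the quadratic form of \<open>A\<close> would be at most
  \<open>l |y|\<^sup>2\<close>, against coercivity. So \<open>R\<close> is constant below \<open>c\<close>, and its limit there is 0.
\<close>

lemma R_below:
  assumes l: "l < c"
  shows "R l x = 0"
proof -
  have eq: "R l x = R k x" if k: "k < l" for k
  proof -
    define y where "y = R l x - R k x"
    have Rl: "R l y = y" and Rk: "R k y = 0"
      using k by (simp_all add: y_def sa_op_lin[OF res.sa_E] res.E_min min_absorb1)
    obtain n where n: "\<bar>l\<bar> < real n" "\<bar>k\<bar> < real n"
      using reals_Archimedean2[of "max \<bar>l\<bar> \<bar>k\<bar>"] by auto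
    have "R (real n) (R l y) = R l y" using n by (simp add: res.E_min min_absorb2)
    moreover have "R (- real n) y = 0" using n by (simp add: y_def sa_op_lin[OF res.sa_E] res.E_min min_absorb1)
    ultimately have "R (real n) y - R (- real n) y = y" by (simp add: Rl)
    then have dom: "y \<in> res.sdom (\<lambda>l. l)" using res.E_diff_in_sdom[OF cont_id, of n y] by simp
    interpret finite_measure "res.\<mu> y" by (rule res.finite_mu)
    have "space (res.\<mu> y) - {..l} = {l<..}" by auto
    then have "measure (res.\<mu> y) {l<..} = measure (res.\<mu> y) UNIV - measure (res.\<mu> y) {..l}"
      using finite_measure_compl[of "{..l}"] by simp
    also have "\<dots> = 0" by (simp add: res.measure_UNIV res.measure_Iic Rl power2_norm_eq_inner)
    finally have "emeasure (res.\<mu> y) {l<..} = 0" by (simp add: emeasure_eq_measure)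
    moreover have "{s \<in> space (res.\<mu> y). \<not> s \<le> l} \<subseteq> {l<..}" by (simp add: subset_eq not_le)
    moreover have "{l<..} \<in> sets (res.\<mu> y)" by simp
    ultimately have ae: "AE s in res.\<mu> y. s \<le> l" by (intro AE_I[of _ _ "{l<..}"])
    have "c * (norm y)\<^sup>2 \<le> A y \<bullet> y" using coercive[of y] dom D_iff by blast
    also have "\<dots> = (\<integral>s. s \<partial>res.\<mu> y)"
      using dom A_eq[of y] res.sint_quad[OF cont_id dom] by (simp add: D_iff)
    also have "\<dots> \<le> (\<integral>s. l \<partial>res.\<mu> y)"
      by (rule integral_mono_AE[OF res.sdom_integrable[OF cont_id dom]]) (use ae in auto)
    also have "\<dots> = l * (norm y)\<^sup>2" by (simp add: res.measure_UNIV)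
    finally have "(c - l) * (norm y)\<^sup>2 \<le> 0" by (simp add: left_diff_distrib)
    then show ?thesis using l by (simp add: mult_le_0_iff y_def)
  qed
  have "\<forall>\<^sub>F k in at_bot. R k x = R l x"
    unfolding eventually_at_bot_dense using eq[symmetric] by blast
  then have "((\<lambda>k::real. R l x) \<longlongrightarrow> 0) at_bot"
    by (rule Lim_transform_eventually[OF res.E_bot[of x]])
  from tendsto_unique[OF trivial_limit_at_bot_linorder this tendsto_const] show ?thesis by simp
qed

lemma spectrum_ge: "AE l in res.\<mu> x. c \<le> l"
proof -
  interpret finite_measure "res.\<mu> x" by (rule res.finite_mu)
  have "AE l in res.\<mu> x. c - 1 / real (Suc n) < l" for n
  proof (rule AE_I)
    show "{l \<in> space (res.\<mu> x). \<not> c - 1 / real (Suc n) < l} \<subseteq> {..c - 1 / real (Suc n)}" by auto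
    show "emeasure (res.\<mu> x) {..c - 1 / real (Suc n)} = 0"
      by (simp add: emeasure_eq_measure res.measure_Iic R_below)
  qed simp
  then have "AE l in res.\<mu> x. \<forall>n. c - 1 / real (Suc n) < l" by (simp add: AE_all_countable)
  then show ?thesis
  proof eventually_elim
    case (elim l)
    have "(\<lambda>n. c - 1 / real (Suc n)) \<longlonglongrightarrow> c - 0"
      by (rule tendsto_diff[OF tendsto_const LIMSEQ_Suc[OF lim_1_over_n]])
    then show ?case
      using LIMSEQ_le_const2[of "\<lambda>n. c - 1 / real (Suc n)" "c - 0" l] elim by (auto intro: less_imp_le)
  qed
qed

lemma sdom_mono:
  assumes f: "res.cont f" and g: "res.cont g" and le: "\<And>l. l \<ge> c \<Longrightarrow> \<bar>f l\<bar> \<le> K * \<bar>g l\<bar>"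
    and x: "x \<in> res.sdom g"
  shows "x \<in> res.sdom f"
proof -
  have "integrable (res.\<mu> x) (\<lambda>l. (f l)\<^sup>2)"
  proof (rule Bochner_Integration.integrable_bound[where f = "\<lambda>l. K\<^sup>2 * (g l)\<^sup>2"])
    show "integrable (res.\<mu> x) (\<lambda>l. K\<^sup>2 * (g l)\<^sup>2)" using x by (simp add: spectral_integral_dom_def)
    show "(\<lambda>l. (f l)\<^sup>2) \<in> borel_measurable (res.\<mu> x)"
      using res.cont_measurable[OF res.cont_sq[OF f]] by (simp add: measurable_cong_sets[OF res.sets_mu refl])
    show "AE l in res.\<mu> x. norm ((f l)\<^sup>2) \<le> norm (K\<^sup>2 * (g l)\<^sup>2)"
      using spectrum_ge
    proof eventually_elim
      case (elim l)
      have "\<bar>f l\<bar>\<^sup>2 \<le> (K * \<bar>g l\<bar>)\<^sup>2" by (rule power_mono[OF le[OF elim]]) simp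
      then show ?case by (simp add: power_mult_distrib)
    qed
  qed
  then show ?thesis by (simp add: spectral_integral_dom_def)
qed

lemma sint_norm_le:
  assumes f: "res.cont f" and g: "res.cont g" and le: "\<And>l. l \<ge> c \<Longrightarrow> \<bar>f l\<bar> \<le> K * \<bar>g l\<bar>"
    and K: "K \<ge> 0" and x: "x \<in> res.sdom g"
  shows "norm (res.sint f x) \<le> K * norm (res.sint g x)"
proof -
  have xf: "x \<in> res.sdom f" by (rule sdom_mono[OF f g le x])
  have "(\<integral>l. (f l)\<^sup>2 \<partial>res.\<mu> x) \<le> (\<integral>l. K\<^sup>2 * (g l)\<^sup>2 \<partial>res.\<mu> x)"
  proof (rule integral_mono_AE)
    show "AE l in res.\<mu> x. (f l)\<^sup>2 \<le> K\<^sup>2 * (g l)\<^sup>2"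
      using spectrum_ge
    proof eventually_elim
      case (elim l)
      have "\<bar>f l\<bar>\<^sup>2 \<le> (K * \<bar>g l\<bar>)\<^sup>2" by (rule power_mono[OF le[OF elim]]) simp
      then show ?case by (simp add: power_mult_distrib)
    qed
  qed (use x xf in \<open>simp_all add: spectral_integral_dom_def\<close>)
  then have "(norm (res.sint f x))\<^sup>2 \<le> (K * norm (res.sint g x))\<^sup>2"
    by (simp add: res.sint_norm_sq[OF f xf] res.sint_norm_sq[OF g x] power_mult_distrib)
  then show ?thesis by (rule power2_le_imp_le) (use K in simp)
qed

lemma sint_cong:
  assumes f: "res.cont f" and g: "res.cont g" and eq: "\<And>l. l \<ge> c \<Longrightarrow> f l = g l"
  shows "x \<in> res.sdom f \<longleftrightarrow> x \<in> res.sdom g" and "x \<in> res.sdom f \<Longrightarrow> res.sint f x = res.sint g x"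
proof -
  show iff: "x \<in> res.sdom f \<longleftrightarrow> x \<in> res.sdom g"
    using sdom_mono[OF f g, of 1 x] sdom_mono[OF g f, of 1 x] eq by auto
  assume x: "x \<in> res.sdom f"
  have h: "res.cont (\<lambda>l. 1 * f l + (-1) * g l)" using f g by (intro continuous_intros)
  have "norm (res.sint (\<lambda>l. 1 * f l + (-1) * g l) x) \<le> 0 * norm (res.sint f x)"
    by (rule sint_norm_le[OF h f _ _ x]) (simp_all add: eq)
  then show "res.sint f x = res.sint g x"
    using res.sdom_fun_lin(2)[OF f g x, of 1 "-1"] x iff by simp
qed

text \<open>
  The spectral integral is an isometry from \<open>L\<^sup>2\<close> of the spectral measure of \<open>x\<close>, so this
  is dominated convergence; the bound and the pointwise limit matter only on the half-line
  that carries the spectrum.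
\<close>

lemma sint_dominated_limit:
  assumes f: "\<And>n. res.cont (f n)" and g: "res.cont g" and h: "res.cont h"
    and le: "\<And>n l. l \<ge> c \<Longrightarrow> \<bar>f n l\<bar> \<le> \<bar>h l\<bar>" and lim: "\<And>l. l \<ge> c \<Longrightarrow> (\<lambda>n. f n l) \<longlonglongrightarrow> g l"
    and x: "x \<in> res.sdom h"
  shows "(\<lambda>n. res.sint (f n) x) \<longlonglongrightarrow> res.sint g x"
proof -
  have gle: "\<bar>g l\<bar> \<le> \<bar>h l\<bar>" if "l \<ge> c" for l
    using LIMSEQ_le_const2[OF tendsto_rabs[OF lim[OF that]], of "\<bar>h l\<bar>"] le[OF that] by blast
  have xf: "x \<in> res.sdom (f n)" for n by (rule sdom_mono[OF f h _ x, of _ 1]) (use le in simp)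
  have xg: "x \<in> res.sdom g" by (rule sdom_mono[OF g h _ x, of 1]) (use gle in simp)
  have d: "res.cont (\<lambda>l. 1 * f n l + (-1) * g l)" for n using f g by (intro continuous_intros)
  have sq: "(norm (res.sint (f n) x - res.sint g x))\<^sup>2 = (\<integral>l. (1 * f n l + (-1) * g l)\<^sup>2 \<partial>res.\<mu> x)" for n
    using res.sint_norm_sq[OF d[of n] res.sdom_fun_lin(1)[OF f g xf xg]]
      res.sdom_fun_lin(2)[OF f[of n] g xf xg, of 1 "-1"] by simp
  have "(\<lambda>n. \<integral>l. (1 * f n l + (-1) * g l)\<^sup>2 \<partial>res.\<mu> x) \<longlonglongrightarrow> (\<integral>l. 0 \<partial>res.\<mu> x)"
  proof (rule integral_dominated_convergence[where w = "\<lambda>l. 4 * (h l)\<^sup>2"])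
    show "integrable (res.\<mu> x) (\<lambda>l. 4 * (h l)\<^sup>2)" using x by (simp add: spectral_integral_dom_def)
    show "(\<lambda>l. (1 * f n l + (-1) * g l)\<^sup>2) \<in> borel_measurable (res.\<mu> x)" for n
      using res.cont_measurable[OF res.cont_sq[OF d]] by (simp add: measurable_cong_sets[OF res.sets_mu refl])
    show "AE l in res.\<mu> x. (\<lambda>n. (1 * f n l + (-1) * g l)\<^sup>2) \<longlonglongrightarrow> 0"
      using spectrum_ge
    proof eventually_elim
      case (elim l)
      have "(\<lambda>n. (f n l - g l)\<^sup>2) \<longlonglongrightarrow> (g l - g l)\<^sup>2" by (intro tendsto_intros lim elim)
      then show ?case by simp
    qed
    show "AE l in res.\<mu> x. norm ((1 * f n l + (-1) * g l)\<^sup>2) \<le> 4 * (h l)\<^sup>2" for n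
      using spectrum_ge
    proof eventually_elim
      case (elim l)
      have "\<bar>f n l - g l\<bar>\<^sup>2 \<le> (2 * \<bar>h l\<bar>)\<^sup>2"
        by (rule power_mono) (use le[OF elim, of n] gle[OF elim] in auto)
      then show ?case by (simp add: power_mult_distrib)
    qed
  qed simp
  then have "(\<lambda>n. (norm (res.sint (f n) x - res.sint g x))\<^sup>2) \<longlonglongrightarrow> 0"
    unfolding sq by simp
  then have "(\<lambda>n. sqrt ((norm (res.sint (f n) x - res.sint g x))\<^sup>2)) \<longlonglongrightarrow> sqrt 0" by (rule tendsto_real_sqrt)
  then have "(\<lambda>n. norm (res.sint (f n) x - res.sint g x)) \<longlonglongrightarrow> 0" by simp
  then show ?thesis by (rule LIM_zero_cancel[OF tendsto_norm_zero_cancel])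
qed

text \<open>
  The function \<open>l \<mapsto> l\<^sup>\<alpha> exp(-s l)\<close> on the spectrum. Replacing \<open>l\<close> by \<open>max 0 l\<close> in the
  exponential keeps the function continuous and, for \<open>s > 0\<close>, bounded on the whole line.
\<close>

definition fpow :: "real \<Rightarrow> real \<Rightarrow> real \<Rightarrow> real" where
  "fpow \<alpha> s l = spectral_pow \<alpha> l * exp (- s * max 0 l)"

text \<open>
  The operator \<open>A\<^sup>\<alpha> exp(-s A)\<close>.
\<close>

definition W :: "real \<Rightarrow> real \<Rightarrow> 'a \<Rightarrow> 'a" where
  "W \<alpha> s = res.sint (fpow \<alpha> s)"

lemma cont_spectral_pow: "\<alpha> \<ge> 0 \<Longrightarrow> res.cont (spectral_pow \<alpha>)"
  unfolding spectral_pow_def[abs_def]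
  by (cases "\<alpha> = 0") (auto intro!: continuous_on_powr'[of UNIV] continuous_on_max continuous_on_const continuous_on_id)

lemma cont_fpow: "\<alpha> \<ge> 0 \<Longrightarrow> res.cont (fpow \<alpha> s)"
  unfolding fpow_def[abs_def] by (intro continuous_intros cont_spectral_pow)

lemma fpow_0: "fpow \<alpha> 0 = spectral_pow \<alpha>"
  by (auto simp: fpow_def)

lemma fpow_pos: "l \<ge> c \<Longrightarrow> fpow \<alpha> s l = l powr \<alpha> * exp (- s * l)"
  using c_pos by (auto simp: fpow_def spectral_pow_def)

lemma power_dom_eq: "power_dom D A \<alpha> = res.sdom (fpow \<alpha> 0)"
  by (simp add: power_dom_def fpow_0)

lemma power_op_eq: "power_op D A \<alpha> = W \<alpha> 0"
  by (simp add: power_op_def W_def fpow_0)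

lemma W_dom_nonneg:
  assumes "\<alpha> \<ge> 0" "s \<ge> 0" "x \<in> power_dom D A \<alpha>"
  shows "x \<in> res.sdom (fpow \<alpha> s)"
proof (rule sdom_mono[OF cont_fpow[OF assms(1)] cont_fpow[OF assms(1), of 0], where K = 1])
  show "\<bar>fpow \<alpha> s l\<bar> \<le> 1 * \<bar>fpow \<alpha> 0 l\<bar>" if "l \<ge> c" for l
    using that c_pos assms(2) by (simp add: fpow_pos abs_mult mult_left_le)
qed (use assms in \<open>simp_all add: power_dom_eq\<close>)

lemma one_dom: "x \<in> res.sdom (\<lambda>_. 1)"
proof -
  interpret finite_measure "res.\<mu> x" by (rule res.finite_mu)
  show ?thesis by (simp add: spectral_integral_dom_def)
qed

lemma powr_le_exp:
  fixes \<alpha> s :: real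
  assumes "\<alpha> \<ge> 0" "s > 0"
  shows "\<exists>K\<ge>0. \<forall>l>0. l powr \<alpha> * exp (- s * l) \<le> K"
proof (cases "\<alpha> = 0")
  case True
  then show ?thesis using assms by (intro exI[of _ 1]) auto
next
  case False
  then have a: "\<alpha> > 0" using assms by simp
  have "l powr \<alpha> * exp (- s * l) \<le> (\<alpha> / s) powr \<alpha>" if l: "l > 0" for l
  proof -
    \<comment> \<open>\<open>y \<le> exp y\<close> at \<open>y = s l / \<alpha>\<close>, raised to the power \<open>\<alpha>\<close>\<close>
    have "s * l / \<alpha> \<le> exp (s * l / \<alpha>)" using exp_ge_add_one_self[of "s * l / \<alpha>"] by linarith
    then have "l \<le> (\<alpha> / s) * exp (s * l / \<alpha>)" using a assms(2) by (simp add: field_simps)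
    then have "l powr \<alpha> \<le> ((\<alpha> / s) * exp (s * l / \<alpha>)) powr \<alpha>" using l a by (intro powr_mono2) auto
    also have "\<dots> = (\<alpha> / s) powr \<alpha> * (exp (s * l / \<alpha>) powr \<alpha>)"
      by (rule powr_mult)
    also have "exp (s * l / \<alpha>) powr \<alpha> = exp (s * l)" using a by (simp add: powr_def)
    finally have "l powr \<alpha> * exp (- s * l) \<le> (\<alpha> / s) powr \<alpha> * exp (s * l) * exp (- s * l)"
      by (rule mult_right_mono) simp
    also have "\<dots> = (\<alpha> / s) powr \<alpha>" by (simp add: mult.assoc flip: exp_add)
    finally show ?thesis .
  qed
  then show ?thesis by (intro exI[of _ "(\<alpha> / s) powr \<alpha>"]) auto
qed

lemma W_dom_pos:
  assumes "\<alpha> \<ge> 0" "s > 0"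
  shows "x \<in> res.sdom (fpow \<alpha> s)"
proof -
  obtain K where K: "\<And>l. l > 0 \<Longrightarrow> l powr \<alpha> * exp (- s * l) \<le> K" using powr_le_exp[OF assms] by blast
  show ?thesis
  proof (rule sdom_mono[OF cont_fpow[OF assms(1)] _ _ one_dom])
    show "\<bar>fpow \<alpha> s l\<bar> \<le> K * \<bar>1\<bar>" if "l \<ge> c" for l
      using K[of l] c_pos that by (simp add: fpow_pos abs_mult)
  qed simp
qed

lemma power_dom_mono:
  assumes "0 \<le> \<alpha>" "\<alpha> \<le> \<beta>" "x \<in> power_dom D A \<beta>"
  shows "x \<in> power_dom D A \<alpha>"
  unfolding power_dom_eq
proof (rule sdom_mono[OF cont_fpow cont_fpow])
  show "\<bar>fpow \<alpha> 0 l\<bar> \<le> c powr (\<alpha> - \<beta>) * \<bar>fpow \<beta> 0 l\<bar>" if l: "l \<ge> c" for l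
  proof -
    have "l powr \<alpha> = l powr (\<alpha> - \<beta>) * l powr \<beta>" by (simp flip: powr_add)
    also have "\<dots> \<le> c powr (\<alpha> - \<beta>) * l powr \<beta>"
      using l c_pos assms by (intro mult_right_mono powr_mono2') auto
    finally show ?thesis using l by (simp add: fpow_pos)
  qed
qed (use assms in \<open>simp_all add: power_dom_eq\<close>)

lemma W_W:
  assumes ab: "0 \<le> \<alpha>" "0 \<le> \<beta>" and d: "x \<in> res.sdom (fpow \<beta> r)" "x \<in> res.sdom (fpow (\<alpha> + \<beta>) (s + r))"
  shows "W \<beta> r x \<in> res.sdom (fpow \<alpha> s)" "W \<alpha> s (W \<beta> r x) = W (\<alpha> + \<beta>) (s + r) x"
proof -
  have c': "res.cont (\<lambda>l. fpow \<alpha> s l * fpow \<beta> r l)" using cont_fpow[OF ab(1)] cont_fpow[OF ab(2)] by (intro continuous_intros)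
  have eq: "fpow \<alpha> s l * fpow \<beta> r l = fpow (\<alpha> + \<beta>) (s + r) l" if "l \<ge> c" for l
  proof -
    have "exp (- (s + r) * l) = exp (- s * l) * exp (- r * l)" by (simp add: algebra_simps flip: exp_add)
    then show ?thesis unfolding fpow_pos[OF that] powr_add by (simp only: mult_ac)
  qed
  have cs: "res.cont (fpow (\<alpha> + \<beta>) (s + r))" using ab by (intro cont_fpow) simp
  have d': "x \<in> res.sdom (\<lambda>l. fpow \<alpha> s l * fpow \<beta> r l)"
    using sint_cong(1)[OF c' cs eq] d(2) by blast
  show "W \<beta> r x \<in> res.sdom (fpow \<alpha> s)" "W \<alpha> s (W \<beta> r x) = W (\<alpha> + \<beta>) (s + r) x"
    using res.sint_mult[OF cont_fpow[OF ab(1)] cont_fpow[OF ab(2)] d(1) d'] sint_cong(2)[OF c' cs eq d']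
    by (simp_all add: W_def)
qed

lemma D_power_dom: "D = power_dom D A 1"
  and A_W: "x \<in> D \<Longrightarrow> A x = W 1 0 x"
proof -
  have c1: "res.cont (fpow 1 0)" by (rule cont_fpow) simp
  have eq: "l = fpow 1 0 l" if "l \<ge> c" for l using that c_pos by (simp add: fpow_pos)
  show "D = power_dom D A 1"
    unfolding power_dom_eq using sint_cong(1)[OF cont_id c1 eq] D_iff by blast
  show "A x = W 1 0 x" if "x \<in> D" for x
    unfolding W_def using A_eq[OF that] sint_cong(2)[OF cont_id c1 eq, of x] that D_iff by metis
qed

lemma half_power_norm:
  assumes x: "x \<in> D"
  shows "(norm (power_op D A (1/2) x))\<^sup>2 = A x \<bullet> x"
proof -
  have d: "x \<in> res.sdom (fpow (1/2) 0)" using power_dom_mono[of "1/2" 1 x] x D_power_dom unfolding power_dom_eq by auto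
  have d1: "x \<in> res.sdom (\<lambda>l. l)" using x D_iff by blast
  have "(norm (power_op D A (1/2) x))\<^sup>2 = (\<integral>l. (fpow (1/2) 0 l)\<^sup>2 \<partial>res.\<mu> x)"
    unfolding power_op_eq W_def by (rule res.sint_norm_sq[OF cont_fpow d]) simp
  also have "\<dots> = (\<integral>l. l \<partial>res.\<mu> x)"
  proof (rule integral_cong_AE)
    show "(\<lambda>l. (fpow (1/2) 0 l)\<^sup>2) \<in> borel_measurable (res.\<mu> x)"
      using res.cont_measurable[OF res.cont_sq[OF cont_fpow[of "1/2" 0]]] by (simp add: measurable_cong_sets[OF res.sets_mu refl])
    show "AE l in res.\<mu> x. (fpow (1/2) 0 l)\<^sup>2 = l"
      using spectrum_ge
    proof eventually_elim
      case (elim l)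
      then show ?case using c_pos by (simp add: fpow_pos powr_half_sqrt)
    qed
  qed simp
  also have "\<dots> = A x \<bullet> x" using res.sint_quad[OF cont_id d1] A_eq[OF x] by simp
  finally show ?thesis .
qed

lemma W_continuous:
  assumes a: "\<alpha> \<ge> 0" and x: "x \<in> power_dom D A \<alpha>"
  shows "continuous_on {0..} (\<lambda>s. W \<alpha> s x)"
  unfolding continuous_on_sequentially
proof (intro allI ballI impI, elim conjE)
  fix s :: "nat \<Rightarrow> real" and t assume t: "t \<in> {0..}" and s: "\<forall>n. s n \<in> {0..}" and lim: "s \<longlonglongrightarrow> t"
  show "((\<lambda>s. W \<alpha> s x) \<circ> s) \<longlonglongrightarrow> W \<alpha> t x"
    unfolding o_def W_def
  proof (rule sint_dominated_limit[where h = "fpow \<alpha> 0"])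
    show "\<bar>fpow \<alpha> (s n) l\<bar> \<le> \<bar>fpow \<alpha> 0 l\<bar>" if "l \<ge> c" for n l
      using that c_pos s by (simp add: fpow_pos abs_mult mult_left_le)
    show "(\<lambda>n. fpow \<alpha> (s n) l) \<longlonglongrightarrow> fpow \<alpha> t l" for l
      unfolding fpow_def by (intro tendsto_intros lim)
  qed (use x in \<open>simp_all add: cont_fpow[OF a] power_dom_eq\<close>)
qed

lemma exp_diff_quotient_le:
  fixes l r s :: real
  assumes "0 \<le> l" "0 \<le> r" "0 \<le> s"
  shows "\<bar>exp (- r * l) - exp (- s * l)\<bar> \<le> \<bar>r - s\<bar> * l"
proof -
  have *: "\<bar>exp (- r * l) - exp (- s * l)\<bar> \<le> (s - r) * l" if rs: "r \<le> s" "0 \<le> r" for r s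
  proof -
    have e: "exp (- s * l) = exp (- r * l) * exp (- ((s - r) * l))" by (simp add: algebra_simps flip: exp_add)
    have "1 - exp (- ((s - r) * l)) \<le> (s - r) * l" using exp_ge_add_one_self[of "- ((s - r) * l)"] by linarith
    moreover have "exp (- r * l) \<le> 1" "exp (- ((s - r) * l)) \<le> 1" using rs assms by simp_all
    ultimately have "exp (- r * l) * (1 - exp (- ((s - r) * l))) \<le> 1 * ((s - r) * l)"
      by (intro mult_mono) auto
    moreover have "0 \<le> exp (- r * l) * (1 - exp (- ((s - r) * l)))" using rs assms by simp
    ultimately show ?thesis unfolding e by (simp add: algebra_simps)
  qed
  show ?thesis using *[of r s] *[of s r] assms by (cases "r \<le> s") (auto simp: abs_minus_commute)
qed

text \<open>
  The difference quotients in \<open>s\<close> of \<open>l\<^sup>\<alpha> exp(-s l)\<close> are bounded by \<open>l\<^sup>\<alpha>\<^sup>+\<^sup>1\<close>, uniformly in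
  \<open>s \<ge> 0\<close>. On \<open>D(A\<^sup>\<alpha>\<^sup>+\<^sup>1)\<close> dominated convergence therefore gives the derivative down to the
  endpoint \<open>s = 0\<close>.
\<close>

lemma W_derivative:
  assumes a: "\<alpha> \<ge> 0" and s: "s \<ge> 0" and x: "x \<in> power_dom D A (\<alpha> + 1)"
  shows "((\<lambda>s. W \<alpha> s x) has_vector_derivative - W (\<alpha> + 1) s x) (at s within {0..})"
  unfolding has_vector_derivative_def has_derivative_iff_norm
proof
  show "bounded_linear (\<lambda>h. h *\<^sub>R - W (\<alpha> + 1) s x)" by (rule bounded_linear_scaleR_left)
  have xa: "x \<in> power_dom D A \<alpha>" by (rule power_dom_mono[OF a _ x]) simp
  have a1: "\<alpha> + 1 \<ge> 0" using a by simp
  show "((\<lambda>r. norm (W \<alpha> r x - W \<alpha> s x - (r - s) *\<^sub>R - W (\<alpha> + 1) s x) / norm (r - s)) \<longlongrightarrow> 0) (at s within {0..})"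
    unfolding tendsto_at_iff_sequentially
  proof (intro allI impI)
    fix r :: "nat \<Rightarrow> real" assume "\<forall>i. r i \<in> {0..} - {s}" and lim: "r \<longlonglongrightarrow> s"
    then have r: "r n \<ge> 0" "r n \<noteq> s" for n by auto
    \<comment> \<open>the difference quotient of the integrand along a sequence \<open>r n\<close> tending to \<open>s\<close>\<close>
    define f where "f n l = (1 / (r n - s)) * fpow \<alpha> (r n) l + (- 1 / (r n - s)) * fpow \<alpha> s l" for n l
    have cf: "res.cont (f n)" for n unfolding f_def[abs_def] using cont_fpow[OF a] by (intro continuous_intros)
    have sf: "res.sint (f n) x = (1 / (r n - s)) *\<^sub>R (W \<alpha> (r n) x - W \<alpha> s x)" for n
      using res.sdom_fun_lin(2)[OF cont_fpow[OF a] cont_fpow[OF a] W_dom_nonneg[OF a r(1)[of n] xa] W_dom_nonneg[OF a s xa], of "1 / (r n - s)" "-1 / (r n - s)"]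
      by (simp add: f_def[abs_def] W_def scaleR_diff_right)
    have ng: "res.sint (\<lambda>l. (-1) * fpow (\<alpha> + 1) s l + 0 * fpow (\<alpha> + 1) s l) x = - W (\<alpha> + 1) s x"
      using res.sdom_fun_lin(2)[OF cont_fpow[OF a1] cont_fpow[OF a1] W_dom_nonneg[OF a1 s x] W_dom_nonneg[OF a1 s x], of "-1" 0]
      by (simp add: W_def)
    have "(\<lambda>n. res.sint (f n) x) \<longlonglongrightarrow> res.sint (\<lambda>l. (-1) * fpow (\<alpha> + 1) s l + 0 * fpow (\<alpha> + 1) s l) x"
    proof (rule sint_dominated_limit[where h = "fpow (\<alpha> + 1) 0"])
      show "res.cont (\<lambda>l. (-1) * fpow (\<alpha> + 1) s l + 0 * fpow (\<alpha> + 1) s l)"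
        using cont_fpow[OF a1] by (intro continuous_intros)
      fix l assume l: "l \<ge> c"
      then have l0: "l > 0" using c_pos by simp
      have f_eq: "f n l = l powr \<alpha> * ((exp (- r n * l) - exp (- s * l)) / (r n - s))" for n
        by (simp add: f_def fpow_pos[OF l] diff_divide_distrib algebra_simps)
      show "\<bar>f n l\<bar> \<le> \<bar>fpow (\<alpha> + 1) 0 l\<bar>" for n
      proof -
        have "\<bar>(exp (- r n * l) - exp (- s * l)) / (r n - s)\<bar> \<le> l"
          using exp_diff_quotient_le[of l "r n" s] r[of n] s l0 by (simp add: abs_divide pos_divide_le_eq mult.commute)
        then have "l powr \<alpha> * \<bar>(exp (- r n * l) - exp (- s * l)) / (r n - s)\<bar> \<le> l powr \<alpha> * l"
          by (rule mult_left_mono) simp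
        then show ?thesis using l0 by (simp add: f_eq fpow_pos[OF l] abs_mult powr_add)
      qed
      have "((\<lambda>r. exp (- r * l)) has_real_derivative (- l) * exp (- s * l)) (at s)"
        by (auto intro!: derivative_eq_intros)
      then have "((\<lambda>r. (exp (- r * l) - exp (- s * l)) / (r - s)) \<longlongrightarrow> (- l) * exp (- s * l)) (at s)"
        unfolding has_field_derivative_iff .
      then have "(\<lambda>n. (exp (- r n * l) - exp (- s * l)) / (r n - s)) \<longlonglongrightarrow> (- l) * exp (- s * l)"
        unfolding tendsto_at_iff_sequentially using lim r by (auto simp: o_def)
      then have "(\<lambda>n. f n l) \<longlonglongrightarrow> l powr \<alpha> * ((- l) * exp (- s * l))"
        unfolding f_eq by (rule tendsto_mult[OF tendsto_const])
      then show "(\<lambda>n. f n l) \<longlonglongrightarrow> (-1) * fpow (\<alpha> + 1) s l + 0 * fpow (\<alpha> + 1) s l"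
        using l0 by (simp add: fpow_pos[OF l] powr_add mult_ac)
    qed (use x in \<open>simp_all add: cf cont_fpow[OF a1] power_dom_eq\<close>)
    then have "(\<lambda>n. (1 / (r n - s)) *\<^sub>R (W \<alpha> (r n) x - W \<alpha> s x)) \<longlonglongrightarrow> - W (\<alpha> + 1) s x"
      unfolding sf ng .
    then have "(\<lambda>n. norm ((1 / (r n - s)) *\<^sub>R (W \<alpha> (r n) x - W \<alpha> s x) - - W (\<alpha> + 1) s x)) \<longlonglongrightarrow> 0"
      by (intro tendsto_norm_zero LIM_zero)
    moreover have "norm ((1 / (r n - s)) *\<^sub>R (W \<alpha> (r n) x - W \<alpha> s x) - - W (\<alpha> + 1) s x)
      = norm (W \<alpha> (r n) x - W \<alpha> s x - (r n - s) *\<^sub>R - W (\<alpha> + 1) s x) / norm (r n - s)" for n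
    proof -
      have "(1 / (r n - s)) *\<^sub>R (W \<alpha> (r n) x - W \<alpha> s x) - - W (\<alpha> + 1) s x
        = (1 / (r n - s)) *\<^sub>R (W \<alpha> (r n) x - W \<alpha> s x - (r n - s) *\<^sub>R - W (\<alpha> + 1) s x)"
        using r[of n] by (simp add: scaleR_diff_right scaleR_add_right)
      then show ?thesis by simp
    qed
    ultimately show "((\<lambda>r. norm (W \<alpha> r x - W \<alpha> s x - (r - s) *\<^sub>R - W (\<alpha> + 1) s x) / norm (r - s)) \<circ> r) \<longlonglongrightarrow> 0"
      by (simp add: o_def)
  qed
qed

end

section \<open>Classes of differentiable functions and separable equations\<close>

lemma Ck_on_SucI:
  assumes "\<And>t. t \<in> S \<Longrightarrow> (f has_vector_derivative f' t) (at t within S)" "Ck_on k S f'"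
  shows "Ck_on (Suc k) S f"
  unfolding Ck_on.simps(2) by (rule exI[of _ f']) (use assms in simp)

lemma Ck_on_SucE:
  assumes "Ck_on (Suc k) S f"
  obtains f' where "\<And>t. t \<in> S \<Longrightarrow> (f has_vector_derivative f' t) (at t within S)" "Ck_on k S f'"
  using assms unfolding Ck_on.simps(2) by blast

lemma Ck_on_SucD: "Ck_on (Suc k) S f \<Longrightarrow> Ck_on k S f"
proof (induction k arbitrary: f)
  case 0
  then obtain f' where f': "\<And>t. t \<in> S \<Longrightarrow> (f has_vector_derivative f' t) (at t within S)"
    by (rule Ck_on_SucE) blast
  then show ?case by (auto simp: continuous_on_eq_continuous_within intro: has_vector_derivative_continuous)
next
  case (Suc k)
  from Suc.prems obtain f' where "\<And>t. t \<in> S \<Longrightarrow> (f has_vector_derivative f' t) (at t within S)"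
    "Ck_on (Suc k) S f'" by (rule Ck_on_SucE) blast
  then show ?case using Suc.IH[of f'] by (intro Ck_on_SucI[of S f f'])
qed

lemma Ck_on_const: "Ck_on k S (\<lambda>_. c)"
proof (induction k arbitrary: c)
  case (Suc k)
  show ?case by (rule Ck_on_SucI[OF has_vector_derivative_const Suc])
qed simp

lemma Ck_on_add: "Ck_on k S f \<Longrightarrow> Ck_on k S g \<Longrightarrow> Ck_on k S (\<lambda>t. f t + g t)"
proof (induction k arbitrary: f g)
  case (Suc k)
  from Suc.prems(1) obtain f' where f:
    "\<And>t. t \<in> S \<Longrightarrow> (f has_vector_derivative f' t) (at t within S)" "Ck_on k S f'" by (rule Ck_on_SucE) blast
  from Suc.prems(2) obtain g' where g:
    "\<And>t. t \<in> S \<Longrightarrow> (g has_vector_derivative g' t) (at t within S)" "Ck_on k S g'" by (rule Ck_on_SucE) blast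
  show ?case
    by (rule Ck_on_SucI[OF has_vector_derivative_add[OF f(1) g(1)] Suc.IH[OF f(2) g(2)]])
qed (simp add: continuous_on_add)

lemma Ck_on_mult:
  fixes f g :: "real \<Rightarrow> real"
  shows "Ck_on k S f \<Longrightarrow> Ck_on k S g \<Longrightarrow> Ck_on k S (\<lambda>t. f t * g t)"
proof (induction k arbitrary: f g)
  case (Suc k)
  from Suc.prems(1) obtain f' where f:
    "\<And>t. t \<in> S \<Longrightarrow> (f has_vector_derivative f' t) (at t within S)" "Ck_on k S f'" by (rule Ck_on_SucE) blast
  from Suc.prems(2) obtain g' where g:
    "\<And>t. t \<in> S \<Longrightarrow> (g has_vector_derivative g' t) (at t within S)" "Ck_on k S g'" by (rule Ck_on_SucE) blast
  have d: "Ck_on k S (\<lambda>t. f t * g' t + f' t * g t)"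
    by (rule Ck_on_add[OF Suc.IH[OF Ck_on_SucD[OF Suc.prems(1)] g(2)] Suc.IH[OF f(2) Ck_on_SucD[OF Suc.prems(2)]]])
  show ?case
    by (rule Ck_on_SucI[OF has_vector_derivative_mult[OF f(1) g(1)] d])
qed (simp add: continuous_on_mult)

lemma Ck_on_compose:
  fixes f g :: "real \<Rightarrow> real"
  shows "Ck_on k T g \<Longrightarrow> Ck_on k S f \<Longrightarrow> f ` S \<subseteq> T \<Longrightarrow> Ck_on k S (\<lambda>t. g (f t))"
proof (induction k arbitrary: g)
  case 0
  then show ?case using continuous_on_compose2[of T g S f] by simp
next
  case (Suc k)
  from Suc.prems(2) obtain f' where f:
    "\<And>t. t \<in> S \<Longrightarrow> (f has_vector_derivative f' t) (at t within S)" "Ck_on k S f'" by (rule Ck_on_SucE) blast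
  from Suc.prems(1) obtain g' where g:
    "\<And>t. t \<in> T \<Longrightarrow> (g has_vector_derivative g' t) (at t within T)" "Ck_on k T g'" by (rule Ck_on_SucE) blast
  have d: "((\<lambda>t. g (f t)) has_vector_derivative f' t * g' (f t)) (at t within S)" if t: "t \<in> S" for t
  proof -
    have "(g has_vector_derivative g' (f t)) (at (f t) within f ` S)"
      using g(1)[of "f t"] t Suc.prems(3) has_vector_derivative_within_subset by blast
    from vector_diff_chain_within[OF f(1)[OF t] this] show ?thesis by (simp add: o_def)
  qed
  have e: "Ck_on k S (\<lambda>t. f' t * g' (f t))"
    by (rule Ck_on_mult[OF f(2) Suc.IH[OF g(2) Ck_on_SucD[OF Suc.prems(2)] Suc.prems(3)]])
  show ?case by (rule Ck_on_SucI[OF d e])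
qed

lemma Ck_on_one_plus_powr: "Ck_on k {0<..} (\<lambda>t::real. (1 + t) powr q)"
proof (induction k arbitrary: q)
  case 0
  show ?case by (auto intro!: continuous_intros)
next
  case (Suc k)
  have d: "((\<lambda>t. (1 + t) powr q) has_vector_derivative q * (1 + t) powr (q - 1)) (at t within {0<..})"
    if "t \<in> {0<..}" for t :: real
  proof -
    have "((\<lambda>t. (1 + t) powr q) has_real_derivative q * (1 + t) powr (q - 1)) (at t within {0<..})"
      using that by (auto intro!: derivative_eq_intros simp: powr_diff)
    then show ?thesis by (simp add: has_real_derivative_iff_has_vector_derivative)
  qed
  show ?case by (rule Ck_on_SucI[OF d Ck_on_mult[OF Ck_on_const Suc]])
qed

lemma Ck_into_SucI:
  assumes "\<And>t. t \<in> S \<Longrightarrow> u t \<in> D" "\<And>t. t \<in> S \<Longrightarrow> u' t \<in> D"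
    "\<And>t. t \<in> S \<Longrightarrow> ((\<lambda>s. (u s, B (u s))) has_vector_derivative (u' t, B (u' t))) (at t within S)"
    "Ck_into D B k S u'"
  shows "Ck_into D B (Suc k) S u"
  unfolding Ck_into.simps(2) by (intro conjI ballI exI[of _ u'] assms)

lemma Ck_into_add:
  assumes add: "\<And>x y. x \<in> D \<Longrightarrow> y \<in> D \<Longrightarrow> x + y \<in> D \<and> B (x + y) = B x + B y"
  shows "Ck_into D B k S u \<Longrightarrow> Ck_into D B k S v \<Longrightarrow> Ck_into D B k S (\<lambda>t. u t + v t)"
proof (induction k arbitrary: u v)
  case 0
  then have "continuous_on S (\<lambda>t. (u t, B (u t)) + (v t, B (v t)))"
    by (intro continuous_on_add) auto
  moreover have "(u t, B (u t)) + (v t, B (v t)) = (u t + v t, B (u t + v t))" if "t \<in> S" for t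
    using 0 that add by simp
  ultimately have "continuous_on S (\<lambda>t. (u t + v t, B (u t + v t)))"
    using continuous_on_cong by (metis (mono_tags, lifting))
  then show ?case using 0 add by simp
next
  case (Suc k)
  obtain u' where u: "\<And>t. t \<in> S \<Longrightarrow> u t \<in> D" "\<And>t. t \<in> S \<Longrightarrow> u' t \<in> D"
    "\<And>t. t \<in> S \<Longrightarrow> ((\<lambda>s. (u s, B (u s))) has_vector_derivative (u' t, B (u' t))) (at t within S)"
    "Ck_into D B k S u'" using Suc.prems(1) by auto
  obtain v' where v: "\<And>t. t \<in> S \<Longrightarrow> v t \<in> D" "\<And>t. t \<in> S \<Longrightarrow> v' t \<in> D"
    "\<And>t. t \<in> S \<Longrightarrow> ((\<lambda>s. (v s, B (v s))) has_vector_derivative (v' t, B (v' t))) (at t within S)"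
    "Ck_into D B k S v'" using Suc.prems(2) by auto
  have "((\<lambda>s. (u s + v s, B (u s + v s))) has_vector_derivative (u' t + v' t, B (u' t + v' t))) (at t within S)"
    if t: "t \<in> S" for t
  proof -
    have "((\<lambda>s. (u s, B (u s)) + (v s, B (v s))) has_vector_derivative (u' t, B (u' t)) + (v' t, B (v' t))) (at t within S)"
      by (rule has_vector_derivative_add[OF u(3)[OF t] v(3)[OF t]])
    then have "((\<lambda>s. (u s + v s, B (u s + v s))) has_vector_derivative (u' t, B (u' t)) + (v' t, B (v' t))) (at t within S)"
      by (rule has_vector_derivative_transform[OF t, rotated]) (simp add: add u v)
    then show ?thesis using add[OF u(2)[OF t] v(2)[OF t]] by simp
  qed
  moreover have "Ck_into D B k S (\<lambda>t. u' t + v' t)" by (rule Suc.IH[OF u(4) v(4)])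
  ultimately show ?case unfolding Ck_into.simps(2) using add u(1,2) v(1,2)
    by (intro conjI ballI exI[of _ "\<lambda>t. u' t + v' t"]) auto
qed

text \<open>
  \<open>g\<close> solves the separable equation \<open>g' = 1 / h(g)\<close>. The lower bound on \<open>h\<close> makes \<open>G\<close>
  surjective and its inverse Lipschitz continuous.
\<close>

lemma antiderivative_with_inverse:
  fixes h :: "real \<Rightarrow> real"
  assumes h: "continuous_on UNIV h" and b: "b > 0" and hb: "\<And>x. b \<le> h x"
  obtains G g where "G 0 = 0" "\<And>x. (G has_real_derivative h x) (at x)"
    "\<And>y. G (g y) = y" "\<And>x. g (G x) = x" "\<And>y. (g has_real_derivative 1 / h (g y)) (at y)"
proof -
  have "\<exists>F. \<forall>x :: real. -\<infinity> < ereal x \<longrightarrow> ereal x < \<infinity> \<longrightarrow> (F has_vector_derivative h x) (at x)"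
    by (rule einterval_antiderivative) (use h in \<open>auto simp: continuous_on_eq_continuous_at\<close>)
  then obtain F where F: "\<And>x. (F has_real_derivative h x) (at x)"
    by (auto simp: has_real_derivative_iff_has_vector_derivative)
  define G where "G x = F x - F 0" for x
  have G: "(G has_real_derivative h x) (at x)" for x
    unfolding G_def[abs_def] by (auto intro!: derivative_eq_intros F)
  have inc: "b * (y - x) \<le> G y - G x" if xy: "x \<le> y" for x y
  proof -
    have "((\<lambda>x. G x - b * x) has_real_derivative h x - b) (at x)" for x
      by (auto intro!: derivative_eq_intros G)
    then have "G x - b * x \<le> G y - b * y"
      using DERIV_nonneg_imp_nondecreasing[OF xy, of "\<lambda>x. G x - b * x"] hb by (metis diff_ge_0_iff_ge)
    then show ?thesis by (simp add: algebra_simps)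
  qed
  have G0: "G 0 = 0" by (simp add: G_def)
  have inj: "x = y" if "G x = G y" for x y
    using inc[of x y] inc[of y x] that mult_pos_pos[OF b, of "y - x"] mult_pos_pos[OF b, of "x - y"]
    by linarith
  have Gc: "isCont G x" for x using G DERIV_isCont by blast
  have "\<exists>x. G x = y" for y
  proof -
    define r where "r = \<bar>y\<bar> / b"
    have r: "0 \<le> r" "b * r = \<bar>y\<bar>" using b by (auto simp: r_def)
    have "G (- r) \<le> y" "y \<le> G r" using inc[of 0 r] inc[of "- r" 0] r G0 by auto
    then show ?thesis using IVT[of G "- r" y r] r(1) Gc by auto
  qed
  then obtain g where g: "\<And>y. G (g y) = y" by metis
  have gG: "g (G x) = x" for x using inj g by blast
  have lip: "\<bar>g y - g z\<bar> \<le> \<bar>y - z\<bar> / b" for y z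
  proof -
    have *: "g z - g y \<le> \<bar>y - z\<bar> / b" if "g y \<le> g z" for y z
    proof -
      have "b * (g z - g y) \<le> \<bar>y - z\<bar>" using inc[OF that] g[of y] g[of z] by linarith
      then show ?thesis using b by (simp add: pos_le_divide_eq mult.commute)
    qed
    show ?thesis using *[of y z] *[of z y] by (cases "g y \<le> g z") (auto simp: abs_minus_commute)
  qed
  have gc: "isCont g y" for y
    unfolding continuous_at_eps_delta
  proof (intro allI impI)
    fix e :: real assume e: "e > 0"
    have "dist (g z) (g y) < e" if "dist z y < e * b" for z
      using lip[of z y] that b by (simp add: dist_real_def) (smt (verit) pos_divide_less_eq)
    then show "\<exists>d>0. \<forall>z. dist z y < d \<longrightarrow> dist (g z) (g y) < e" using e b by (intro exI[of _ "e * b"]) auto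
  qed
  have "(g has_real_derivative 1 / h (g y)) (at y)" for y
    using DERIV_inverse_function[OF G, of g y "y - 1" "y + 1"] g gc hb[of "g y"] b
    by (auto simp: inverse_eq_divide)
  then show thesis using that G0 G g gG by blast
qed

section \<open>The Cauchy problem: change of time and uniqueness\<close>

context coercive_operator
begin

lemma W_in_power_dom:
  assumes "0 \<le> \<alpha>" "0 \<le> \<beta>" "s > 0"
  shows "W \<beta> s x \<in> power_dom D A \<alpha>" "power_op D A \<alpha> (W \<beta> s x) = W (\<alpha> + \<beta>) s x"
  using W_W[where \<alpha> = \<alpha> and \<beta> = \<beta> and s = 0 and r = s and x = x] W_dom_pos[OF assms(2,3), of x] W_dom_pos[of "\<alpha> + \<beta>" s x] assms
  by (simp_all add: power_dom_eq power_op_eq)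

lemma semigroup_in_power_dom:
  assumes "0 \<le> \<alpha>" "0 \<le> s" "x \<in> power_dom D A \<alpha>"
  shows "W 0 s x \<in> power_dom D A \<alpha>" "power_op D A \<alpha> (W 0 s x) = W \<alpha> s x"
  using W_W[where \<alpha> = \<alpha> and \<beta> = 0 and s = 0 and r = s and x = x] assms
    W_dom_nonneg[OF order_refl assms(2), of x] W_dom_nonneg[OF assms] power_dom_mono[OF order_refl assms(1,3)]
  by (simp_all add: power_dom_eq power_op_eq)

text \<open>
  \<open>exp(-b A) x\<close> lies in the domain of every power, so the one-sided result applies after a
  shift of time by \<open>b = s / 2\<close>, and \<open>s - b\<close> is an interior point.
\<close>

lemma W_derivative_pos:
  assumes a: "0 \<le> \<alpha>" and s: "s > 0"
  shows "((\<lambda>r. W \<alpha> r x) has_vector_derivative - W (\<alpha> + 1) s x) (at s)"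
proof -
  define b where "b = s / 2"
  have b: "0 < b" "b < s" using s by (simp_all add: b_def)
  define y where "y = W 0 b x"
  have y: "y \<in> power_dom D A (\<alpha> + 1)"
    unfolding y_def using W_in_power_dom(1)[of "\<alpha> + 1" 0 b] a b by simp
  have shift: "W \<gamma> (r - b) y = W \<gamma> r x" if "0 \<le> \<gamma>" "r > b" for \<gamma> r
    unfolding y_def using W_W(2)[OF that(1) order_refl W_dom_pos[OF order_refl b(1)], of x "r - b"]
      W_dom_pos[of \<gamma> r x] that b by simp
  have "((\<lambda>r. W \<alpha> r y) has_vector_derivative - W (\<alpha> + 1) (s - b) y) (at (s - b) within {0..})"
    by (rule W_derivative[OF a _ y]) (use b in simp)
  then have "((\<lambda>r. W \<alpha> r y) has_vector_derivative - W (\<alpha> + 1) s x) (at (s - b))"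
    using shift[of "\<alpha> + 1" s] a b at_within_interior[of "s - b" "{0..}"] by simp
  moreover have "((\<lambda>r. r - b) has_vector_derivative 1) (at s)"
    unfolding has_real_derivative_iff_has_vector_derivative[symmetric] by (auto intro!: derivative_eq_intros)
  ultimately have "((\<lambda>r. W \<alpha> (r - b) y) has_vector_derivative - W (\<alpha> + 1) s x) (at s)"
    using vector_diff_chain_at[of "\<lambda>r. r - b" 1 s "\<lambda>r. W \<alpha> r y" "- W (\<alpha> + 1) s x"]
    by (simp add: o_def)
  then show ?thesis
    by (rule has_vector_derivative_transform_within_open[of _ _ _ "{b<..}"]) (use b shift[OF a] in auto)
qed

lemma W_decay:
  assumes "0 \<le> \<alpha>" "0 \<le> s" "x \<in> power_dom D A \<alpha>"
  shows "norm (W \<alpha> s x) \<le> exp (- c * s) * norm (W \<alpha> 0 x)"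
  unfolding W_def
proof (rule sint_norm_le[OF cont_fpow[OF assms(1)] cont_fpow[OF assms(1)]])
  show "\<bar>fpow \<alpha> s l\<bar> \<le> exp (- c * s) * \<bar>fpow \<alpha> 0 l\<bar>" if l: "l \<ge> c" for l
  proof -
    have "c * s \<le> s * l" using mult_left_mono[OF l assms(2)] by (simp add: mult.commute)
    then have "l powr \<alpha> * exp (- s * l) \<le> l powr \<alpha> * exp (- c * s)" by (intro mult_left_mono) auto
    then show ?thesis by (simp add: fpow_pos[OF l] abs_mult mult.commute)
  qed
qed (use assms in \<open>simp_all add: power_dom_eq\<close>)

lemma W_0_0: "W 0 0 x = x"
proof -
  have eq: "fpow 0 0 = (\<lambda>_. 1)" by (simp add: fpow_def spectral_pow_def fun_eq_iff)
  have c1: "res.cont (\<lambda>_. 1)" by simp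
  have "(\<lambda>n. R (real n) x - R (- real n) x) \<longlonglongrightarrow> res.sint (\<lambda>_. 1) x"
    using res.cutop_tendsto[OF c1 one_dom, of x] by (simp add: res.cutop_one)
  from LIMSEQ_unique[OF this res.E_diff_tendsto] show ?thesis by (simp add: W_def eq)
qed

lemma power_op_lin:
  assumes "0 \<le> \<alpha>" "x \<in> power_dom D A \<alpha>" "y \<in> power_dom D A \<alpha>"
  shows "a *\<^sub>R x + b *\<^sub>R y \<in> power_dom D A \<alpha>"
    "power_op D A \<alpha> (a *\<^sub>R x + b *\<^sub>R y) = a *\<^sub>R power_op D A \<alpha> x + b *\<^sub>R power_op D A \<alpha> y"
  using assms res.sdom_lin[OF cont_fpow[OF assms(1), of 0]] res.sint_lin[OF cont_fpow[OF assms(1), of 0]]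
  by (simp_all add: power_dom_eq power_op_eq W_def)

text \<open>
  The derivative of \<open>|w|\<^sup>2\<close> is \<open>- 2 k \<langle>A w, w\<rangle> \<le> 0\<close>.
\<close>

lemma linear_evolution_unique:
  fixes w :: "real \<Rightarrow> 'a" and k :: "real \<Rightarrow> real"
  assumes der: "\<And>t. t \<ge> 0 \<Longrightarrow> (w has_vector_derivative - k t *\<^sub>R A (w t)) (at t within {0..})"
    and dom: "\<And>t. t \<ge> 0 \<Longrightarrow> w t \<in> D" and k: "\<And>t. t \<ge> 0 \<Longrightarrow> 0 \<le> k t" and w0: "w 0 = 0" and t: "t \<ge> 0"
  shows "w t = 0"
proof -
  have cw: "continuous_on {0..} w"
    using der by (auto simp: continuous_on_eq_continuous_within intro: has_vector_derivative_continuous)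
  have "w t \<bullet> w t \<le> w 0 \<bullet> w 0"
  proof (rule DERIV_nonpos_imp_decreasing_open[OF t])
    show "continuous_on {0..t} (\<lambda>t. w t \<bullet> w t)"
      by (intro continuous_on_inner continuous_on_subset[OF cw]) auto
    fix s assume s: "0 < s" "s < t"
    have "(w has_vector_derivative - k s *\<^sub>R A (w s)) (at s)"
      using der[of s] s at_within_interior[of s "{0..}"] by simp
    then have d: "(w has_derivative (\<lambda>h. h *\<^sub>R (- k s *\<^sub>R A (w s)))) (at s)" by (simp add: has_vector_derivative_def)
    have "((\<lambda>t. w t \<bullet> w t) has_derivative (*) (- 2 * k s * (A (w s) \<bullet> w s))) (at s)"
      by (rule has_derivative_eq_rhs[OF has_derivative_inner[OF d d]]) (simp add: fun_eq_iff inner_commute)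
    then have "((\<lambda>t. w t \<bullet> w t) has_real_derivative - 2 * k s * (A (w s) \<bullet> w s)) (at s)"
      by (simp add: has_field_derivative_def)
    moreover have "0 \<le> c * (norm (w s))\<^sup>2" using c_pos by simp
    then have "0 \<le> A (w s) \<bullet> w s" using coercive[OF dom[of s]] s by linarith
    then have "- 2 * k s * (A (w s) \<bullet> w s) \<le> 0" using k[of s] s by (simp add: mult_nonneg_nonneg)
    ultimately show "\<exists>y. ((\<lambda>t. w t \<bullet> w t) has_real_derivative y) (at s) \<and> y \<le> 0" by blast
  qed
  then have "(norm (w t))\<^sup>2 \<le> 0" using w0 by (simp add: power2_norm_eq_inner)
  then show ?thesis by simp
qed

end

locale kirchhoff_cauchy = coercive_operator D A c
  for D :: "'a::{real_inner, complete_space} set" and A :: "'a \<Rightarrow> 'a" and c :: real +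
  fixes u0 :: 'a and p \<mu> :: real and m :: "real \<Rightarrow> real"
  assumes u0: "u0 \<in> D" and p: "p \<ge> 0" and m_cont: "continuous_on {0..} m"
    and m_ge: "\<And>\<sigma>. \<sigma> \<ge> 0 \<Longrightarrow> \<mu> \<le> m \<sigma>" and mu_pos: "\<mu> > 0"
begin

lemma u0_dom: "0 \<le> \<alpha> \<Longrightarrow> \<alpha> \<le> 1 \<Longrightarrow> u0 \<in> power_dom D A \<alpha>"
  using power_dom_mono u0 D_power_dom by blast

lemma semigroup_D: "s \<ge> 0 \<Longrightarrow> W 0 s u0 \<in> D" "s \<ge> 0 \<Longrightarrow> A (W 0 s u0) = W 1 s u0"
proof -
  assume s: "s \<ge> 0"
  note 1 = semigroup_in_power_dom[OF _ s u0_dom, of 1]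
  show D1: "W 0 s u0 \<in> D" using 1(1) D_power_dom by simp
  show "A (W 0 s u0) = W 1 s u0" using A_W[OF D1] 1(2) by (simp add: power_op_eq)
qed

definition \<phi> :: "real \<Rightarrow> real" where "\<phi> s = (norm (W (1/2) s u0))\<^sup>2"

lemma phi_nonneg: "0 \<le> \<phi> s" by (simp add: \<phi>_def)

lemma phi_eq: "s \<ge> 0 \<Longrightarrow> (norm (power_op D A (1/2) (W 0 s u0)))\<^sup>2 = \<phi> s"
  using semigroup_in_power_dom(2)[of "1/2" s u0] u0_dom by (simp add: \<phi>_def)

lemma phi_le: assumes "s \<ge> 0" shows "\<phi> s \<le> \<phi> 0"
proof -
  have "norm (W (1/2) s u0) \<le> exp (- c * s) * norm (W (1/2) 0 u0)"
    by (rule W_decay) (use assms u0_dom in auto)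
  also have "\<dots> \<le> 1 * norm (W (1/2) 0 u0)"
    using assms c_pos by (intro mult_right_mono) auto
  finally show ?thesis unfolding \<phi>_def by (simp add: power_mono)
qed

lemma phi_continuous: "continuous_on {0..} \<phi>"
  unfolding \<phi>_def by (intro continuous_intros W_continuous u0_dom) auto

text \<open>
  The scalar equation is \<open>h(\<sigma>) \<sigma>' = (1 + t)\<^sup>p\<close>. The function \<open>h\<close> is extended by a constant
  to negative arguments, so that its antiderivative is a bijection of the line.
\<close>

definition h :: "real \<Rightarrow> real" where "h s = 1 / m (\<phi> (max 0 s))"

lemma m_pos: "\<sigma> \<ge> 0 \<Longrightarrow> 0 < m \<sigma>"
  using m_ge mu_pos by (meson less_le_trans)

lemma h_continuous: "continuous_on UNIV h"
proof -
  have "continuous_on UNIV (\<lambda>s::real. max 0 s)" by (intro continuous_intros)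
  then have "continuous_on UNIV (\<lambda>s. \<phi> (max 0 s))"
    by (rule continuous_on_compose2[OF phi_continuous]) auto
  then have "continuous_on UNIV (\<lambda>s. m (\<phi> (max 0 s)))"
    by (rule continuous_on_compose2[OF m_cont]) (use phi_nonneg in auto)
  moreover have "m (\<phi> (max 0 s)) \<noteq> 0" for s using m_pos[OF phi_nonneg] by (metis less_irrefl)
  ultimately show ?thesis unfolding h_def[abs_def] by (intro continuous_on_divide continuous_on_const) auto
qed

text \<open>
  \<open>\<phi>\<close> decreases from \<open>\<phi>(0)\<close>, so only the values of \<open>m\<close> on a compact interval matter.
\<close>

lemma m_bounded: "\<exists>M>0. \<forall>s\<ge>0. m (\<phi> s) \<le> M"
proof -
  have "compact (m ` {0..\<phi> 0})"
    by (intro compact_continuous_image continuous_on_subset[OF m_cont]) auto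
  then obtain M where M: "\<And>y. y \<in> m ` {0..\<phi> 0} \<Longrightarrow> \<bar>y\<bar> \<le> M"
    using compact_imp_bounded bounded_real by metis
  have "m (\<phi> s) \<le> M" if "s \<ge> 0" for s
    using M[of "m (\<phi> s)"] phi_nonneg[of s] phi_le[OF that] by force
  then show ?thesis by (intro exI[of _ "max M 1"]) (auto intro: le_max_iff_disj[THEN iffD2])
qed

text \<open>
  The antiderivative of \<open>(1 + t)\<^sup>p\<close> that vanishes at 0.
\<close>

definition clock :: "real \<Rightarrow> real" where "clock t = ((1 + t) powr (1 + p) - 1) / (1 + p)"

lemma clock_derivative: "t > -1 \<Longrightarrow> (clock has_real_derivative (1 + t) powr p) (at t)"
  unfolding clock_def[abs_def] using p by (auto intro!: derivative_eq_intros simp: powr_diff)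

lemma clock_nonneg: "t \<ge> 0 \<Longrightarrow> 0 \<le> clock t"
  using p ge_one_powr_ge_zero[of "1 + t" "1 + p"] by (simp add: clock_def)

lemma clock_pos: "t > 0 \<Longrightarrow> 0 < clock t"
  using p gr_one_powr[of "1 + t" "1 + p"] by (simp add: clock_def)

lemma clock_0: "clock 0 = 0" by (simp add: clock_def)

text \<open>
  \<open>\<sigma>\<close> is the inverse of \<open>G\<close> after the clock. The lower bound holds because
  \<open>\<sigma>' \<ge> \<mu> (1 + t)\<^sup>p\<close>.
\<close>

lemma time_change:
  obtains G \<sigma> where "\<And>s. (G has_real_derivative h s) (at s)" "G 0 = 0" "\<And>t. G (\<sigma> t) = clock t"
    "\<And>s t. G s = clock t \<Longrightarrow> s = \<sigma> t"
    "\<sigma> 0 = 0" "\<And>t. t \<ge> 0 \<Longrightarrow> \<mu> * clock t \<le> \<sigma> t"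
    "\<And>t. t \<ge> 0 \<Longrightarrow> (\<sigma> has_real_derivative (1 + t) powr p * m (\<phi> (\<sigma> t))) (at t)"
proof -
  obtain M where M: "M > 0" "\<And>s. s \<ge> 0 \<Longrightarrow> m (\<phi> s) \<le> M" using m_bounded by blast
  have "1 / M \<le> h s" for s
    unfolding h_def using M(2)[of "max 0 s"] m_pos[OF phi_nonneg] by (intro divide_left_mono mult_pos_pos M(1)) auto
  then obtain G g where G: "G 0 = 0" "\<And>x. (G has_real_derivative h x) (at x)"
    "\<And>y. G (g y) = y" "\<And>x. g (G x) = x" and g: "\<And>y. (g has_real_derivative 1 / h (g y)) (at y)"
    using antiderivative_with_inverse[OF h_continuous, of "1 / M"] M(1) by auto
  define \<sigma> where "\<sigma> t = g (clock t)" for t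
  have s0: "\<sigma> 0 = 0" using G(4)[of 0] by (simp add: \<sigma>_def clock_0 G(1))
  have mh: "1 / h s = m (\<phi> (max 0 s))" for s by (simp add: h_def)
  have d: "(\<sigma> has_real_derivative (1 + t) powr p * m (\<phi> (max 0 (\<sigma> t)))) (at t)" if "t \<ge> 0" for t
  proof -
    have "(clock has_real_derivative (1 + t) powr p) (at t)" by (rule clock_derivative) (use that in simp)
    from DERIV_chain2[OF g this] show ?thesis unfolding \<sigma>_def mh by (simp add: mult.commute)
  qed
  have low: "\<mu> * clock t \<le> \<sigma> t" if t: "t \<ge> 0" for t
  proof -
    have "\<sigma> 0 - \<mu> * clock 0 \<le> \<sigma> t - \<mu> * clock t"
    proof (rule DERIV_nonneg_imp_nondecreasing[OF t])
      fix s assume s: "0 \<le> s" "s \<le> t"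
      have "((\<lambda>t. \<sigma> t - \<mu> * clock t) has_real_derivative
          (1 + s) powr p * m (\<phi> (max 0 (\<sigma> s))) - \<mu> * (1 + s) powr p) (at s)"
        by (intro DERIV_diff d s DERIV_cmult clock_derivative) (use s in simp)
      moreover have "\<mu> * (1 + s) powr p \<le> (1 + s) powr p * m (\<phi> (max 0 (\<sigma> s)))"
        using mult_left_mono[OF m_ge[OF phi_nonneg], of "(1 + s) powr p"] by (simp add: mult.commute)
      ultimately show "\<exists>y. ((\<lambda>t. \<sigma> t - \<mu> * clock t) has_real_derivative y) (at s) \<and> 0 \<le> y"
        by (meson diff_ge_0_iff_ge)
    qed
    then show ?thesis by (simp add: s0 clock_0)
  qed
  have mx: "max 0 (\<sigma> t) = \<sigma> t" if "t \<ge> 0" for t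
    using low[OF that] clock_nonneg[OF that] mu_pos by (smt (verit) mult_nonneg_nonneg)
  have inv: "s = \<sigma> t" if "G s = clock t" for s t using G(4)[of s] that by (simp add: \<sigma>_def)
  have Gs: "G (\<sigma> t) = clock t" for t by (simp add: \<sigma>_def G(3))
  have d': "(\<sigma> has_real_derivative (1 + t) powr p * m (\<phi> (\<sigma> t))) (at t)" if "t \<ge> 0" for t
    using d[OF that] unfolding mx[OF that] .
  show thesis by (rule that[OF G(2) G(1) Gs inv s0 low d'])
qed

lemma within_nontrivial: "t \<ge> 0 \<Longrightarrow> at t within {0..} \<noteq> (bot :: real filter)"
proof (cases "t = 0")
  case True
  then show ?thesis by (simp add: at_within_Ici_at_right)
next
  case False
  assume "t \<ge> 0"
  then show ?thesis using False at_within_interior[of t "{0..}"] by simp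
qed

lemma evolution_derivative:
  assumes \<sigma>: "(\<sigma> has_real_derivative d) (at t within {0..})" and pos: "\<And>t. t \<ge> 0 \<Longrightarrow> \<sigma> t \<ge> 0"
    and t: "t \<ge> 0"
  shows "((\<lambda>t. W 0 (\<sigma> t) u0) has_vector_derivative - d *\<^sub>R W 1 (\<sigma> t) u0) (at t within {0..})"
proof -
  have sub: "\<sigma> ` {0..} \<subseteq> {0..}" using pos by auto
  have "((\<lambda>s. W 0 s u0) has_vector_derivative - W (0 + 1) (\<sigma> t) u0) (at (\<sigma> t) within {0..})"
    by (rule W_derivative) (use pos t u0_dom in auto)
  from has_vector_derivative_within_subset[OF this sub]
  have "((\<lambda>s. W 0 s u0) has_vector_derivative - W 1 (\<sigma> t) u0) (at (\<sigma> t) within \<sigma> ` {0..})" by simp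
  from vector_diff_chain_within[OF \<sigma>[unfolded has_real_derivative_iff_has_vector_derivative] this]
  show ?thesis by (simp add: o_def)
qed

text \<open>
  \<open>v\<close> solves a linear equation \<open>v' = - k(t) A v\<close> with a coefficient computed from \<open>v\<close>. So
  does \<open>exp(-S(t) A) u\<^sub>0\<close> if \<open>S' = k\<close>, and the linear equation has only one solution.
  Knowing this form of \<open>v\<close>, \<open>k\<close> is the right-hand side of the scalar equation at \<open>S\<close>,
  which determines \<open>G(S(t))\<close>.
\<close>

lemma solution_unique:
  assumes G: "\<And>s. (G has_real_derivative h s) (at s)" "G 0 = 0" "\<And>s t. G s = clock t \<Longrightarrow> s = \<sigma> t"
    and v: "is_global_solution D A p m u0 v" and t: "t \<ge> 0"
  shows "v t = W 0 (\<sigma> t) u0"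
proof -
  from v obtain v' where v': "\<And>t. t \<ge> 0 \<Longrightarrow> (v has_vector_derivative v' t) (at t within {0..})"
    and vD: "\<And>t. t \<ge> 0 \<Longrightarrow> v t \<in> D" and cv: "continuous_on {0..} (\<lambda>t. (v t, A (v t)))"
    and eq: "\<And>t. t \<ge> 0 \<Longrightarrow> (1 / (1 + t) powr p) *\<^sub>R vector_derivative v (at t within {0..})
              + m ((norm (power_op D A (1/2) (v t)))\<^sup>2) *\<^sub>R A (v t) = 0"
    and v0: "v 0 = u0"
    unfolding is_global_solution_def by auto
  define k where "k t = (1 + t) powr p * m (A (v t) \<bullet> v t)" for t
  have Av: "0 \<le> A (v t) \<bullet> v t" if "t \<ge> 0" for t
    using half_power_norm[OF vD[OF that]] by (metis zero_le_power2)
  have k0: "0 \<le> k t" if "t \<ge> 0" for t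
    using m_pos[OF Av[OF that]] by (simp add: k_def)
  have vder: "(v has_vector_derivative - k t *\<^sub>R A (v t)) (at t within {0..})" if t: "t \<ge> 0" for t
  proof -
    have "vector_derivative v (at t within {0..}) = v' t"
      by (rule vector_derivative_within[OF within_nontrivial[OF t] v'[OF t]])
    then have *: "(1 / (1 + t) powr p) *\<^sub>R v' t + m (A (v t) \<bullet> v t) *\<^sub>R A (v t) = 0"
      using eq[OF t] half_power_norm[OF vD[OF t]] by simp
    have nz: "(1 + t) powr p \<noteq> 0" using t by simp
    have "(1 + t) powr p *\<^sub>R ((1 / (1 + t) powr p) *\<^sub>R v' t + m (A (v t) \<bullet> v t) *\<^sub>R A (v t)) = 0"
      by (simp only: * scaleR_zero_right)
    then have "v' t + k t *\<^sub>R A (v t) = 0" using nz by (simp add: scaleR_add_right k_def)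
    then have "v' t = - k t *\<^sub>R A (v t)" by (simp add: eq_neg_iff_add_eq_0)
    then show ?thesis using v'[OF t] by simp
  qed
  have ck: "continuous_on {0..} k"
  proof -
    have "continuous_on {0..} (\<lambda>t. A (v t) \<bullet> v t)"
      using continuous_on_fst[OF cv] continuous_on_snd[OF cv] by (simp add: continuous_on_inner)
    then have "continuous_on {0..} (\<lambda>t. m (A (v t) \<bullet> v t))"
      by (rule continuous_on_compose2[OF m_cont]) (use Av in auto)
    then show ?thesis unfolding k_def[abs_def] by (intro continuous_intros) auto
  qed
  have ck': "continuous_on UNIV (\<lambda>t. k (max 0 t))"
    by (rule continuous_on_compose2[OF ck]) (auto intro!: continuous_intros)
  have "\<exists>F. \<forall>x :: real. -\<infinity> < ereal x \<longrightarrow> ereal x < \<infinity> \<longrightarrow> (F has_vector_derivative k (max 0 x)) (at x)"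
    by (rule einterval_antiderivative) (use ck' in \<open>auto simp: continuous_on_eq_continuous_at\<close>)
  then obtain F where F: "\<And>x. (F has_real_derivative k (max 0 x)) (at x)"
    by (auto simp: has_real_derivative_iff_has_vector_derivative)
  \<comment> \<open>the candidate for \<open>\<sigma>\<close>: elapsed time along the trajectory of the linear equation\<close>
  define S where "S x = F x - F 0" for x
  have Sd: "(S has_real_derivative k x) (at x)" if "x \<ge> 0" for x
    unfolding S_def[abs_def] using F[of x] that by (auto intro!: derivative_eq_intros simp: max_def)
  have S0: "S 0 = 0" by (simp add: S_def)
  have Spos: "S x \<ge> 0" if "x \<ge> 0" for x
    using DERIV_nonneg_imp_nondecreasing[OF that, of S] Sd k0 S0 by metis
  define z where "z t = W 0 (S t) u0" for t
  have zD: "z t \<in> D" "A (z t) = W 1 (S t) u0" if "t \<ge> 0" for t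
    using semigroup_D[OF Spos[OF that]] by (simp_all add: z_def)
  have zd: "(z has_vector_derivative - k t *\<^sub>R A (z t)) (at t within {0..})" if t: "t \<ge> 0" for t
    unfolding zD(2)[OF t] unfolding z_def[abs_def]
    by (rule evolution_derivative[OF has_field_derivative_at_within[OF Sd[OF t]] Spos t])
  have vz: "v t = z t" if t: "t \<ge> 0" for t
  proof -
    have "v t - z t = 0"
    proof (rule linear_evolution_unique[where k = k and w = "\<lambda>t. v t - z t"])
      fix r :: real assume r: "r \<ge> 0"
      show "((\<lambda>t. v t - z t) has_vector_derivative - k r *\<^sub>R A (v r - z r)) (at r within {0..})"
        using has_vector_derivative_diff[OF vder[OF r] zd[OF r]] A_diff[OF vD[OF r] zD(1)[OF r]]
        by (simp add: scaleR_diff_right)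
      show "v r - z r \<in> D" using D_diff vD zD r by blast
    next
      show "v 0 - z 0 = 0" using v0 by (simp add: z_def S0 W_0_0)
    qed (use k0 t in auto)
    then show ?thesis by simp
  qed
  have kS: "k r = (1 + r) powr p * m (\<phi> (S r))" if r: "r \<ge> 0" for r
    using half_power_norm[OF vD[OF r]] phi_eq[OF Spos[OF r]] vz[OF r] by (simp add: k_def z_def)
  have d0: "((\<lambda>r. G (S r) - clock r) has_real_derivative 0) (at r)" if r: "r \<ge> 0" for r
  proof -
    have "h (S r) * k r = (1 + r) powr p"
      using m_pos[OF phi_nonneg, of "S r"] Spos[OF r] by (simp add: kS[OF r] h_def max_absorb2)
    then have "((\<lambda>r. G (S r)) has_real_derivative (1 + r) powr p) (at r)"
      using DERIV_chain2[OF G(1) Sd[OF r]] by simp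
    then show ?thesis using DERIV_diff[OF _ clock_derivative, of "\<lambda>r. G (S r)" _ r] r by fastforce
  qed
  have "G (S t) - clock t = G (S 0) - clock 0"
  proof (cases "t = 0")
    case False
    show ?thesis
    proof (rule DERIV_isconst_end[of 0 t "\<lambda>r. G (S r) - clock r"])
      show "continuous_on {0..t} (\<lambda>r. G (S r) - clock r)"
        using d0 by (intro continuous_at_imp_continuous_on ballI DERIV_isCont) auto
    qed (use False t d0 in auto)
  qed simp
  then have "S t = \<sigma> t" using G(2,3) by (simp add: S0 clock_0)
  then show ?thesis using vz[OF t] by (simp add: z_def)
qed

section \<open>The Cauchy problem: existence, regularity and decay\<close>

definition rate :: "(real \<Rightarrow> real) \<Rightarrow> real \<Rightarrow> real" where
  "rate \<sigma> t = (1 + t) powr p * m (\<phi> (\<sigma> t))"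

definition is_time_change :: "(real \<Rightarrow> real) \<Rightarrow> bool" where
  "is_time_change \<sigma> \<longleftrightarrow> \<sigma> 0 = 0 \<and> (\<forall>t\<ge>0. \<mu> * clock t \<le> \<sigma> t) \<and>
     (\<forall>t\<ge>0. (\<sigma> has_real_derivative rate \<sigma> t) (at t))"

context
  fixes \<sigma> assumes \<sigma>: "is_time_change \<sigma>"
begin

lemma sigma_derivative: "t \<ge> 0 \<Longrightarrow> (\<sigma> has_real_derivative rate \<sigma> t) (at t)"
  and sigma_0: "\<sigma> 0 = 0" and sigma_ge: "t \<ge> 0 \<Longrightarrow> \<mu> * clock t \<le> \<sigma> t"
  using \<sigma> by (auto simp: is_time_change_def)

lemma sigma_nonneg: "t \<ge> 0 \<Longrightarrow> 0 \<le> \<sigma> t"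
  using sigma_ge[of t] clock_nonneg[of t] mu_pos by (smt (verit) mult_nonneg_nonneg)

lemma sigma_pos: "t > 0 \<Longrightarrow> 0 < \<sigma> t"
  using sigma_ge[of t] mult_pos_pos[OF mu_pos clock_pos[of t]] by linarith

lemma sigma_continuous: "continuous_on {0..} \<sigma>"
  using sigma_derivative by (intro continuous_at_imp_continuous_on ballI DERIV_isCont) auto

lemma rate_continuous: "continuous_on {0..} (rate \<sigma>)"
proof -
  have "continuous_on {0..} (\<lambda>t. \<phi> (\<sigma> t))"
    by (rule continuous_on_compose2[OF phi_continuous sigma_continuous]) (use sigma_nonneg in auto)
  then have "continuous_on {0..} (\<lambda>t. m (\<phi> (\<sigma> t)))"
    by (rule continuous_on_compose2[OF m_cont]) (use phi_nonneg in auto)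
  then show ?thesis unfolding rate_def[abs_def] by (intro continuous_intros) auto
qed

lemma W_path_continuous:
  assumes "0 \<le> \<alpha>" "\<alpha> \<le> 1"
  shows "continuous_on {0..} (\<lambda>t. W \<alpha> (\<sigma> t) u0)"
  by (rule continuous_on_compose2[OF W_continuous[OF assms(1) u0_dom[OF assms]] sigma_continuous])
     (use sigma_nonneg in auto)

lemma solution_derivative:
  assumes "t \<ge> 0"
  shows "((\<lambda>t. W 0 (\<sigma> t) u0) has_vector_derivative - rate \<sigma> t *\<^sub>R W 1 (\<sigma> t) u0) (at t within {0..})"
  by (rule evolution_derivative[OF has_field_derivative_at_within[OF sigma_derivative[OF assms]] sigma_nonneg assms])

lemma solution_vector_derivative:
  assumes "t \<ge> 0"
  shows "vector_derivative (\<lambda>t. W 0 (\<sigma> t) u0) (at t within {0..}) = - rate \<sigma> t *\<^sub>R W 1 (\<sigma> t) u0"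
  by (rule vector_derivative_within[OF within_nontrivial[OF assms] solution_derivative[OF assms]])

lemma solution_exists: "is_global_solution D A p m u0 (\<lambda>t. W 0 (\<sigma> t) u0)"
  unfolding is_global_solution_def
proof (intro conjI allI impI)
  have "continuous_on {0..} (\<lambda>t. - rate \<sigma> t *\<^sub>R W 1 (\<sigma> t) u0)"
    by (intro continuous_on_scaleR continuous_on_minus rate_continuous W_path_continuous) auto
  then have "Ck_on (Suc 0) {0..} (\<lambda>t. W 0 (\<sigma> t) u0)"
    by (intro Ck_on_SucI[of _ _ "\<lambda>t. - rate \<sigma> t *\<^sub>R W 1 (\<sigma> t) u0"] solution_derivative) auto
  then show "Ck_on 1 {0..} (\<lambda>t. W 0 (\<sigma> t) u0)" by simp
  have "continuous_on {0..} (\<lambda>t. (W 0 (\<sigma> t) u0, W 1 (\<sigma> t) u0))"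
    by (intro continuous_on_Pair W_path_continuous) auto
  then have "continuous_on {0..} (\<lambda>t. (W 0 (\<sigma> t) u0, A (W 0 (\<sigma> t) u0)))"
    by (rule continuous_on_eq) (use semigroup_D(2) sigma_nonneg in auto)
  then show "Ck_into D A 0 {0..} (\<lambda>t. W 0 (\<sigma> t) u0)" using semigroup_D(1) sigma_nonneg by simp
  fix t :: real assume t: "0 \<le> t"
  then have "(1 / (1 + t) powr p) * rate \<sigma> t = m (\<phi> (\<sigma> t))" by (simp add: rate_def)
  then show "(1 / (1 + t) powr p) *\<^sub>R vector_derivative (\<lambda>t. W 0 (\<sigma> t) u0) (at t within {0..})
      + m ((norm (power_op D A (1 / 2) (W 0 (\<sigma> t) u0)))\<^sup>2) *\<^sub>R A (W 0 (\<sigma> t) u0) = 0"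
    unfolding solution_vector_derivative[OF t] phi_eq[OF sigma_nonneg[OF t]] semigroup_D(2)[OF sigma_nonneg[OF t]]
    by (simp flip: scaleR_add_left)
qed (simp add: sigma_0 W_0_0)

lemma W_path_derivative:
  assumes a: "0 \<le> \<alpha>" and t: "t \<in> {0<..}"
  shows "((\<lambda>t. W \<alpha> (\<sigma> t) u0) has_vector_derivative - rate \<sigma> t *\<^sub>R W (\<alpha> + 1) (\<sigma> t) u0) (at t within {0<..})"
proof -
  have "(\<sigma> has_vector_derivative rate \<sigma> t) (at t)"
    using sigma_derivative[of t] t by (simp add: has_real_derivative_iff_has_vector_derivative)
  moreover have "((\<lambda>r. W \<alpha> r u0) has_vector_derivative - W (\<alpha> + 1) (\<sigma> t) u0) (at (\<sigma> t))"
    by (rule W_derivative_pos[OF a sigma_pos]) (use t in simp)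
  ultimately have "((\<lambda>r. W \<alpha> r u0) \<circ> \<sigma> has_vector_derivative rate \<sigma> t *\<^sub>R - W (\<alpha> + 1) (\<sigma> t) u0) (at t)"
    by (rule vector_diff_chain_at)
  then show ?thesis by (simp add: o_def has_vector_derivative_at_within)
qed

lemma W_path_continuous_pos:
  assumes "0 \<le> \<alpha>" shows "continuous_on {0<..} (\<lambda>t. W \<alpha> (\<sigma> t) u0)"
  using W_path_derivative[OF assms]
  by (auto simp: continuous_on_eq_continuous_within intro: has_vector_derivative_continuous)

text \<open>
  The derivative is the rate times a sum of functions of the same kind, so one derivative
  is gained over the rate.
\<close>

lemma Ck_inner_path:
  assumes "0 \<le> \<alpha>" "0 \<le> \<beta>" "Ck_on k {0<..} (rate \<sigma>)"
  shows "Ck_on (Suc k) {0<..} (\<lambda>t. W \<alpha> (\<sigma> t) u0 \<bullet> W \<beta> (\<sigma> t) u0)"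
  using assms
proof (induction k arbitrary: \<alpha> \<beta>)
  have d: "((\<lambda>t. W \<alpha> (\<sigma> t) u0 \<bullet> W \<beta> (\<sigma> t) u0) has_vector_derivative
      (- 1) * rate \<sigma> t * (W \<alpha> (\<sigma> t) u0 \<bullet> W (\<beta> + 1) (\<sigma> t) u0 + W (\<alpha> + 1) (\<sigma> t) u0 \<bullet> W \<beta> (\<sigma> t) u0)) (at t within {0<..})"
    if "0 \<le> \<alpha>" "0 \<le> \<beta>" "t \<in> {0<..}" for \<alpha> \<beta> t
    unfolding has_vector_derivative_def
    by (rule has_derivative_eq_rhs[OF has_derivative_inner[OF
          W_path_derivative[OF that(1,3), unfolded has_vector_derivative_def]
          W_path_derivative[OF that(2,3), unfolded has_vector_derivative_def]]])
       (simp add: fun_eq_iff algebra_simps)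
  {
    case 0
    have "continuous_on {0<..} (\<lambda>t. (- 1) * rate \<sigma> t * (W \<alpha> (\<sigma> t) u0 \<bullet> W (\<beta> + 1) (\<sigma> t) u0 + W (\<alpha> + 1) (\<sigma> t) u0 \<bullet> W \<beta> (\<sigma> t) u0))"
      using 0 by (intro continuous_intros W_path_continuous_pos) auto
    then show ?case by (intro Ck_on_SucI[OF d[OF 0(1,2)]]) auto
  next
    case (Suc k)
    have r: "Ck_on k {0<..} (rate \<sigma>)" by (rule Ck_on_SucD[OF Suc.prems(3)])
    have "Ck_on (Suc k) {0<..} (\<lambda>t. (- 1) * rate \<sigma> t * (W \<alpha> (\<sigma> t) u0 \<bullet> W (\<beta> + 1) (\<sigma> t) u0 + W (\<alpha> + 1) (\<sigma> t) u0 \<bullet> W \<beta> (\<sigma> t) u0))"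
      by (intro Ck_on_mult Ck_on_add Ck_on_const Suc.IH Suc.prems r) (use Suc.prems in auto)
    then show ?case by (intro Ck_on_SucI[OF d[OF Suc.prems(1,2)]]) auto
  }
qed

text \<open>
  Bootstrap: if the rate is \<open>C\<^sup>k\<close> then \<open>\<phi> \<circ> \<sigma>\<close> is \<open>C\<^sup>k\<^sup>+\<^sup>1\<close>, and with \<open>m \<in> C\<^sup>k\<^sup>+\<^sup>1\<close> so is the
  rate.
\<close>

lemma Ck_rate:
  assumes "Ck_on k {0..} m"
  shows "Ck_on k {0<..} (rate \<sigma>)"
  using assms
proof (induction k)
  case 0
  have "continuous_on {0<..} (rate \<sigma>)" by (rule continuous_on_subset[OF rate_continuous]) auto
  then show ?case by simp
next
  case (Suc k)
  have "Ck_on k {0<..} (rate \<sigma>)" by (rule Suc.IH[OF Ck_on_SucD[OF Suc.prems]])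
  then have "Ck_on (Suc k) {0<..} (\<lambda>t. W (1/2) (\<sigma> t) u0 \<bullet> W (1/2) (\<sigma> t) u0)"
    by (intro Ck_inner_path) auto
  then have "Ck_on (Suc k) {0<..} (\<lambda>t. \<phi> (\<sigma> t))" by (simp only: \<phi>_def power2_norm_eq_inner)
  then have "Ck_on (Suc k) {0<..} (\<lambda>t. m (\<phi> (\<sigma> t)))"
    by (rule Ck_on_compose[OF Suc.prems]) (use phi_nonneg in auto)
  from Ck_on_mult[OF Ck_on_one_plus_powr this, of p] show ?case by (simp only: rate_def[abs_def])
qed

text \<open>
  Sums of such paths are closed under differentiation, which raises \<open>\<beta>\<close> by 1 or leaves it,
  and \<open>A\<^sup>\<alpha>\<close> raises \<open>\<beta>\<close> by \<open>\<alpha>\<close>; so induction on \<open>k\<close> works for all \<open>g\<close> and \<open>\<beta>\<close> at once.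
\<close>

lemma Ck_into_path:
  assumes a: "0 \<le> \<alpha>" and "0 \<le> \<beta>" "Ck_on k {0<..} g" "Ck_on k {0<..} (rate \<sigma>)"
  shows "Ck_into (power_dom D A \<alpha>) (power_op D A \<alpha>) k {0<..} (\<lambda>t. g t *\<^sub>R W \<beta> (\<sigma> t) u0)"
  using assms(2-)
proof (induction k arbitrary: \<beta> g)
  have dom: "W \<gamma> (\<sigma> t) u0 \<in> power_dom D A \<alpha>" and op: "power_op D A \<alpha> (W \<gamma> (\<sigma> t) u0) = W (\<alpha> + \<gamma>) (\<sigma> t) u0"
    if "0 \<le> \<gamma>" "t \<in> {0<..}" for \<gamma> t
    using W_in_power_dom[OF a that(1) sigma_pos[of t]] that by auto
  have dom': "x *\<^sub>R W \<gamma> (\<sigma> t) u0 \<in> power_dom D A \<alpha>"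
    and op': "power_op D A \<alpha> (x *\<^sub>R W \<gamma> (\<sigma> t) u0) = x *\<^sub>R W (\<alpha> + \<gamma>) (\<sigma> t) u0"
    if "0 \<le> \<gamma>" "t \<in> {0<..}" for \<gamma> t x
    using power_op_lin[OF a dom[OF that] dom[OF that], of x 0] op[OF that] by simp_all
  have dom2: "x *\<^sub>R W \<gamma> (\<sigma> t) u0 + y *\<^sub>R W \<delta> (\<sigma> t) u0 \<in> power_dom D A \<alpha>"
    and op2: "power_op D A \<alpha> (x *\<^sub>R W \<gamma> (\<sigma> t) u0 + y *\<^sub>R W \<delta> (\<sigma> t) u0) = x *\<^sub>R W (\<alpha> + \<gamma>) (\<sigma> t) u0 + y *\<^sub>R W (\<alpha> + \<delta>) (\<sigma> t) u0"
    if "0 \<le> \<gamma>" "0 \<le> \<delta>" "t \<in> {0<..}" for \<gamma> \<delta> t x y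
    using power_op_lin[OF a dom[OF that(1,3)] dom[OF that(2,3)], of x y] op[OF that(1,3)] op[OF that(2,3)] by simp_all
  {
    case 0
    have "continuous_on {0<..} (\<lambda>t. (g t *\<^sub>R W \<beta> (\<sigma> t) u0, g t *\<^sub>R W (\<alpha> + \<beta>) (\<sigma> t) u0))"
      using 0 a by (intro continuous_intros W_path_continuous_pos) auto
    then have "continuous_on {0<..} (\<lambda>t. (g t *\<^sub>R W \<beta> (\<sigma> t) u0, power_op D A \<alpha> (g t *\<^sub>R W \<beta> (\<sigma> t) u0)))"
      by (rule continuous_on_eq) (simp add: op'[OF 0(1)])
    then show ?case using dom'[OF 0(1)] by simp
  next
    case (Suc k)
    from Suc.prems(2) obtain g' where g': "\<And>t. t \<in> {0<..} \<Longrightarrow> (g has_vector_derivative g' t) (at t within {0<..})"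
      "Ck_on k {0<..} g'" by (rule Ck_on_SucE) blast
    have b1: "0 \<le> \<beta> + 1" using Suc.prems(1) by simp
    define u' where "u' t = g' t *\<^sub>R W \<beta> (\<sigma> t) u0 + (g t * ((- 1) * rate \<sigma> t)) *\<^sub>R W (\<beta> + 1) (\<sigma> t) u0" for t
    have r: "Ck_on k {0<..} (rate \<sigma>)" by (rule Ck_on_SucD[OF Suc.prems(3)])
    have "Ck_into (power_dom D A \<alpha>) (power_op D A \<alpha>) k {0<..} u'"
      unfolding u'_def[abs_def]
    proof (rule Ck_into_add)
      show "x + y \<in> power_dom D A \<alpha> \<and> power_op D A \<alpha> (x + y) = power_op D A \<alpha> x + power_op D A \<alpha> y"
        if "x \<in> power_dom D A \<alpha>" "y \<in> power_dom D A \<alpha>" for x y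
        using power_op_lin[OF a that, of 1 1] by simp
      show "Ck_into (power_dom D A \<alpha>) (power_op D A \<alpha>) k {0<..} (\<lambda>t. g' t *\<^sub>R W \<beta> (\<sigma> t) u0)"
        by (rule Suc.IH[OF Suc.prems(1) g'(2) r])
      show "Ck_into (power_dom D A \<alpha>) (power_op D A \<alpha>) k {0<..} (\<lambda>t. (g t * ((- 1) * rate \<sigma> t)) *\<^sub>R W (\<beta> + 1) (\<sigma> t) u0)"
        by (rule Suc.IH[OF b1 Ck_on_mult[OF Ck_on_SucD[OF Suc.prems(2)] Ck_on_mult[OF Ck_on_const r]] r])
    qed
    moreover have "((\<lambda>s. (g s *\<^sub>R W \<beta> (\<sigma> s) u0, power_op D A \<alpha> (g s *\<^sub>R W \<beta> (\<sigma> s) u0)))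
        has_vector_derivative (u' t, power_op D A \<alpha> (u' t))) (at t within {0<..})" if t: "t \<in> {0<..}" for t
    proof -
      have d: "((\<lambda>s. g s *\<^sub>R W \<gamma> (\<sigma> s) u0) has_vector_derivative
          g' t *\<^sub>R W \<gamma> (\<sigma> t) u0 + (g t * ((- 1) * rate \<sigma> t)) *\<^sub>R W (\<gamma> + 1) (\<sigma> t) u0) (at t within {0<..})"
        if "0 \<le> \<gamma>" for \<gamma>
      proof -
        have "(g has_real_derivative g' t) (at t within {0<..})"
          using g'(1)[OF t] by (simp add: has_real_derivative_iff_has_vector_derivative)
        from has_vector_derivative_scaleR[OF this W_path_derivative[OF that t]]
        show ?thesis by (simp add: add.commute)
      qed
      have "((\<lambda>s. (g s *\<^sub>R W \<beta> (\<sigma> s) u0, g s *\<^sub>R W (\<alpha> + \<beta>) (\<sigma> s) u0)) has_vector_derivative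
          (u' t, g' t *\<^sub>R W (\<alpha> + \<beta>) (\<sigma> t) u0 + (g t * ((- 1) * rate \<sigma> t)) *\<^sub>R W (\<alpha> + \<beta> + 1) (\<sigma> t) u0)) (at t within {0<..})"
        unfolding u'_def using d[OF Suc.prems(1)] d[of "\<alpha> + \<beta>"] a Suc.prems(1)
        by (intro has_vector_derivative_Pair) auto
      moreover have "power_op D A \<alpha> (u' t) = g' t *\<^sub>R W (\<alpha> + \<beta>) (\<sigma> t) u0 + (g t * ((- 1) * rate \<sigma> t)) *\<^sub>R W (\<alpha> + \<beta> + 1) (\<sigma> t) u0"
        unfolding u'_def op2[OF Suc.prems(1) b1 t] by (simp add: add.assoc)
      ultimately have "((\<lambda>s. (g s *\<^sub>R W \<beta> (\<sigma> s) u0, g s *\<^sub>R W (\<alpha> + \<beta>) (\<sigma> s) u0)) has_vector_derivative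
          (u' t, power_op D A \<alpha> (u' t))) (at t within {0<..})" by simp
      then show ?thesis
        by (rule has_vector_derivative_transform[OF t, rotated]) (simp add: op'[OF Suc.prems(1)])
    qed
    moreover have "u' t \<in> power_dom D A \<alpha>" if t: "t \<in> {0<..}" for t
      unfolding u'_def by (rule dom2[OF Suc.prems(1) b1 t])
    ultimately show ?case
      by (intro Ck_into_SucI[where u' = u'] dom'[OF Suc.prems(1)])
  }
qed

lemma solution_regularity:
  assumes a: "0 \<le> \<alpha>" and m: "Ck_on k {0..} m"
  shows "Ck_into (power_dom D A \<alpha>) (power_op D A \<alpha>) (Suc k) {0<..} (\<lambda>t. W 0 (\<sigma> t) u0)"
proof (rule Ck_into_SucI)
  let ?u' = "\<lambda>t. ((- 1) * rate \<sigma> t) *\<^sub>R W 1 (\<sigma> t) u0"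
  have r: "Ck_on k {0<..} (rate \<sigma>)" by (rule Ck_rate[OF m])
  show "Ck_into (power_dom D A \<alpha>) (power_op D A \<alpha>) k {0<..} ?u'"
    by (rule Ck_into_path[OF a _ Ck_on_mult[OF Ck_on_const r] r]) simp
  fix t :: real assume t: "t \<in> {0<..}"
  note pw = W_in_power_dom[OF a _ sigma_pos, of _ t u0]
  show "W 0 (\<sigma> t) u0 \<in> power_dom D A \<alpha>" using pw(1)[of 0] t by simp
  have W1: "W 1 (\<sigma> t) u0 \<in> power_dom D A \<alpha>" using pw(1)[of 1] t by simp
  then show "?u' t \<in> power_dom D A \<alpha>" using power_op_lin(1)[OF a W1 W1, of "- rate \<sigma> t" 0] by simp
  have op: "power_op D A \<alpha> (?u' t) = - rate \<sigma> t *\<^sub>R W (\<alpha> + 1) (\<sigma> t) u0"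
    using power_op_lin(2)[OF a W1 W1, of "- rate \<sigma> t" 0] pw(2)[of 1] t by simp
  have "((\<lambda>s. (W 0 (\<sigma> s) u0, W \<alpha> (\<sigma> s) u0)) has_vector_derivative (?u' t, power_op D A \<alpha> (?u' t))) (at t within {0<..})"
    unfolding op using W_path_derivative[OF a t] W_path_derivative[OF order_refl t]
    by (intro has_vector_derivative_Pair) auto
  then show "((\<lambda>s. (W 0 (\<sigma> s) u0, power_op D A \<alpha> (W 0 (\<sigma> s) u0))) has_vector_derivative
      (?u' t, power_op D A \<alpha> (?u' t))) (at t within {0<..})"
    by (rule has_vector_derivative_transform[OF t, rotated])
       (use W_in_power_dom(2)[OF a order_refl sigma_pos] in simp)
qed

text \<open>
  Each term on the left is a constant times \<open>exp(-2 c \<sigma>)\<close> at most, the last one because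
  \<open>u' / (1 + t)\<^sup>p = - m(\<phi>(\<sigma>)) A u\<close> with \<open>m \<circ> \<phi>\<close> bounded. The lower bound on \<open>\<sigma>\<close> does the
  rest.
\<close>

lemma solution_decay:
  assumes \<nu>: "0 \<le> \<nu>" "\<nu> \<le> c"
  shows "\<exists>C. \<forall>t\<ge>0.
     (norm (W 0 (\<sigma> t) u0))\<^sup>2 + (norm (power_op D A (1/2) (W 0 (\<sigma> t) u0)))\<^sup>2 + (norm (A (W 0 (\<sigma> t) u0)))\<^sup>2
       + (norm (vector_derivative (\<lambda>t. W 0 (\<sigma> t) u0) (at t within {0..})))\<^sup>2 / (1 + t) powr (2 * p)
     \<le> C * exp (- (2 * \<mu> * \<nu> / (1 + p)) * (1 + t) powr (1 + p))"
proof -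
  obtain M where M: "M > 0" "\<And>s. s \<ge> 0 \<Longrightarrow> m (\<phi> s) \<le> M" using m_bounded by blast
  define q where "q \<alpha> = (norm (W \<alpha> 0 u0))\<^sup>2" for \<alpha>
  define K where "K = q 0 + q (1/2) + (1 + M\<^sup>2) * q 1"
  have K0: "0 \<le> K" by (simp add: K_def q_def)
  have "(norm (W 0 (\<sigma> t) u0))\<^sup>2 + (norm (power_op D A (1/2) (W 0 (\<sigma> t) u0)))\<^sup>2 + (norm (A (W 0 (\<sigma> t) u0)))\<^sup>2
       + (norm (vector_derivative (\<lambda>t. W 0 (\<sigma> t) u0) (at t within {0..})))\<^sup>2 / (1 + t) powr (2 * p)
     \<le> (K * exp (2 * \<mu> * \<nu> / (1 + p))) * exp (- (2 * \<mu> * \<nu> / (1 + p)) * (1 + t) powr (1 + p))" if t: "t \<ge> 0" for t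
  proof -
    define s where "s = \<sigma> t"
    have s: "s \<ge> 0" by (simp add: s_def sigma_nonneg[OF t])
    define E where "E = exp (- 2 * c * s)"
    have dec: "(norm (W \<alpha> s u0))\<^sup>2 \<le> E * q \<alpha>" if "0 \<le> \<alpha>" "\<alpha> \<le> 1" for \<alpha>
    proof -
      have "(norm (W \<alpha> s u0))\<^sup>2 \<le> (exp (- c * s) * norm (W \<alpha> 0 u0))\<^sup>2"
        by (rule power_mono[OF W_decay[OF that(1) s u0_dom[OF that]]]) simp
      also have "\<dots> = E * q \<alpha>"
        by (simp add: power_mult_distrib q_def E_def flip: exp_double)
      finally show ?thesis .
    qed
    have der: "(norm (vector_derivative (\<lambda>t. W 0 (\<sigma> t) u0) (at t within {0..})))\<^sup>2 / (1 + t) powr (2 * p)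
        = (m (\<phi> s))\<^sup>2 * (norm (W 1 s u0))\<^sup>2"
    proof -
      have "(1 + t) powr (2 * p) = ((1 + t) powr p)\<^sup>2"
        by (simp add: power2_eq_square flip: powr_add)
      moreover have "(1 + t) powr p \<noteq> 0" using t by simp
      ultimately show ?thesis
        unfolding solution_vector_derivative[OF t] s_def[symmetric] rate_def by (simp add: power_mult_distrib)
    qed
    have "(m (\<phi> s))\<^sup>2 \<le> M\<^sup>2" using M(2)[OF s] m_pos[OF phi_nonneg, of s] by (intro power_mono) auto
    then have "(m (\<phi> s))\<^sup>2 * (norm (W 1 s u0))\<^sup>2 \<le> M\<^sup>2 * (E * q 1)"
      using dec[of 1] by (intro mult_mono) auto
    moreover have "(norm (power_op D A (1/2) (W 0 s u0)))\<^sup>2 \<le> E * q (1/2)"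
      using dec[of "1/2"] phi_eq[OF s] by (simp add: \<phi>_def)
    moreover have "(norm (A (W 0 s u0)))\<^sup>2 \<le> E * q 1" using dec[of 1] semigroup_D(2)[OF s] by simp
    moreover have "(norm (W 0 s u0))\<^sup>2 \<le> E * q 0" using dec[of 0] by simp
    moreover have "E * q 0 + E * q (1/2) + E * q 1 + M\<^sup>2 * (E * q 1) = K * E" by (simp add: K_def algebra_simps)
    ultimately have 1: "(norm (W 0 s u0))\<^sup>2 + (norm (power_op D A (1/2) (W 0 s u0)))\<^sup>2 + (norm (A (W 0 s u0)))\<^sup>2
        + (norm (vector_derivative (\<lambda>t. W 0 (\<sigma> t) u0) (at t within {0..})))\<^sup>2 / (1 + t) powr (2 * p) \<le> K * E"
      unfolding der by linarith
    have "\<nu> * (\<mu> * clock t) \<le> c * s"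
      using sigma_ge[OF t] \<nu> s mu_pos clock_nonneg[OF t] by (intro mult_mono) (auto simp: s_def)
    then have "E \<le> exp (- 2 * (\<nu> * (\<mu> * clock t)))" unfolding E_def by simp
    also have "- 2 * (\<nu> * (\<mu> * clock t)) = 2 * \<mu> * \<nu> / (1 + p) + - (2 * \<mu> * \<nu> / (1 + p)) * (1 + t) powr (1 + p)"
      by (simp add: clock_def diff_divide_distrib right_diff_distrib mult_ac)
    finally have "K * E \<le> K * (exp (2 * \<mu> * \<nu> / (1 + p)) * exp (- (2 * \<mu> * \<nu> / (1 + p)) * (1 + t) powr (1 + p)))"
      using K0 unfolding exp_add by (rule mult_left_mono)
    then show ?thesis using 1 unfolding s_def by (simp add: mult.assoc)
  qed
  then show ?thesis by blast
qed

end

end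

section \<open>The theorem\<close>

lemma locally_lipschitz_imp_continuous_on:
  assumes "locally_lipschitz_on S f"
  shows "continuous_on S f"
  unfolding continuous_on_eq_continuous_within
proof
  fix x assume x: "x \<in> S"
  then obtain e L where e: "e > 0" "L-lipschitz_on (cball x e \<inter> S) f"
    using assms unfolding locally_lipschitz_on_def by blast
  from e(2) have "continuous_on (cball x e \<inter> S) f" by (rule lipschitz_on_continuous_on)
  then have "continuous (at x within cball x e \<inter> S) f"
    using x e(1) by (simp add: continuous_on_eq_continuous_within)
  moreover have "at x within cball x e \<inter> S = at x within S"
    by (rule at_within_nhd[of x "ball x e"]) (use e(1) in auto)
  ultimately show "continuous (at x within S) f" by simp
qed

text \<open>
  If the infimum is \<open>\<infinity>\<close>, then \<open>D\<close> contains no unit vector and every \<open>c\<close> is a coercivity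
  constant; \<open>real_of_ereal\<close> gives 0 in that case.
\<close>

lemma numerical_inf_coercive:
  fixes D :: "'a::real_inner set"
  assumes lin: "linear_operator_on D A" and pos: "numerical_inf D A > 0"
  obtains c where "c > 0" "0 \<le> real_of_ereal (numerical_inf D A)" "real_of_ereal (numerical_inf D A) \<le> c"
    "\<And>x. x \<in> D \<Longrightarrow> c * (norm x)\<^sup>2 \<le> A x \<bullet> x"
proof -
  let ?n = "numerical_inf D A"
  have key: "r * (norm x)\<^sup>2 \<le> A x \<bullet> x" if x: "x \<in> D" and r: "ereal r \<le> ?n" for x r
  proof (cases "x = 0")
    case True
    then show ?thesis by simp
  next
    case False
    define y where "y = (1 / norm x) *\<^sub>R x"
    have y: "y \<in> D" "norm y = 1" "A y = (1 / norm x) *\<^sub>R A x"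
      using x lin False unfolding y_def linear_operator_on_def by (auto simp: subspace_scale)
    then have "?n \<le> ereal (A y \<bullet> y)" unfolding numerical_inf_def by (intro INF_lower) auto
    then have "ereal r \<le> ereal (A y \<bullet> y)" using r by (rule order_trans[rotated])
    moreover have "A y \<bullet> y = (A x \<bullet> x) / (norm x)\<^sup>2"
      unfolding y(3) by (simp add: y_def power2_eq_square)
    ultimately show ?thesis using False by (simp add: pos_le_divide_eq)
  qed
  show thesis
  proof (cases ?n)
    case (real r)
    then show ?thesis using that[of r] key[of _ r] pos by simp
  next
    case PInf
    then show ?thesis using that[of 1] key[of _ 1] by simp
  next
    case MInf
    then show ?thesis using pos by simp
  qed
qed

theorem theorem2p1:
  fixes D :: "'a::{real_inner, complete_space} set"
    and A :: "'a \<Rightarrow> 'a"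
    and u0 :: 'a
    and p \<mu> :: real
    and \<nu> :: ereal
    and m :: "real \<Rightarrow> real"
  assumes "self_adjoint_operator D A"
    and "u0 \<in> D"
    and "p \<ge> 0"
    and "\<And>\<sigma>. \<sigma> \<ge> 0 \<Longrightarrow> m \<sigma> > 0"
    and "locally_lipschitz_on {0..} m"
    and "\<mu> = (INF \<sigma>\<in>{0..}. m \<sigma>)" and "\<mu> > 0"
    and "\<nu> = numerical_inf D A" and "\<nu> > 0"
  shows "\<exists>u. is_global_solution D A p m u0 u \<and>
      (\<forall>v. is_global_solution D A p m u0 v \<longrightarrow> (\<forall>t\<ge>0. v t = u t)) \<and>
      (\<forall>\<alpha>\<ge>0. Ck_into (power_dom D A \<alpha>) (power_op D A \<alpha>) 1 {0<..} u) \<and>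
      (\<forall>k. Ck_on k {0..} m \<longrightarrow>
         (\<forall>\<alpha>\<ge>0. Ck_into (power_dom D A \<alpha>) (power_op D A \<alpha>) (Suc k) {0<..} u)) \<and>
      (\<exists>C. \<forall>t\<ge>0.
         (norm (u t))\<^sup>2 + (norm (power_op D A (1/2) (u t)))\<^sup>2 + (norm (A (u t)))\<^sup>2
           + (norm (vector_derivative u (at t within {0..})))\<^sup>2 / (1 + t) powr (2 * p)
         \<le> C * exp (- (2 * \<mu> * real_of_ereal \<nu> / (1 + p)) * (1 + t) powr (1 + p)))"
proof -
  have lin: "linear_operator_on D A" using assms(1) by (simp add: self_adjoint_operator_def)
  obtain c where c: "c > 0" "0 \<le> real_of_ereal \<nu>" "real_of_ereal \<nu> \<le> c"
    "\<And>x. x \<in> D \<Longrightarrow> c * (norm x)\<^sup>2 \<le> A x \<bullet> x"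
    unfolding assms(8) by (rule numerical_inf_coercive[OF lin assms(9)[unfolded assms(8)]]) blast
  have m_cont: "continuous_on {0..} m" by (rule locally_lipschitz_imp_continuous_on[OF assms(5)])
  interpret kirchhoff_cauchy D A c u0 p \<mu> m
  proof unfold_locales
    fix \<sigma> :: real assume "\<sigma> \<ge> 0"
    moreover have "bdd_below (m ` {0..})" by (rule bdd_belowI[of _ 0]) (use assms(4) less_imp_le in auto)
    ultimately show "\<mu> \<le> m \<sigma>" unfolding assms(6) by (intro cINF_lower) auto
  qed (use assms c m_cont in auto)
  obtain G \<sigma> where G: "\<And>s. (G has_real_derivative h s) (at s)" "G 0 = 0" "\<And>t. G (\<sigma> t) = clock t"
    "\<And>s t. G s = clock t \<Longrightarrow> s = \<sigma> t"
    and \<sigma>: "\<sigma> 0 = 0" "\<And>t. t \<ge> 0 \<Longrightarrow> \<mu> * clock t \<le> \<sigma> t"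
    "\<And>t. t \<ge> 0 \<Longrightarrow> (\<sigma> has_real_derivative (1 + t) powr p * m (\<phi> (\<sigma> t))) (at t)"
    by (rule time_change) blast
  have tc: "is_time_change \<sigma>" using \<sigma> by (simp add: is_time_change_def rate_def)
  show ?thesis
  proof (intro exI[of _ "\<lambda>t. W 0 (\<sigma> t) u0"] conjI allI impI)
    show "is_global_solution D A p m u0 (\<lambda>t. W 0 (\<sigma> t) u0)" by (rule solution_exists[OF tc])
    show "v t = W 0 (\<sigma> t) u0" if "is_global_solution D A p m u0 v" "0 \<le> t" for v t
      by (rule solution_unique[OF G(1,2,4) that])
    show "Ck_into (power_dom D A \<alpha>) (power_op D A \<alpha>) 1 {0<..} (\<lambda>t. W 0 (\<sigma> t) u0)" if "0 \<le> \<alpha>" for \<alpha>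
      using solution_regularity[OF tc that, of 0] m_cont by simp
    show "Ck_into (power_dom D A \<alpha>) (power_op D A \<alpha>) (Suc k) {0<..} (\<lambda>t. W 0 (\<sigma> t) u0)"
      if "Ck_on k {0..} m" "0 \<le> \<alpha>" for k \<alpha>
      by (rule solution_regularity[OF tc that(2,1)])
    show "\<exists>C. \<forall>t\<ge>0.
         (norm (W 0 (\<sigma> t) u0))\<^sup>2 + (norm (power_op D A (1/2) (W 0 (\<sigma> t) u0)))\<^sup>2 + (norm (A (W 0 (\<sigma> t) u0)))\<^sup>2
           + (norm (vector_derivative (\<lambda>t. W 0 (\<sigma> t) u0) (at t within {0..})))\<^sup>2 / (1 + t) powr (2 * p)
         \<le> C * exp (- (2 * \<mu> * real_of_ereal \<nu> / (1 + p)) * (1 + t) powr (1 + p))"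
      by (rule solution_decay[OF tc c(2,3)])
  qed
qed

end
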